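(* Let $(\mathfrak g,\mathfrak k)$ be a supersymmetric pair as in the context. Suppose that the supertrace of $\operatorname{ad}x$ (acting on $\mathfrak k$) is $0$ for every $x\in\mathfrak k$. Then $$(\mathcal U\mathfrak g)^{\mathfrak k}\cap\mathfrak k\,\mathcal U\mathfrak g=(\mathcal U\mathfrak g)^{\mathfrak k}\cap(\mathcal U\mathfrak g)\,\mathfrak k .$$
   Context: $\mathfrak g$ is a finite-dimensional complex Kac-Moody (contragredient) Lie superalgebra (for example $\mathfrak{sl}(m|n)$ with $m\neq n$, $\mathfrak{gl}(n|n)$, $\mathfrak{osp}(m|2n)$) with a nondegenerate invariant form; $\theta$ is an involution of $\mathfrak g$ preserving the form, $\mathfrak k$ is its fixed-point subalgebra and $\mathfrak p$ its $(-1)$-eigenspace, so $\mathfrak g=\mathfrak k\oplus\mathfrak p$. $\mathcal U\mathfrak g$ is the universal enveloping algebra, and $(\mathcal U\mathfrak g)^{\mathfrak k}$ denotes the invariants of the adjoint action of $\mathfrak k$ on $\mathcal U\mathfrak g$. *)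

theory Defs
  imports
    "HOL-Library.Z2"
    "HOL-Library.Poly_Mapping"
    "HOL-Algebra.Algebraic_Closure_Type"
    "HOL-Algebra.QuotRing"
    "HOL-Algebra.Ideal_Product"
    "Jordan_Normal_Form.DL_Rank"
begin

section \<open>Lie superalgebras over the complex numbers\<close>

text \<open>Parities are elements of the two-element field \<^typ>\<open>bit\<close>. The scalar below is
  $(-1)^{ij}$.\<close>

definition koszul :: "bit \<Rightarrow> bit \<Rightarrow> 'a::ring_1" where
  "koszul i j = (if i = 1 \<and> j = 1 then - 1 else 1)"

locale super_vector_space = vector_space scale
  for scale :: "complex \<Rightarrow> 'g::ab_group_add \<Rightarrow> 'g" +
  fixes part :: "bit \<Rightarrow> 'g set"
  assumes subspace_part: "subspace (part i)"
    and part_disjoint: "part 0 \<inter> part 1 = {0}"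
    and part_sum: "\<exists>y\<in>part 0. \<exists>z\<in>part 1. x = y + z"
begin

definition graded_subspace :: "'g set \<Rightarrow> bool" where
  "graded_subspace V \<longleftrightarrow> subspace V \<and>
     (\<forall>x\<in>V. \<exists>y\<in>V \<inter> part 0. \<exists>z\<in>V \<inter> part 1. x = y + z)"

definition finite_dim :: bool where
  "finite_dim \<longleftrightarrow> (\<exists>B. finite B \<and> span B = UNIV)"

definition part_basis :: "'g set \<Rightarrow> bit \<Rightarrow> 'g set" where
  "part_basis V i = (SOME B. independent B \<and> span B = V \<inter> part i)"

text \<open>Supertrace of a linear map preserving a finite-dimensional graded subspace \<open>V\<close>: trace of
  the even-even block minus trace of the odd-odd block, read off in a homogeneous basis of \<open>V\<close>.\<close>

definition supertrace_on :: "'g set \<Rightarrow> ('g \<Rightarrow> 'g) \<Rightarrow> complex" where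
  "supertrace_on V T =
     (let B0 = part_basis V 0; B1 = part_basis V 1 in
       (\<Sum>b\<in>B0. representation (B0 \<union> B1) (T b) b) -
       (\<Sum>b\<in>B1. representation (B0 \<union> B1) (T b) b))"

end

locale lie_superalgebra = super_vector_space scale part
  for scale :: "complex \<Rightarrow> 'g::ab_group_add \<Rightarrow> 'g" and part :: "bit \<Rightarrow> 'g set" +
  fixes br :: "'g \<Rightarrow> 'g \<Rightarrow> 'g"
  assumes br_linear_right: "Vector_Spaces.linear scale scale (br x)"
    and br_linear_left: "Vector_Spaces.linear scale scale (\<lambda>y. br y x)"
    and br_part: "x \<in> part i \<Longrightarrow> y \<in> part j \<Longrightarrow> br x y \<in> part (i + j)"
    and br_skew: "x \<in> part i \<Longrightarrow> y \<in> part j \<Longrightarrow> br x y = - scale (koszul i j) (br y x)"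
    and br_jacobi: "x \<in> part i \<Longrightarrow> y \<in> part j \<Longrightarrow> z \<in> part l \<Longrightarrow>
          br x (br y z) = br (br x y) z + scale (koszul i j) (br y (br x z))"
begin

definition graded_ideal :: "'g set \<Rightarrow> bool" where
  "graded_ideal I \<longleftrightarrow> graded_subspace I \<and> (\<forall>x y. y \<in> I \<longrightarrow> br x y \<in> I)"

text \<open>\<open>(\<hh>, \<alpha>, c)\<close> is a realization of the \<open>n \<times> n\<close> matrix \<open>A\<close>: \<open>c i\<close> are the simple coroots and
  \<open>\<alpha> i\<close> the simple roots, linear functionals on \<open>\<hh>\<close> given by functions whose values off \<open>\<hh>\<close> are
  irrelevant.\<close>

definition realization ::
  "nat \<Rightarrow> complex mat \<Rightarrow> 'g set \<Rightarrow> (nat \<Rightarrow> 'g \<Rightarrow> complex) \<Rightarrow> (nat \<Rightarrow> 'g) \<Rightarrow> bool" where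
  "realization n A \<hh> \<alpha> c \<longleftrightarrow>
     A \<in> carrier_mat n n \<and> subspace \<hh> \<and> dim \<hh> + vec_space.rank n A = 2 * n \<and>
     (\<forall>i<n. c i \<in> \<hh>) \<and> inj_on c {..<n} \<and> independent (c ` {..<n}) \<and>
     (\<forall>i<n. \<forall>x\<in>\<hh>. \<forall>y\<in>\<hh>. \<forall>a b.
        \<alpha> i (scale a x + scale b y) = a * \<alpha> i x + b * \<alpha> i y) \<and>
     (\<forall>a. (\<forall>x\<in>\<hh>. (\<Sum>i<n. a i * \<alpha> i x) = 0) \<longrightarrow> (\<forall>i<n. a i = 0)) \<and>
     (\<forall>i<n. \<forall>j<n. \<alpha> j (c i) = A $$ (i, j))"

text \<open>The algebra is the contragredient Lie superalgebra of some matrix \<open>A\<close> and parity function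
  \<open>p\<close>, i.e. the quotient of the Lie superalgebra given by the generators \<open>\<hh>, e i, f i\<close> and the
  Chevalley relations below by its largest graded ideal meeting \<open>\<hh>\<close> trivially. Being such a
  quotient means that it is generated by \<open>\<hh>, e i, f i\<close>, that the relations hold, and that no
  nonzero graded ideal meets \<open>\<hh>\<close> trivially.\<close>

definition contragredient :: bool where
  "contragredient \<longleftrightarrow>
    (\<exists>n A (p :: nat \<Rightarrow> bit) \<hh> \<alpha> c e f.
       realization n A \<hh> \<alpha> c \<and> \<hh> \<subseteq> part 0 \<and>
       (\<forall>i<n. e i \<in> part (p i) \<and> f i \<in> part (p i)) \<and>
       (\<forall>x\<in>\<hh>. \<forall>y\<in>\<hh>. br x y = 0) \<and>
       (\<forall>i<n. \<forall>x\<in>\<hh>. br x (e i) = scale (\<alpha> i x) (e i) \<and>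
                    br x (f i) = - scale (\<alpha> i x) (f i)) \<and>
       (\<forall>i<n. \<forall>j<n. br (e i) (f j) = (if i = j then c i else 0)) \<and>
       (\<forall>S. subspace S \<and> (\<forall>x\<in>S. \<forall>y\<in>S. br x y \<in> S) \<and> \<hh> \<subseteq> S \<and> e ` {..<n} \<subseteq> S \<and> f ` {..<n} \<subseteq> S
            \<longrightarrow> S = UNIV) \<and>
       (\<forall>I. graded_ideal I \<and> I \<inter> \<hh> = {0} \<longrightarrow> I = {0}))"

definition nondegenerate_invariant_form :: "('g \<Rightarrow> 'g \<Rightarrow> complex) \<Rightarrow> bool" where
  "nondegenerate_invariant_form \<beta> \<longleftrightarrow>
     (\<forall>x. Vector_Spaces.linear scale (*) (\<beta> x)) \<and>
     (\<forall>x. Vector_Spaces.linear scale (*) (\<lambda>y. \<beta> y x)) \<and>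
     (\<forall>x\<in>part 0. \<forall>y\<in>part 1. \<beta> x y = 0) \<and>
     (\<forall>i j. \<forall>x\<in>part i. \<forall>y\<in>part j. \<beta> x y = koszul i j * \<beta> y x) \<and>
     (\<forall>x y z. \<beta> (br x y) z = \<beta> x (br y z)) \<and>
     (\<forall>x. (\<forall>y. \<beta> x y = 0) \<longrightarrow> x = 0)"

definition superalgebra_involution :: "('g \<Rightarrow> 'g) \<Rightarrow> bool" where
  "superalgebra_involution \<theta> \<longleftrightarrow>
     Vector_Spaces.linear scale scale \<theta> \<and> (\<forall>i. \<theta> ` part i \<subseteq> part i) \<and>
     (\<forall>x y. \<theta> (br x y) = br (\<theta> x) (\<theta> y)) \<and> (\<forall>x. \<theta> (\<theta> x) = x)"

end

locale kac_moody_superalgebra = lie_superalgebra +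
  assumes finite_dim: "finite_dim"
    and contragredient: "contragredient"

locale supersymmetric_pair = kac_moody_superalgebra scale part br
  for scale :: "complex \<Rightarrow> 'g::ab_group_add \<Rightarrow> 'g" and part :: "bit \<Rightarrow> 'g set"
    and br :: "'g \<Rightarrow> 'g \<Rightarrow> 'g" +
  fixes \<beta> :: "'g \<Rightarrow> 'g \<Rightarrow> complex" and \<theta> :: "'g \<Rightarrow> 'g"
  assumes form: "nondegenerate_invariant_form \<beta>"
    and involution: "superalgebra_involution \<theta>"
    and involution_form: "\<beta> (\<theta> x) (\<theta> y) = \<beta> x y"

definition fixed_subalgebra :: "('g \<Rightarrow> 'g) \<Rightarrow> 'g set" where
  "fixed_subalgebra \<theta> = {x. \<theta> x = x}"

section \<open>The universal enveloping algebra\<close>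

text \<open>Words form a free monoid, written additively as the exponent monoid of
  \<^typ>\<open>'a \<Rightarrow>\<^sub>0 'b\<close>; hence \<open>'g letters \<Rightarrow>\<^sub>0 complex\<close> is the free associative unital algebra on
  the set of all elements of \<open>'g\<close>.\<close>

datatype 'g letters = Letters (letter_list: "'g list")

instantiation letters :: (type) monoid_add
begin

definition zero_letters :: "'a letters" where
  "zero_letters = Letters []"

definition plus_letters :: "'a letters \<Rightarrow> 'a letters \<Rightarrow> 'a letters" where
  "plus_letters v w = Letters (letter_list v @ letter_list w)"

instance
  by standard (simp_all add: zero_letters_def plus_letters_def)

end

type_synonym 'g free_alg = "'g letters \<Rightarrow>\<^sub>0 complex"

definition gen :: "'g \<Rightarrow> 'g free_alg" where
  "gen x = Poly_Mapping.single (Letters [x]) 1"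

definition const :: "complex \<Rightarrow> 'g free_alg" where
  "const a = Poly_Mapping.single 0 a"

definition free_ring :: "'g free_alg ring" where
  "free_ring = ring_of_type_algebra"

text \<open>The first two families of relations cut the free algebra down to the tensor algebra of the
  vector space \<open>'g\<close>. As constants belong to the free algebra, ring ideals are algebra ideals.\<close>

definition env_relations ::
  "(complex \<Rightarrow> 'g::ab_group_add \<Rightarrow> 'g) \<Rightarrow> (bit \<Rightarrow> 'g set) \<Rightarrow> ('g \<Rightarrow> 'g \<Rightarrow> 'g) \<Rightarrow> 'g free_alg set" where
  "env_relations scale part br =
     {gen (x + y) - gen x - gen y | x y. True} \<union>
     {gen (scale a x) - const a * gen x | a x. True} \<union>
     {gen x * gen y - koszul i j * gen y * gen x - gen (br x y) | i j x y.
        x \<in> part i \<and> y \<in> part j}"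

definition env_ideal ::
  "(complex \<Rightarrow> 'g::ab_group_add \<Rightarrow> 'g) \<Rightarrow> (bit \<Rightarrow> 'g set) \<Rightarrow> ('g \<Rightarrow> 'g \<Rightarrow> 'g) \<Rightarrow> 'g free_alg set" where
  "env_ideal scale part br = genideal free_ring (env_relations scale part br)"

definition envelope ::
  "(complex \<Rightarrow> 'g::ab_group_add \<Rightarrow> 'g) \<Rightarrow> (bit \<Rightarrow> 'g set) \<Rightarrow> ('g \<Rightarrow> 'g \<Rightarrow> 'g) \<Rightarrow> 'g free_alg set ring" where
  "envelope scale part br = FactRing free_ring (env_ideal scale part br)"

definition env_class ::
  "(complex \<Rightarrow> 'g::ab_group_add \<Rightarrow> 'g) \<Rightarrow> (bit \<Rightarrow> 'g set) \<Rightarrow> ('g \<Rightarrow> 'g \<Rightarrow> 'g) \<Rightarrow>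
     'g free_alg \<Rightarrow> 'g free_alg set" where
  "env_class scale part br t = a_r_coset free_ring (env_ideal scale part br) t"

definition env_map ::
  "(complex \<Rightarrow> 'g::ab_group_add \<Rightarrow> 'g) \<Rightarrow> (bit \<Rightarrow> 'g set) \<Rightarrow> ('g \<Rightarrow> 'g \<Rightarrow> 'g) \<Rightarrow>
     'g \<Rightarrow> 'g free_alg set" where
  "env_map scale part br x = env_class scale part br (gen x)"

text \<open>A word has parity \<open>i\<close> when its letters are homogeneous with parities summing to \<open>i\<close>. Words
  in nonhomogeneous letters have no parity, but their classes in the enveloping algebra are sums
  of classes of words that do.\<close>

fun word_parity :: "(bit \<Rightarrow> 'g set) \<Rightarrow> bit \<Rightarrow> 'g list \<Rightarrow> bool" where
  "word_parity part i [] \<longleftrightarrow> i = 0"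
| "word_parity part i (x # xs) \<longleftrightarrow> (\<exists>j. x \<in> part j \<and> word_parity part (i - j) xs)"

definition env_part ::
  "(complex \<Rightarrow> 'g::ab_group_add \<Rightarrow> 'g) \<Rightarrow> (bit \<Rightarrow> 'g set) \<Rightarrow> ('g \<Rightarrow> 'g \<Rightarrow> 'g) \<Rightarrow>
     bit \<Rightarrow> 'g free_alg set set" where
  "env_part scale part br i =
     env_class scale part br ` {t. \<forall>w\<in>Poly_Mapping.keys t. word_parity part i (letter_list w)}"

definition component :: "(bit \<Rightarrow> 'g::ab_group_add set) \<Rightarrow> bit \<Rightarrow> 'g \<Rightarrow> 'g" where
  "component part i x = (THE y. y \<in> part i \<and> (\<exists>z\<in>part (i + 1). x = y + z))"

definition env_component ::
  "(complex \<Rightarrow> 'g::ab_group_add \<Rightarrow> 'g) \<Rightarrow> (bit \<Rightarrow> 'g set) \<Rightarrow> ('g \<Rightarrow> 'g \<Rightarrow> 'g) \<Rightarrow>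
     bit \<Rightarrow> 'g free_alg set \<Rightarrow> 'g free_alg set" where
  "env_component scale part br i u =
     (THE v. v \<in> env_part scale part br i \<and>
        (\<exists>w\<in>env_part scale part br (i + 1). u = v \<oplus>\<^bsub>envelope scale part br\<^esub> w))"

text \<open>The adjoint action $x \cdot u = x u - (-1)^{|x||u|} u x$, extended biadditively from
  homogeneous elements.\<close>

definition env_ad ::
  "(complex \<Rightarrow> 'g::ab_group_add \<Rightarrow> 'g) \<Rightarrow> (bit \<Rightarrow> 'g set) \<Rightarrow> ('g \<Rightarrow> 'g \<Rightarrow> 'g) \<Rightarrow>
     'g \<Rightarrow> 'g free_alg set \<Rightarrow> 'g free_alg set" where
  "env_ad scale part br x u =
     (let U = envelope scale part br;
          a = (\<lambda>i. env_map scale part br (component part i x));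
          v = (\<lambda>j. env_component scale part br j u)
      in \<Oplus>\<^bsub>U\<^esub>i\<in>{0, 1}. \<Oplus>\<^bsub>U\<^esub>j\<in>{0, 1}.
           (a i \<otimes>\<^bsub>U\<^esub> v j) \<ominus>\<^bsub>U\<^esub>
           (env_class scale part br (koszul i j) \<otimes>\<^bsub>U\<^esub> (v j \<otimes>\<^bsub>U\<^esub> a i)))"

definition env_invariants ::
  "(complex \<Rightarrow> 'g::ab_group_add \<Rightarrow> 'g) \<Rightarrow> (bit \<Rightarrow> 'g set) \<Rightarrow> ('g \<Rightarrow> 'g \<Rightarrow> 'g) \<Rightarrow>
     'g set \<Rightarrow> 'g free_alg set set" where
  "env_invariants scale part br K =
     {u \<in> carrier (envelope scale part br).
        \<forall>x\<in>K. env_ad scale part br x u = \<zero>\<^bsub>envelope scale part br\<^esub>}"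

text \<open>\<open>K U\<close> and \<open>U K\<close>: the sets of finite sums of products. The library's \<^const>\<open>ideal_prod\<close> is
  the closure of the set of products of two arbitrary subsets under addition.\<close>

definition env_right_ideal ::
  "(complex \<Rightarrow> 'g::ab_group_add \<Rightarrow> 'g) \<Rightarrow> (bit \<Rightarrow> 'g set) \<Rightarrow> ('g \<Rightarrow> 'g \<Rightarrow> 'g) \<Rightarrow>
     'g set \<Rightarrow> 'g free_alg set set" where
  "env_right_ideal scale part br K =
     ideal_prod (envelope scale part br) (env_map scale part br ` K) (carrier (envelope scale part br))"

definition env_left_ideal ::
  "(complex \<Rightarrow> 'g::ab_group_add \<Rightarrow> 'g) \<Rightarrow> (bit \<Rightarrow> 'g set) \<Rightarrow> ('g \<Rightarrow> 'g \<Rightarrow> 'g) \<Rightarrow>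
     'g set \<Rightarrow> 'g free_alg set set" where
  "env_left_ideal scale part br K =
     ideal_prod (envelope scale part br) (carrier (envelope scale part br)) (env_map scale part br ` K)"

end

theory Submission
  imports Defs
begin

text \<open>
  Write $U = F/J$ with $F$ the free algebra. Contracting the coproduct of $U$ with linear
  functionals shows that symmetrization $S(\bar{\mathfrak p}) \otimes S(\bar{\mathfrak k}) \to U$ is
  bijective, where the bars denote images in $U$. This is the Poincare-Birkhoff-Witt theorem for
  the image of $\mathfrak g$ in $U$, which suffices because the kernel of $\mathfrak g \to U$ is
  central and so does not contribute to supertraces.
  Since symmetrization is $\mathfrak k$-equivariant and bijective, an invariant of $U\mathfrak k$
  is the image of an \<^emph>\<open>invariant\<close> tensor $\sum_j v_j \otimes x_j \in U \otimes \bar{\mathfrak k}$,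
  $(x_j)$ a basis, even though $\mathfrak k$ need not act semisimply. Up to signs,
  $\sum_j v_j x_j - \sum_j x_j v_j = - \sum_j [x_j, v_j]$, and contracting the invariance equations
  turns the right-hand side into a combination of supertraces of $\mathrm{ad}\, x$ on
  $\mathfrak k$, hence into $0$. The opposite inclusion is the mirror image.
\<close>

section \<open>The free algebra\<close>

text \<open>Injectivity rests on derivatives. Contracting with a functional that vanishes at 1 and
  is dual to a basis letter \<open>b\<close> shortens words by at least one letter and acts on the
  leading term as the superderivation dual to \<open>b\<close>. A supersymmetric tensor of positive
  degree all of whose derivatives vanish is zero, because the multiplicities m + 1 that arise are
  invertible in characteristic 0. Induction on the degree then gives linear independence without
  first building a faithful module of \<open>U\<close>. The coproduct itself is never formed: the
  contraction is defined on words, and only its compatibility with \<open>J\<close> is checked.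
  Bijectivity is what turns invariance modulo \<open>J\<close> into exact equations between
  coordinates. For left multiples of k the letters of k are written first, so that the coordinates
  live on words beginning in k; for right multiples they are written last. This is why the
  symmetrization is studied for two unspecified groups of letters \<open>Q1\<close>,
  \<open>Q2\<close>. Signs such as (-1)^{|x||t|} are carried by the parity automorphism, so that
  \<open>t\<close> need not be homogeneous.\<close>

declare Z2.add_bit_eq_xor [simp del]

lemma bit_add_self [simp]: "i + i = (0 :: bit)"
  by (cases i) simp_all

lemma koszul_simps [simp]:
  "koszul 0 i = 1" "koszul i 0 = 1" "koszul 1 1 = - 1"
  by (simp_all add: koszul_def)

lemma koszul_sym: "koszul i j = koszul j i"
  by (simp add: koszul_def)

lemma koszul_add_left: "koszul (i + j) l = koszul i l * koszul j l"
  by (cases i; cases j; cases l) simp_all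

lemma koszul_add_right: "koszul l (i + j) = koszul l i * koszul l j"
  by (cases i; cases j; cases l) simp_all

lemma koszul_self_inverse [simp]: "koszul i j * koszul i j = 1"
  by (cases i; cases j) simp_all

lemma koszul_self_inverse_left [simp]: "koszul i j * (koszul i j * a) = a"
  by (cases i; cases j) simp_all

definition wprod :: "'g list \<Rightarrow> 'g free_alg" where
  "wprod w = Poly_Mapping.single (Letters w) 1"

lemma wprod_Nil [simp]: "wprod [] = 1"
  by (simp add: wprod_def flip: zero_letters_def)

lemma wprod_append: "wprod (v @ w) = wprod v * wprod w"
  by (simp add: wprod_def mult_single plus_letters_def)

lemma wprod_Cons: "wprod (x # w) = gen x * wprod w"
  by (simp add: wprod_def gen_def mult_single plus_letters_def)

lemma wprod_single: "wprod [x] = gen x"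
  by (simp add: wprod_Cons)

lemma const_wprod: "const a * wprod w = Poly_Mapping.single (Letters w) a"
  by (simp add: const_def wprod_def mult_single)

lemma wprod_expansion: "t = (\<Sum>w\<in>Poly_Mapping.keys t. const (Poly_Mapping.lookup t w) * wprod
    (letter_list w))"
proof (rule poly_mapping_eqI)
  fix k
  have "Poly_Mapping.lookup (\<Sum>w\<in>Poly_Mapping.keys t. const (Poly_Mapping.lookup t w) * wprod
      (letter_list w)) k
      = (\<Sum>w\<in>Poly_Mapping.keys t. if w = k then Poly_Mapping.lookup t w else 0)"
    by (simp add: lookup_sum const_wprod lookup_single when_def)
  also have "\<dots> = Poly_Mapping.lookup t k"
    by (simp add: in_keys_iff)
  finally show "Poly_Mapping.lookup t k = Poly_Mapping.lookup
      (\<Sum>w\<in>Poly_Mapping.keys t. const (Poly_Mapping.lookup t w) * wprod (letter_list w)) k"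
    by simp
qed

lemma const_0 [simp]: "const 0 = 0"
  and const_1 [simp]: "const 1 = 1"
  by (simp_all add: const_def)

lemma const_add: "const (a + b) = const a + const b"
  and const_diff: "const (a - b) = const a - const b"
  and const_uminus: "const (- a) = - const a"
  and const_mult: "const (a * b) = const a * const b"
  by (simp_all add: const_def single_add single_diff single_uminus mult_single)

lemma const_commute: "const a * t = t * const a"
proof -
  have "const a * wprod w = wprod w * const a" for w :: "'a list"
    by (simp add: const_def wprod_def mult_single)
  moreover have "const a * const b = const b * (const a :: 'a free_alg)" for b
    by (simp add: mult.commute flip: const_mult)
  ultimately have "const a * (const b * wprod w) = const b * wprod w * const a"
    for b and w :: "'a list"
    by (metis mult.assoc)
  then have "const a * (\<Sum>w\<in>A. const (f w) * wprod (letter_list w)) =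
      (\<Sum>w\<in>A. const (f w) * wprod (letter_list w)) * const a"
    for A :: "'a letters set" and f
    by (simp add: sum_distrib_left sum_distrib_right)
  from this[of "Poly_Mapping.lookup t" "Poly_Mapping.keys t"] show ?thesis
    by (simp only: wprod_expansion[of t, symmetric])
qed

lemma const_left_commute: "t * (const a * s) = const a * (t * s)"
  by (metis const_commute mult.assoc)

lemma const_koszul [simp]: "const (koszul i j) = koszul i j"
  by (simp add: koszul_def const_uminus)

interpretation F: vector_space "\<lambda>a (t :: 'g free_alg). const a * t"
  by unfold_locales (simp_all add: algebra_simps const_add const_mult)

text \<open>The scalar multiplication \<open>s\<close> is a parameter because the targets differ:
  the free algebra for \<open>env_hom\<close> and \<open>contract\<close>, the Lie superalgebra
  itself for \<open>adj\<close>.\<close>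

definition ext :: "(complex \<Rightarrow> 'v \<Rightarrow> 'v) \<Rightarrow> ('g list \<Rightarrow> 'v) \<Rightarrow> 'g free_alg \<Rightarrow> 'v::ab_group_add" where
  "ext s h t = (\<Sum>w\<in>Poly_Mapping.keys t. s (Poly_Mapping.lookup t w) (h (letter_list w)))"

abbreviation "F_linear \<equiv> Vector_Spaces.linear (\<lambda>a t. const a * t)"

lemma linear_ext:
  assumes "vector_space s"
  shows "F_linear s (ext s h)"
proof -
  interpret vector_space s by fact
  have *: "ext s h t = (\<Sum>w\<in>A. s (Poly_Mapping.lookup t w) (h (letter_list w)))"
    if "finite A" "Poly_Mapping.keys t \<subseteq> A" for A t
    unfolding ext_def using that by (intro sum.mono_neutral_left) (auto simp: in_keys_iff)
  have "ext s h (t + t') = ext s h t + ext s h t'" for t t'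
    using Poly_Mapping.keys_add[of t t']
    by (simp add: *[of "Poly_Mapping.keys t \<union> Poly_Mapping.keys t'"] lookup_add
        scale_left_distrib sum.distrib)
  moreover have "ext s h (const a * t) = s a (ext s h t)" for a t
  proof -
    have l: "Poly_Mapping.lookup (const a * t) k = a * Poly_Mapping.lookup t k" for k
      unfolding const_def mult_map_scale_conv_mult[symmetric] by (simp add: map.rep_eq when_def)
    then show ?thesis
      by (subst *[of "Poly_Mapping.keys t"]) (auto simp: in_keys_iff ext_def scale_sum_right)
  qed
  ultimately show ?thesis
    by unfold_locales auto
qed

lemma ext_wprod [simp]:
  assumes "vector_space s"
  shows "ext s h (wprod w) = h w"
proof -
  interpret vector_space s by fact
  show ?thesis by (simp add: ext_def wprod_def)
qed

lemma F_induct [case_names zero add scale word]: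
  assumes "P 0" "\<And>s t. P s \<Longrightarrow> P t \<Longrightarrow> P (s + t)" "\<And>a t. P t \<Longrightarrow> P (const a * t)"
    and "\<And>w. P (wprod w)"
  shows "P (t :: 'g free_alg)"
proof -
  have "(\<Sum>w\<in>A. const (Poly_Mapping.lookup t w) * wprod (letter_list w)) \<in> Collect P" for A
    using assms by (induction A rule: infinite_finite_induct) auto
  then show ?thesis
    by (metis wprod_expansion mem_Collect_eq)
qed

lemma F_linear_intros:
  shows "F_linear (\<lambda>a t. const a * t) (\<lambda>t. s * t)"
    and "F_linear (\<lambda>a t. const a * t) (\<lambda>t. t * s)"
  by (unfold_locales; simp add: algebra_simps const_left_commute)+

section \<open>The defining ideal of the enveloping algebra\<close>

context super_vector_space
begin

lemma part_0 [simp]: "0 \<in> part i"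
  using subspace_part subspace_0 by blast

lemma part_inter: "x \<in> part i \<Longrightarrow> x \<in> part (i + 1) \<Longrightarrow> x = 0"
  using part_disjoint by (cases i) auto

lemma part_add: "x \<in> part i \<Longrightarrow> y \<in> part i \<Longrightarrow> x + y \<in> part i"
  and part_diff: "x \<in> part i \<Longrightarrow> y \<in> part i \<Longrightarrow> x - y \<in> part i"
  and part_scale: "x \<in> part i \<Longrightarrow> scale a x \<in> part i"
  using subspace_part by (auto intro: subspace_add subspace_diff subspace_scale)

lemma component_eqI:
  assumes "y \<in> part i" "z \<in> part (i + 1)" "x = y + z"
  shows "component part i x = y"
  unfolding component_def
proof (rule the_equality)
  fix y' assume "y' \<in> part i \<and> (\<exists>z\<in>part (i + 1). x = y' + z)"
  then obtain z' where z': "y' \<in> part i" "z' \<in> part (i + 1)" "x = y' + z'" by blast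
  then have "y' - y = z - z'" using assms(3) by (simp add: algebra_simps)
  then have "y' - y = 0"
    using part_inter[of "y' - y" i] part_diff assms(1,2) z'(1,2) by metis
  then show "y' = y" by simp
qed (use assms in auto)

lemma component_decomp:
  "component part i x \<in> part i \<and> component part (i + 1) x \<in> part (i + 1) \<and>
   component part i x + component part (i + 1) x = x"
proof -
  obtain y z where yz: "y \<in> part 0" "z \<in> part 1" "x = y + z" using part_sum by blast
  then have "component part 0 x = y" "component part 1 x = z"
    by (auto intro: component_eqI simp: add.commute)
  then show ?thesis using yz by (cases i) (auto simp: add.commute)
qed

lemma component_in [simp]: "component part i x \<in> part i"
  using component_decomp by blast

lemma component_sum: "component part 0 x + component part 1 x = x"
  using component_decomp[of 0 x] by simp

lemma component_add: "component part i (x + y) = component part i x + component part i y"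
  by (rule component_eqI[where z = "component part (i + 1) x + component part (i + 1) y"])
    (use component_decomp[of i x] component_decomp[of i y] in \<open>auto intro: part_add simp:
        algebra_simps\<close>)

lemma component_scale: "component part i (scale a x) = scale a (component part i x)"
  by (rule component_eqI[where z = "scale a (component part (i + 1) x)"])
    (use component_decomp[of i x] in \<open>auto intro: part_scale simp flip: scale_right_distrib\<close>)

lemma component_of_part: "x \<in> part j \<Longrightarrow> component part i x = (if i = j then x else 0)"
  by (cases "i = j"; cases i; cases j)
    (auto intro: component_eqI[where z = 0] component_eqI[where z = x])

end

lemma ring_free_ring: "ring (free_ring :: 'g free_alg ring)"
proof -
  have "\<exists>y. x + y = 0" for x :: "'g free_alg"
    using add.right_inverse by blast
  then show ?thesis
    unfolding free_ring_def ring_of_type_algebra_def using add.right_inverse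
    by unfold_locales (auto simp: algebra_simps Units_def)
qed

lemma free_ring_simps [simp]:
  "carrier free_ring = UNIV" "\<zero>\<^bsub>free_ring\<^esub> = 0" "\<one>\<^bsub>free_ring\<^esub> = 1"
  "s \<oplus>\<^bsub>free_ring\<^esub> t = s + t" "s \<otimes>\<^bsub>free_ring\<^esub> t = s * t"
  by (simp_all add: free_ring_def ring_of_type_algebra_def)

lemma a_inv_free_ring [simp]: "\<ominus>\<^bsub>free_ring\<^esub> t = - t"
proof -
  interpret ring "free_ring :: 'a free_alg ring" by (rule ring_free_ring)
  show ?thesis by (rule minus_equality) auto
qed

lemma a_minus_free_ring [simp]: "s \<ominus>\<^bsub>free_ring\<^esub> t = s - t"
  by (simp add: a_minus_def)

section \<open>Endomorphisms of the free algebra induced by maps of letters\<close>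

definition env_hom :: "('g \<Rightarrow> 'h) \<Rightarrow> 'g free_alg \<Rightarrow> 'h free_alg" where
  "env_hom \<phi> = ext (\<lambda>a t. const a * t) (\<lambda>w. wprod (map \<phi> w))"

lemma linear_env_hom: "F_linear (\<lambda>a t. const a * t) (env_hom \<phi>)"
  unfolding env_hom_def by (rule linear_ext) unfold_locales

interpretation env_hom: Vector_Spaces.linear "\<lambda>a t. const a * t" "\<lambda>a t. const a * t" "env_hom \<phi>"
  by (rule linear_env_hom)

lemma env_hom_wprod [simp]: "env_hom \<phi> (wprod w) = wprod (map \<phi> w)"
  unfolding env_hom_def by (rule ext_wprod) unfold_locales

lemma env_hom_gen [simp]: "env_hom \<phi> (gen x) = gen (\<phi> x)"
  using env_hom_wprod[of \<phi> "[x]"] by (simp add: wprod_single)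

lemma env_hom_1 [simp]: "env_hom \<phi> 1 = 1"
  using env_hom_wprod[of \<phi> "[]"] by simp

lemma env_hom_const [simp]: "env_hom \<phi> (const a) = const a"
  using env_hom.scale[of \<phi> a 1] by simp

lemma env_hom_mult [simp]: "env_hom \<phi> (s * t) = env_hom \<phi> s * env_hom \<phi> t"
proof -
  have *: "env_hom \<phi> (wprod v * t) = wprod (map \<phi> v) * env_hom \<phi> t" for v
    by (induction t rule: F_induct)
      (simp_all add: env_hom.zero env_hom.add env_hom.scale distrib_left const_left_commute
        flip: wprod_append map_append)
  show ?thesis
    by (induction s rule: F_induct)
      (simp_all add: * env_hom.zero env_hom.add env_hom.scale distrib_right mult.assoc)
qed

lemma env_hom_koszul [simp]: "env_hom \<phi> (koszul i j) = koszul i j"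
  using env_hom_const[of \<phi> "koszul i j"] by simp

context lie_superalgebra
begin

abbreviation J :: "'g free_alg set" where
  "J \<equiv> env_ideal scale part br"

lemma ideal_J: "ideal J free_ring"
  unfolding env_ideal_def using ring_free_ring by (intro ring.genideal_ideal) auto

lemma J_0 [simp]: "0 \<in> J"
  using additive_subgroup.zero_closed[OF ideal.axioms(1)[OF ideal_J]] by simp

lemma J_add: "s \<in> J \<Longrightarrow> t \<in> J \<Longrightarrow> s + t \<in> J"
  using additive_subgroup.a_closed[OF ideal.axioms(1)[OF ideal_J]] by simp

lemma J_mult_left: "t \<in> J \<Longrightarrow> s * t \<in> J"
  using ideal.I_l_closed[OF ideal_J] by simp

lemma J_mult_right: "t \<in> J \<Longrightarrow> t * s \<in> J"
  using ideal.I_r_closed[OF ideal_J] by simp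

lemma subspace_J: "F.subspace J"
  by (rule F.subspaceI) (auto intro: J_add J_mult_left)

lemma J_relation: "r \<in> env_relations scale part br \<Longrightarrow> r \<in> J"
  unfolding env_ideal_def using ring.genideal_self[OF ring_free_ring]
  by (metis free_ring_simps(1) subset_UNIV subsetD)

text \<open>The induction principle for \<open>J\<close>: to show that a map sends \<open>J\<close>
  into a subspace, take the preimage of that subspace as \<open>S\<close>. Closure under single
  letters suffices because words are products of letters and span the free algebra.\<close>

lemma J_minimal:
  assumes "env_relations scale part br \<subseteq> S" "F.subspace S"
    and l: "\<And>x t. t \<in> S \<Longrightarrow> gen x * t \<in> S" and r: "\<And>x t. t \<in> S \<Longrightarrow> t * gen x \<in> S"
  shows "J \<subseteq> S"
proof -
  note S = F.subspace_0[OF assms(2)] F.subspace_add[OF assms(2)] F.subspace_scale[OF assms(2)]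
  have 1: "wprod w * t \<in> S" if "t \<in> S" for w t
    using that by (induction w) (auto simp: wprod_Cons mult.assoc intro: l)
  have 2: "t * wprod w \<in> S" if "t \<in> S" for w t
    using that by (induction w arbitrary: t) (auto simp: wprod_Cons r simp flip: mult.assoc)
  have 3: "s * t \<in> S" if "t \<in> S" for s t
    by (induction s rule: F_induct) (auto simp: distrib_right mult.assoc that 1 S)
  have 4: "t * s \<in> S" if "t \<in> S" for s t
    by (induction s rule: F_induct) (auto simp: distrib_left const_left_commute that 2 S)
  have "ideal S free_ring"
  proof (rule idealI[OF ring_free_ring])
    show "subgroup S (add_monoid free_ring)"
    proof (rule subgroup.intro)
      fix s assume "s \<in> S"
      then show "inv\<^bsub>add_monoid free_ring\<^esub> s \<in> S"
        unfolding a_inv_def[symmetric] using F.subspace_neg[OF assms(2)] by simp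
    qed (use S in auto)
  qed (use 3 4 in auto)
  then show ?thesis
    unfolding env_ideal_def using ring.genideal_minimal[OF ring_free_ring] assms(1) by blast
qed

definition cong :: "'g free_alg \<Rightarrow> 'g free_alg \<Rightarrow> bool" (infix "\<approx>" 50) where
  "s \<approx> t \<longleftrightarrow> s - t \<in> J"

lemma cong_0_iff: "t \<approx> 0 \<longleftrightarrow> t \<in> J"
  by (simp add: cong_def)

lemma cong_refl [simp]: "t \<approx> t"
  by (simp add: cong_def)

lemma cong_sym: "s \<approx> t \<Longrightarrow> t \<approx> s"
  unfolding cong_def using F.subspace_neg[OF subspace_J, of "s - t"] by simp

lemma cong_trans [trans]: "r \<approx> s \<Longrightarrow> s \<approx> t \<Longrightarrow> r \<approx> t"
  unfolding cong_def using J_add[of "r - s" "s - t"] by simp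

lemma cong_trans_eq1 [trans]: "r = s \<Longrightarrow> s \<approx> t \<Longrightarrow> r \<approx> t"
  and cong_trans_eq2 [trans]: "r \<approx> s \<Longrightarrow> s = t \<Longrightarrow> r \<approx> t"
  by simp_all

lemma cong_J_iff: "s \<approx> t \<Longrightarrow> s \<in> J \<longleftrightarrow> t \<in> J"
  by (metis cong_0_iff cong_sym cong_trans)

lemma cong_add: "s \<approx> s' \<Longrightarrow> t \<approx> t' \<Longrightarrow> s + t \<approx> s' + t'"
  unfolding cong_def using J_add[of "s - s'" "t - t'"] by (simp add: algebra_simps)

lemma cong_uminus: "s \<approx> s' \<Longrightarrow> - s \<approx> - s'"
  using cong_sym[of s s'] by (simp add: cong_def)

lemma cong_diff: "s \<approx> s' \<Longrightarrow> t \<approx> t' \<Longrightarrow> s - t \<approx> s' - t'"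
  using cong_add[of s s' "- t" "- t'"] cong_uminus by simp

lemma cong_mult: "s \<approx> s' \<Longrightarrow> t \<approx> t' \<Longrightarrow> s * t \<approx> s' * t'"
proof -
  assume "s \<approx> s'" "t \<approx> t'"
  then have "(s - s') * t + s' * (t - t') \<in> J"
    unfolding cong_def by (intro J_add J_mult_left J_mult_right)
  then show ?thesis by (simp add: cong_def algebra_simps)
qed

lemma cong_sum: "(\<And>i. i \<in> I \<Longrightarrow> f i \<approx> g i) \<Longrightarrow> sum f I \<approx> sum g I"
  by (induction I rule: infinite_finite_induct) (simp_all add: cong_add)

lemma gen_add: "gen (x + y) \<approx> gen x + gen y"
proof -
  have "gen (x + y) - gen x - gen y \<in> J"
    by (rule J_relation) (auto simp: env_relations_def)
  then show ?thesis by (simp add: cong_def algebra_simps)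
qed

lemma gen_scale: "gen (scale a x) \<approx> const a * gen x"
  unfolding cong_def by (rule J_relation) (auto simp: env_relations_def)

lemma gen_0: "gen 0 \<approx> 0"
  using gen_scale[of 0] by simp

lemma gen_sum: "gen (\<Sum>i\<in>I. f i) \<approx> (\<Sum>i\<in>I. gen (f i))"
proof (induction I rule: infinite_finite_induct)
  case (insert i I)
  then have "gen (f i + sum f I) \<approx> gen (f i) + (\<Sum>i\<in>I. gen (f i))"
    by (intro cong_trans[OF gen_add] cong_add) auto
  then show ?case using insert by simp
qed (simp_all add: gen_0)

lemma gen_br: "x \<in> part i \<Longrightarrow> y \<in> part j \<Longrightarrow>
    gen x * gen y \<approx> koszul i j * gen y * gen x + gen (br x y)"
proof -
  assume "x \<in> part i" "y \<in> part j"
  then have "gen x * gen y - koszul i j * gen y * gen x - gen (br x y) \<in> J"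
    by (intro J_relation) (auto simp: env_relations_def)
  then show ?thesis by (simp add: cong_def algebra_simps)
qed

lemma env_hom_J:
  assumes add: "\<And>x y. \<phi> (x + y) = \<phi> x + \<phi> y" and sc: "\<And>a x. \<phi> (scale a x) = scale a (\<phi> x)"
    and part: "\<And>i x. x \<in> part i \<Longrightarrow> \<phi> x \<in> part i"
    and br: "\<And>x y. \<phi> (br x y) = br (\<phi> x) (\<phi> y)" and t: "t \<in> J"
  shows "env_hom \<phi> t \<in> J"
proof -
  have "J \<subseteq> {t. env_hom \<phi> t \<in> J}"
  proof (rule J_minimal)
    show "env_relations scale part br \<subseteq> {t. env_hom \<phi> t \<in> J}"
    proof
      fix r assume "r \<in> env_relations scale part br"
      then have "env_hom \<phi> r \<in> env_relations scale part br"
        unfolding env_relations_def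
        by (elim UnE CollectE exE conjE; clarsimp simp: env_hom.diff add sc br; metis part)
      then show "r \<in> {t. env_hom \<phi> t \<in> J}" using J_relation by simp
    qed
    show "F.subspace {t. env_hom \<phi> t \<in> J}"
      by (rule F.subspaceI) (auto simp: env_hom.zero env_hom.add env_hom.scale J_add J_mult_left)
  qed (auto intro: J_mult_left J_mult_right)
  then show ?thesis using t by auto
qed

section \<open>The parity automorphism\<close>

definition signed :: "'g \<Rightarrow> 'g" where
  "signed x = component part 0 x - component part 1 x"

text \<open>The operator (-1)^{i|t|}, available for every \<open>t\<close>, homogeneous or not. It
  lets the Koszul sign rule be stated without splitting \<open>t\<close> into its even and odd
  parts.\<close>

definition eps :: "bit \<Rightarrow> 'g free_alg \<Rightarrow> 'g free_alg" where
  "eps i t = (if i = 1 then env_hom signed t else t)"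

lemma signed_part: "x \<in> part i \<Longrightarrow> signed x = scale (koszul 1 i) x"
  by (cases i) (simp_all add: signed_def component_of_part)

lemma signed_add: "signed (x + y) = signed x + signed y"
  and signed_scale: "signed (scale a x) = scale a (signed x)"
  by (simp_all add: signed_def component_add component_scale scale_right_diff_distrib)

lemma br_add_right: "br x (y + z) = br x y + br x z"
  and br_scale_right: "br x (scale a y) = scale a (br x y)"
  and br_0_right [simp]: "br x 0 = 0"
proof -
  interpret Vector_Spaces.linear scale scale "br x" by (rule br_linear_right)
  show "br x (y + z) = br x y + br x z" "br x (scale a y) = scale a (br x y)" "br x 0 = 0"
    by (simp_all add: add scale zero)
qed

lemma br_add_left: "br (y + z) x = br y x + br z x"
  and br_scale_left: "br (scale a y) x = scale a (br y x)"
  and br_0_left [simp]: "br 0 x = 0"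
proof -
  interpret Vector_Spaces.linear scale scale "\<lambda>y. br y x" by (rule br_linear_left)
  show "br (y + z) x = br y x + br z x" "br (scale a y) x = scale a (br y x)" "br 0 x = 0"
    using add[of y z] scale[of a y] zero by simp_all
qed

lemma signed_br: "signed (br x y) = br (signed x) (signed y)"
proof -
  have *: "signed (br (component part i x) (component part j y)) =
      br (signed (component part i x)) (signed (component part j y))" for i j
  proof -
    have "br (component part i x) (component part j y) \<in> part (i + j)"
      by (rule br_part) auto
    then show ?thesis
      unfolding signed_part[OF component_in] br_scale_left br_scale_right scale_scale
      by (simp only: signed_part koszul_add_right mult.commute)
  qed
  have "signed (br (component part 0 x + component part 1 x) (component part 0 y +
      component part 1 y)) =
      br (signed (component part 0 x + component part 1 x)) (signed (component part 0 y +
          component part 1 y))"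
    by (simp add: br_add_left br_add_right signed_add *)
  then show ?thesis by (simp add: component_sum)
qed

lemma eps_J: "t \<in> J \<Longrightarrow> eps i t \<in> J"
  unfolding eps_def
  by (auto intro!: env_hom_J simp: signed_add signed_scale signed_br signed_part part_scale)

lemma eps_0 [simp]: "eps 0 t = t"
  and eps_zero [simp]: "eps i 0 = 0"
  and eps_add: "eps i (s + t) = eps i s + eps i t"
  and eps_diff: "eps i (s - t) = eps i s - eps i t"
  and eps_mult: "eps i (s * t) = eps i s * eps i t"
  and eps_const [simp]: "eps i (const a) = const a"
  and eps_1 [simp]: "eps i 1 = 1"
  by (simp_all add: eps_def env_hom.add env_hom.diff env_hom.zero)

lemma eps_sum: "eps i (sum f A) = (\<Sum>x\<in>A. eps i (f x))"
  by (induction A rule: infinite_finite_induct) (simp_all add: eps_add)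

lemma eps_cong: "s \<approx> t \<Longrightarrow> eps i s \<approx> eps i t"
  unfolding cong_def using eps_J[of "s - t" i] by (simp add: eps_diff)

lemma eps_gen: "x \<in> part j \<Longrightarrow> eps i (gen x) \<approx> const (koszul i j) * gen x"
  by (cases i) (simp_all add: eps_def signed_part gen_scale del: const_koszul)

lemma eps_eps: "eps i (eps i t) \<approx> t"
proof (cases "i = 1")
  case True
  have "signed (signed x) = x" for x
  proof -
    have "signed (signed (component part 0 x + component part 1 x))
        = component part 0 x + component part 1 x"
      unfolding signed_add signed_part[OF component_in] signed_scale by simp
    then show ?thesis by (simp add: component_sum)
  qed
  then have "map (signed \<circ> signed) w = w" for w
    by (simp add: map_idI)
  then have "env_hom signed (env_hom signed t) = t" for t
    by (induction t rule: F_induct) (simp_all add: env_hom.zero env_hom.add)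
  then show ?thesis by (simp add: eps_def)
qed (simp add: eps_def)

subsection \<open>The kernel of the canonical map is central\<close>

text \<open>The adjoint representation, extended to an action of the free algebra on the Lie
  superalgebra. The vector acted on is the first argument, so that linearity in the free algebra is
  linearity of \<open>adj y\<close>.\<close>

definition adj :: "'g \<Rightarrow> 'g free_alg \<Rightarrow> 'g" where
  "adj y = ext scale (\<lambda>w. foldr br w y)"

lemma linear_adj: "F_linear scale (adj y)"
  unfolding adj_def by (rule linear_ext) (rule vector_space_axioms)

lemma adj_wprod: "adj y (wprod w) = foldr br w y"
  unfolding adj_def by (rule ext_wprod) (rule vector_space_axioms)

lemma adj_mult: "adj y (s * t) = adj (adj y t) s"
proof -
  interpret adj: Vector_Spaces.linear "\<lambda>a t. const a * t" scale "adj u" for u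
    by (rule linear_adj)
  have fold_add: "foldr br w (y + z) = foldr br w y + foldr br w z" for w y z
    by (induction w) (simp_all add: br_add_right)
  have fold_scale: "foldr br w (scale a y) = scale a (foldr br w y)" for w y a
    by (induction w) (simp_all add: br_scale_right)
  have fold_0: "foldr br w 0 = 0" for w
    by (induction w) simp_all
  have *: "adj y (wprod v * t) = foldr br v (adj y t)" for v
    by (induction t rule: F_induct)
      (simp_all add: adj.zero adj.add adj.scale distrib_left const_left_commute fold_add fold_scale
        fold_0 adj_wprod flip: wprod_append)
  show ?thesis
    by (induction s rule: F_induct)
      (simp_all add: * adj.zero adj.add adj.scale distrib_right mult.assoc adj_wprod)
qed

text \<open>The adjoint representation annihilates the defining relations, the bracket relation by
  the Jacobi identity, and hence all of \<open>J\<close>. A letter whose class in \<open>U\<close>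
  is zero therefore acts by zero.\<close>

lemma gen_J_central:
  assumes "gen x \<in> J"
  shows "br x y = 0"
proof -
  interpret adj: Vector_Spaces.linear "\<lambda>a t. const a * t" scale "adj u" for u
    by (rule linear_adj)
  have gen: "adj y (gen x) = br x y" for x y
    using adj_wprod[of y "[x]"] by (simp add: wprod_single)
  have adj_const: "adj y (const a) = scale a y" for y a
    using adj.scale[of y a 1] adj_wprod[of y "[]"] by simp
  have adj_koszul: "adj y (koszul i j) = scale (koszul i j) y" for y i j
    using adj_const[of y "koszul i j"] by simp
  \<comment> \<open>The Jacobi identity is given for homogeneous \<open>z\<close>; splitting
    \<open>z\<close> into components extends it. The sign stands in the innermost argument because
    the reversed \<open>br_scale_right\<close> moves it there below.\<close>
  have jac: "br x (br y z) - br y (br x (scale (koszul i j) z)) = br (br x y) z"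
    if "x \<in> part i" "y \<in> part j" for x y z i j
  proof -
    have *: "br x (br y (component part l z)) =
        scale (koszul i j) (br y (br x (component part l z))) + br (br x y) (component part l z)"
            for l
      using br_jacobi[OF that, of "component part l z" l] by (simp add: add.commute)
    have "br x (br y (component part 0 z + component part 1 z)) =
        scale (koszul i j) (br y (br x (component part 0 z + component part 1 z)))
        + br (br x y) (component part 0 z + component part 1 z)"
      unfolding br_add_right *  by (simp add: scale_right_distrib)
    then show ?thesis by (simp add: component_sum br_scale_right)
  qed
  have "J \<subseteq> {t. \<forall>y. adj y t = 0}"
  proof (rule J_minimal)
    show "env_relations scale part br \<subseteq> {t. \<forall>y. adj y t = 0}"
      by (auto simp: env_relations_def adj.diff adj.scale gen br_add_left br_scale_left adj_const
          adj_koszul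
          adj_mult br_scale_right[symmetric] jac)
    show "F.subspace {t. \<forall>y. adj y t = 0}"
      by (rule F.subspaceI) (auto simp: adj.zero adj.add adj.scale)
  qed (auto simp: adj_mult gen)
  then show ?thesis using assms gen by (metis (mono_tags) mem_Collect_eq subsetD)
qed

section \<open>The augmentation\<close>

lemma lookup_gen_mult: "Poly_Mapping.lookup (gen x * t) 0 = 0"
    "Poly_Mapping.lookup (t * gen x) 0 = 0"
proof -
  have "0 \<notin> Poly_Mapping.keys (gen x * t)" "0 \<notin> Poly_Mapping.keys (t * gen x)"
    using keys_mult[of "gen x" t] keys_mult[of t "gen x"]
    by (auto simp: gen_def zero_letters_def plus_letters_def split: if_splits)
  then show "Poly_Mapping.lookup (gen x * t) 0 = 0" "Poly_Mapping.lookup (t * gen x) 0 = 0"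
    by (simp_all add: in_keys_iff)
qed

lemma lookup_gen: "Poly_Mapping.lookup (gen x) 0 = 0"
  using lookup_gen_mult(1)[of x 1] by simp

lemma lookup_const_mult: "Poly_Mapping.lookup (const c * t) w = c * Poly_Mapping.lookup t w"
  unfolding const_def mult_map_scale_conv_mult[symmetric] by (simp add: map.rep_eq when_def)

text \<open>No relation has a constant term, and multiplying by a letter never creates one. So the
  constants embed in \<open>U\<close>, which is the base of the injectivity induction.\<close>

lemma lookup_J:
  assumes "t \<in> J"
  shows "Poly_Mapping.lookup t 0 = 0"
proof -
  have "J \<subseteq> {t. Poly_Mapping.lookup t 0 = 0}"
  proof (rule J_minimal)
    show "env_relations scale part br \<subseteq> {t. Poly_Mapping.lookup t 0 = 0}"
      by (auto simp: env_relations_def lookup_minus lookup_gen_mult lookup_gen)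
    show "F.subspace {t. Poly_Mapping.lookup t 0 = 0}"
      by (rule F.subspaceI) (auto simp: lookup_add lookup_const_mult)
  qed (auto simp: lookup_gen_mult)
  then show ?thesis using assms by auto
qed

lemma const_in_J_iff: "const a \<in> J \<longleftrightarrow> a = 0"
  using lookup_J[of "const a"] by (auto simp: const_def)

end

context lie_superalgebra
begin

section \<open>Contraction of the coproduct with a functional\<close>

definition env_functional :: "('g free_alg \<Rightarrow> complex) \<Rightarrow> bool" where
  "env_functional \<xi> \<longleftrightarrow> (\<forall>s t. \<xi> (s + t) = \<xi> s + \<xi> t) \<and> (\<forall>a t. \<xi> (const a * t) = a * \<xi> t) \<and>
     (\<forall>t\<in>J. \<xi> t = 0)"

lemma env_functional_mult: "env_functional \<xi> \<Longrightarrow> env_functional (\<lambda>t. \<xi> (s * t))"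
  by (auto simp: env_functional_def distrib_left const_left_commute J_mult_left)

lemma env_functional_0: "env_functional \<xi> \<Longrightarrow> \<xi> 0 = 0"
  by (simp add: env_functional_def)

lemma env_functional_diff: "env_functional \<xi> \<Longrightarrow> \<xi> (s - t) = \<xi> s - \<xi> t"
proof -
  assume "env_functional \<xi>"
  then have "\<xi> (s + const (- 1) * t) = \<xi> s + - 1 * \<xi> t"
    unfolding env_functional_def by metis
  then show ?thesis by (simp add: const_uminus)
qed

lemma env_functional_cong: "env_functional \<xi> \<Longrightarrow> s \<approx> t \<Longrightarrow> \<xi> s = \<xi> t"
  using env_functional_diff[of \<xi> s t] by (simp add: env_functional_def cong_def)

text \<open>\<open>contract l \<xi>\<close> below is $(\xi \otimes \mathrm{id}) \circ \Delta$ for the coproduct $\Delta$ with primitive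
  generators. Passing a letter through $\xi$ costs the Koszul sign of \<open>l\<close>, which is the parity of
  $\xi$ when $\xi$ is homogeneous; compatibility with \<open>J\<close> holds for any \<open>l\<close>.\<close>

primrec contract_word :: "'g list \<Rightarrow> bit \<Rightarrow> ('g free_alg \<Rightarrow> complex) \<Rightarrow> 'g free_alg" where
  "contract_word [] l \<xi> = const (\<xi> 1)"
| "contract_word (x # w) l \<xi> =
     (\<Sum>i\<in>{0, 1}. contract_word w (l + i) (\<lambda>t. \<xi> (gen (component part i x) * t)) +
        const (koszul i l) * (gen (component part i x) * contract_word w l \<xi>))"

definition contract :: "bit \<Rightarrow> ('g free_alg \<Rightarrow> complex) \<Rightarrow> 'g free_alg \<Rightarrow> 'g free_alg" where
  "contract l \<xi> = ext (\<lambda>a t. const a * t) (\<lambda>w. contract_word w l \<xi>)"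

lemma linear_contract: "F_linear (\<lambda>a t. const a * t) (contract l \<xi>)"
  unfolding contract_def by (rule linear_ext) unfold_locales

sublocale contract: Vector_Spaces.linear "\<lambda>a t. const a * t" "\<lambda>a t. const a * t" "contract l \<xi>"
  by (rule linear_contract)

lemma contract_wprod [simp]: "contract l \<xi> (wprod w) = contract_word w l \<xi>"
  unfolding contract_def by (rule ext_wprod) unfold_locales

lemma gen_const_left_commute: "gen x * (const a * t) = const a * (gen x * t)"
  by (rule const_left_commute)

lemma contract_koszul: "contract l \<xi> (koszul i j * t) = koszul i j * contract l \<xi> t"
proof -
  have "contract l \<xi> (const (koszul i j) * t) = const (koszul i j) * contract l \<xi> t"
    by (rule contract.scale)
  then show ?thesis by simp
qed

lemma contract_gen_mult:
  "contract l \<xi> (gen x * t) =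
     (\<Sum>i\<in>{0, 1}. contract (l + i) (\<lambda>t. \<xi> (gen (component part i x) * t)) t +
        const (koszul i l) * (gen (component part i x) * contract l \<xi> t))"
proof (induction t rule: F_induct)
  case (scale a t)
  then show ?case
    by (simp add: contract.scale gen_const_left_commute distrib_left mult.commute del: const_koszul)
next
  case (word w)
  then show ?case by (simp only: contract_wprod contract_word.simps flip: wprod_Cons)
qed (simp_all add: contract.zero contract.add algebra_simps)

lemma contract_word_linear:
  "contract_word w l (\<lambda>t. a * \<xi> t + b * \<zeta> t) = const a * contract_word w l \<xi> +
      const b * contract_word w l \<zeta>"
  by (induction w arbitrary: l \<xi> \<zeta>)
    (simp_all add: const_add const_mult distrib_left gen_const_left_commute mult.commute add_ac
      del: const_koszul)

lemma contract_functional_linear: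
  "contract l (\<lambda>t. a * \<xi> t + b * \<zeta> t) t = const a * contract l \<xi> t + const b * contract l \<zeta> t"
  by (induction t rule: F_induct)
    (simp_all add: contract_word_linear contract.zero contract.add contract.scale distrib_left
      mult.commute add_ac)

lemma contract_zero_functional: "contract l (\<lambda>t. 0) t = 0"
  using contract_functional_linear[of l 0 "\<lambda>t. 0" 0 "\<lambda>t. 0" t] by simp

lemma contract_mult_cong:
  "env_functional \<xi> \<Longrightarrow> r \<approx> r' \<Longrightarrow> contract l (\<lambda>t. \<xi> (r * t)) = contract l (\<lambda>t. \<xi> (r' * t))"
  by (metis cong_mult cong_refl env_functional_cong)

lemma contract_mult_linear:
  "env_functional \<xi> \<Longrightarrow> contract l (\<lambda>t. \<xi> ((const a * r + const b * s) * t)) t =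
     const a * contract l (\<lambda>t. \<xi> (r * t)) t + const b * contract l (\<lambda>t. \<xi> (s * t)) t"
  by (simp add: distrib_right mult.assoc env_functional_def flip: contract_functional_linear)

text \<open>The component of \<open>x\<close> of the other parity is 0, but the letter
  \<open>gen 0\<close> vanishes only modulo \<open>J\<close>; hence a congruence and not an
  equation.\<close>

lemma contract_gen_mult_part:
  assumes "env_functional \<xi>" "x \<in> part i"
  shows "contract l \<xi> (gen x * t) \<approx>
    contract (l + i) (\<lambda>t. \<xi> (gen x * t)) t + const (koszul i l) * (gen x * contract l \<xi> t)"
proof -
  have 0: "contract l' (\<lambda>t. \<xi> (gen 0 * t)) t = 0" for l'
    using contract_mult_cong[OF assms(1) gen_0, of l'] env_functional_0[OF assms(1)]
      contract_zero_functional by simp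
  have "const (koszul (i + 1) l) * (gen 0 * contract l \<xi> t) \<approx> const (koszul (i +
      1) l) * (0 * contract l \<xi> t)"
    by (intro cong_mult gen_0) auto
  then have "contract (l + i) (\<lambda>t. \<xi> (gen x * t)) t +
      const (koszul i l) * (gen x * contract l \<xi> t) +
      const (koszul (i + 1) l) * (gen 0 * contract l \<xi> t) \<approx>
      contract (l + i) (\<lambda>t. \<xi> (gen x * t)) t + const (koszul i l) * (gen x * contract l \<xi> t) + 0"
    by (intro cong_add) auto
  moreover have "contract l \<xi> (gen x * t) =
      contract (l + i) (\<lambda>t. \<xi> (gen x * t)) t + const (koszul i l) * (gen x * contract l \<xi> t) +
      const (koszul (i + 1) l) * (gen 0 * contract l \<xi> t)"
    by (cases i) (simp_all add: contract_gen_mult component_of_part[OF assms(2)] 0 algebra_simps)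
  ultimately show ?thesis by simp
qed

text \<open>Letters are primitive, and primitive elements are closed under the superbracket.
  Concretely: what is entirely absorbed by \<xi> cancels because \<xi> vanishes on \<open>J\<close>,
  the terms with one of the two letters absorbed cancel in pairs by the sign rule, and what stays
  outside assembles to the relation times the contraction of \<open>s\<close>.\<close>

lemma contract_relation:
  assumes \<xi>: "env_functional \<xi>" and x: "x \<in> part i" and y: "y \<in> part j"
  shows "contract l \<xi> ((gen x * gen y - koszul i j * gen y * gen x - gen (br x y)) * s) \<in> J"
proof -
  define C where "C = contract l \<xi> s"
  define A where "A l' r = contract l' (\<lambda>t. \<xi> (r * t)) s" for l' r
  have two: "contract l \<xi> (gen x * (gen y * s)) \<approx>
      A (l + i + j) (gen x * gen y) + const (koszul j (l + i)) * (gen y * A (l + i) (gen x)) +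
      const (koszul i l) * (gen x * (A (l + j) (gen y) + const (koszul j l) * (gen y * C)))"
    if x: "x \<in> part i" and y: "y \<in> part j" for x y i j
  proof -
    have "contract (l + i) (\<lambda>t. \<xi> (gen x * t)) (gen y * s) \<approx>
        A (l + i + j) (gen x * gen y) + const (koszul j (l + i)) * (gen y * A (l + i) (gen x))"
      using contract_gen_mult_part[OF env_functional_mult[OF \<xi>, of "gen x"] y, of "l + i" s]
      by (simp add: A_def mult.assoc)
    moreover have "contract l \<xi> (gen y * s) \<approx> A (l + j) (gen y) + const (koszul j l) * (gen y * C)"
      using contract_gen_mult_part[OF \<xi> y] by (simp add: A_def C_def)
    ultimately show ?thesis
      by (intro cong_trans[OF contract_gen_mult_part[OF \<xi> x]] cong_add cong_mult) auto
  qed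
  define d where "d = gen x * gen y - koszul i j * gen y * gen x - gen (br x y)"
  have d: "d \<in> J"
    unfolding d_def using x y by (intro J_relation) (auto simp: env_relations_def)
  have "A (l + i + j) (gen x * gen y) =
      A (l + i + j) (const (koszul i j) * (gen y * gen x) + const 1 * gen (br x y))"
    unfolding A_def using gen_br[OF x y]
    by (intro fun_cong[OF contract_mult_cong[OF \<xi>]]) (simp add: mult.assoc)
  also have "\<dots> = const (koszul i j) * A (l + i + j) (gen y * gen x) + A (l + i + j) (gen (br x y))"
    unfolding A_def contract_mult_linear[OF \<xi>] by simp
  finally have A: "A (l + i + j) (gen x * gen y) =
      const (koszul i j) * A (l + i + j) (gen y * gen x) + A (l + i + j) (gen (br x y))" .
  have lij: "l + j + i = l + i + j" "l + (i + j) = l + i + j" 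
    by (cases l; cases i; cases j; simp)+
  have "contract l \<xi> (d * s) = contract l \<xi> (gen x * (gen y * s)) -
      const (koszul i j) * contract l \<xi> (gen y * (gen x * s)) - contract l \<xi> (gen (br x y) * s)"
    unfolding d_def by (simp add: left_diff_distrib contract.diff mult.assoc contract_koszul)
  also have "\<dots> \<approx>
      A (l + i + j) (gen x * gen y) + const (koszul j (l + i)) * (gen y * A (l + i) (gen x)) +
      const (koszul i l) * (gen x * (A (l + j) (gen y) + const (koszul j l) * (gen y * C))) -
      const (koszul i j) *
       (A (l + j + i) (gen y * gen x) + const (koszul i (l + j)) * (gen x * A (l + j) (gen y)) +
        const (koszul j l) * (gen y * (A (l + i) (gen x) + const (koszul i l) * (gen x * C)))) -
      (A (l + (i + j)) (gen (br x y)) + const (koszul (i + j) l) * (gen (br x y) * C))"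
    unfolding A_def[of "l + (i + j)"] C_def[symmetric]
    by (intro cong_diff cong_mult two x y cong_refl)
      (use contract_gen_mult_part[OF \<xi> br_part[OF x y], of l s] in \<open>simp add: C_def\<close>)
  also have "\<dots> = const (koszul (i + j) l) * (d * C)"
    unfolding lij A d_def koszul_add_left koszul_add_right
    by (cases i; cases j; cases l) (simp_all add: algebra_simps)
  also have "\<dots> \<approx> 0"
    using d by (simp add: cong_0_iff J_mult_left J_mult_right)
  finally show ?thesis by (simp add: cong_0_iff d_def)
qed

lemma contract_J:
  assumes "env_functional \<xi>" "t \<in> J"
  shows "contract l \<xi> t \<in> J"
proof -
  \<comment> \<open>The factor \<open>s\<close> makes closure under right multiplication immediate.
    Left multiplication by a letter changes both the functional and the parity \<open>l\<close>, so
    the set quantifies over these as well.\<close>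
  let ?S = "{t. \<forall>s l \<xi>. env_functional \<xi> \<longrightarrow> contract l \<xi> (t * s) \<in> J}"
  note J_simps = J_add J_mult_left J_mult_right F.subspace_diff[OF subspace_J]
  have "J \<subseteq> ?S"
  proof (rule J_minimal)
    show "env_relations scale part br \<subseteq> ?S"
    proof
      fix r assume "r \<in> env_relations scale part br"
      then consider x y where "r = gen (x + y) - gen x - gen y"
        | a x where "r = gen (scale a x) - const a * gen x"
        | i j x y where "r = gen x * gen y - koszul i j * gen y * gen x - gen (br x y)"
            "x \<in> part i" "y \<in> part j"
        unfolding env_relations_def by blast
      then show "r \<in> ?S"
      proof cases
        case 1
        have "contract l \<xi> (r * s) \<in> J" if \<xi>: "env_functional \<xi>" for s l \<xi>
        proof -
          let ?c = "component part"
          let ?A = "\<lambda>l r. contract l (\<lambda>t. \<xi> (r * t)) s"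
          have A: "?A l (gen (?c i (x + y))) = ?A l (gen (?c i x)) + ?A l (gen (?c i y))" for l i
          proof -
            have "?A l (gen (?c i (x + y))) = ?A l (const 1 * gen (?c i x) +
                const 1 * gen (?c i y))"
              by (rule fun_cong[OF contract_mult_cong[OF \<xi>]]) (simp add: component_add gen_add)
            then show ?thesis unfolding contract_mult_linear[OF \<xi>] by simp
          qed
          have "contract l \<xi> (r * s) = (\<Sum>i\<in>{0,1}. const (koszul i l) *
              ((gen (?c i (x + y)) - (gen (?c i x) + gen (?c i y))) * contract l \<xi> s))"
            unfolding 1 left_diff_distrib contract.diff contract_gen_mult A
            by (simp add: algebra_simps)
          moreover have "gen (?c i (x + y)) - (gen (?c i x) + gen (?c i y)) \<in> J" for i
            using gen_add[of "?c i x" "?c i y"] by (simp add: cong_def component_add)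
          ultimately show ?thesis
            by (metis (no_types, lifting) F.subspace_sum[OF subspace_J] J_mult_left J_mult_right)
        qed
        then show ?thesis by simp
      next
        case 2
        have "contract l \<xi> (r * s) \<in> J" if \<xi>: "env_functional \<xi>" for s l \<xi>
        proof -
          let ?c = "component part"
          let ?A = "\<lambda>l r. contract l (\<lambda>t. \<xi> (r * t)) s"
          have A: "?A l (gen (?c i (scale a x))) = const a * ?A l (gen (?c i x))" for l i
          proof -
            have "?A l (gen (?c i (scale a x))) = ?A l (const a * gen (?c i x) + const 0 * 0)"
              by (rule fun_cong[OF contract_mult_cong[OF \<xi>]]) (simp add: component_scale gen_scale)
            then show ?thesis unfolding contract_mult_linear[OF \<xi>] by simp
          qed
          have "contract l \<xi> (r * s) = (\<Sum>i\<in>{0,1}. const (koszul i l) *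
              ((gen (?c i (scale a x)) - const a * gen (?c i x)) * contract l \<xi> s))"
            unfolding 2 left_diff_distrib contract.diff mult.assoc contract.scale
                contract_gen_mult A
            by (simp add: algebra_simps const_left_commute)
          moreover have "gen (?c i (scale a x)) - const a * gen (?c i x) \<in> J" for i
            using gen_scale[of a "?c i x"] by (simp add: cong_def component_scale)
          ultimately show ?thesis
            by (metis (no_types, lifting) F.subspace_sum[OF subspace_J] J_mult_left J_mult_right)
        qed
        then show ?thesis by simp
      next
        case 3
        then show ?thesis using contract_relation by simp
      qed
    qed
    show "F.subspace ?S"
      by (rule F.subspaceI)
        (auto simp: contract.zero contract.add contract.scale distrib_right mult.assoc intro:
            J_simps)
  next
    fix x t assume "t \<in> ?S"
    then show "gen x * t \<in> ?S"
      by (auto simp: mult.assoc contract_gen_mult intro!: J_add J_mult_left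
          F.subspace_diff[OF subspace_J] env_functional_mult)
  qed (auto simp: mult.assoc)
  then show ?thesis using assms by (metis (mono_tags, lifting) mem_Collect_eq mult_1_right subsetD)
qed

section \<open>The word-length filtration\<close>

text \<open>The preimage in the free algebra of the subspace of \<open>U\<close> spanned by the
  words in \<open>S\<close>. Choosing \<open>S\<close> by length or by alphabet yields the
  filtrations used below.\<close>

definition Sp :: "'g list set \<Rightarrow> 'g free_alg set" where
  "Sp S = F.span (J \<union> wprod ` S)"

lemma subspace_Sp [simp]: "F.subspace (Sp S)"
  unfolding Sp_def by (rule F.subspace_span)

lemmas Sp_add = F.subspace_add[OF subspace_Sp]
  and Sp_diff = F.subspace_diff[OF subspace_Sp]
  and Sp_scale = F.subspace_scale[OF subspace_Sp]
  and Sp_sum = F.subspace_sum[OF subspace_Sp]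

lemma Sp_J: "t \<in> J \<Longrightarrow> t \<in> Sp S"
  and Sp_word: "w \<in> S \<Longrightarrow> wprod w \<in> Sp S"
  unfolding Sp_def by (auto intro: F.span_base)

lemma Sp_mono: "S \<subseteq> S' \<Longrightarrow> t \<in> Sp S \<Longrightarrow> t \<in> Sp S'"
  unfolding Sp_def using F.span_mono[of "J \<union> wprod ` S" "J \<union> wprod ` S'"] by blast

lemma Sp_cong: "s \<approx> t \<Longrightarrow> t \<in> Sp S \<Longrightarrow> s \<in> Sp S"
  unfolding cong_def using Sp_add[OF Sp_J, of "s - t" t] by simp

lemma Sp_induct:
  assumes "t \<in> Sp S" "F.subspace V" "J \<subseteq> V" "\<And>w. w \<in> S \<Longrightarrow> wprod w \<in> V"
  shows "t \<in> V"
  using F.span_minimal[of "J \<union> wprod ` S" V] assms unfolding Sp_def by blast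

lemma Sp_linear:
  assumes "F_linear (\<lambda>a t. const a * t) h" "F.subspace V"
    and "\<And>t. t \<in> J \<Longrightarrow> h t \<in> V" "\<And>w. w \<in> S \<Longrightarrow> h (wprod w) \<in> V" "t \<in> Sp S"
  shows "h t \<in> V"
proof -
  interpret h: Vector_Spaces.linear "\<lambda>a t. const a * t" "\<lambda>a t. const a * t" h by fact
  have "t \<in> {t. h t \<in> V}"
    by (rule Sp_induct[OF assms(5)])
      (auto intro!: F.subspaceI simp: h.zero h.add h.scale assms(3,4) F.subspace_0[OF assms(2)]
        F.subspace_add[OF assms(2)] F.subspace_scale[OF assms(2)])
  then show ?thesis by simp
qed

lemma Sp_mult:
  assumes "\<And>w. w \<in> S \<Longrightarrow> v @ w \<in> S'" "t \<in> Sp S"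
  shows "wprod v * t \<in> Sp S'"
  by (rule Sp_linear[OF F_linear_intros(1) subspace_Sp _ _ assms(2)])
    (auto intro: Sp_J J_mult_left Sp_word assms(1) simp flip: wprod_append)

lemma Sp_mult_right:
  assumes "\<And>w. w \<in> S \<Longrightarrow> w @ v \<in> S'" "t \<in> Sp S"
  shows "t * wprod v \<in> Sp S'"
  by (rule Sp_linear[OF F_linear_intros(2) subspace_Sp _ _ assms(2)])
    (auto intro: Sp_J J_mult_right Sp_word assms(1) simp flip: wprod_append)

lemma Sp_gen_mult:
  assumes "\<And>w. w \<in> S \<Longrightarrow> x # w \<in> S'" "t \<in> Sp S"
  shows "gen x * t \<in> Sp S'"
  using Sp_mult[of S "[x]"] assms by (simp add: wprod_single)

text \<open>The bound is strict so that \<open>Sp (short 0)\<close> is \<open>J\<close>: the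
  filtration has a zero step below the constants, and lowering the length of a constant needs no
  special case.\<close>

abbreviation short :: "nat \<Rightarrow> 'g list set" where
  "short n \<equiv> {w. length w < n}"

lemma contract_word_short: "contract_word w l \<xi> \<in> Sp (short (Suc (length w)))"
proof (induction w arbitrary: l \<xi>)
  case Nil
  then show ?case
    using Sp_scale[OF Sp_word[of "[]" "short 1"], of "\<xi> 1"] by simp
next
  case (Cons x w)
  have "contract_word w l \<xi> \<in> Sp (short (Suc (length (x # w))))" for l \<xi>
    by (rule Sp_mono[OF _ Cons.IH]) auto
  moreover have "gen y * contract_word w l \<xi> \<in> Sp (short (Suc (length (x # w))))" for y
    by (rule Sp_gen_mult[OF _ Cons.IH]) auto
  ultimately show ?case
    unfolding contract_word.simps by (intro Sp_sum Sp_add Sp_scale)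
qed

text \<open>A term has full length only if every letter stays outside the functional, and then it
  carries the factor \<open>\<xi> 1\<close>.\<close>

lemma contract_word_augmentation:
  assumes "\<xi> 1 = 0"
  shows "contract_word w l \<xi> \<in> Sp (short (length w))"
proof (induction w)
  case Nil
  then show ?case by (simp add: assms Sp_J)
next
  case (Cons x w)
  have "gen y * contract_word w l \<xi> \<in> Sp (short (length (x # w)))" for y
    by (rule Sp_gen_mult[OF _ Cons.IH]) auto
  moreover have "contract_word w l \<xi> \<in> Sp (short (length (x # w)))" for l \<xi>
    using contract_word_short[of w] by simp
  ultimately show ?case
    unfolding contract_word.simps by (intro Sp_sum Sp_add Sp_scale)
qed

text \<open>For \<open>l = 0\<close> letters pass the functional without a sign, so the part of full
  length is a multiple of the word itself and not of its image under the parity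
  automorphism.\<close>

lemma contract_word_even:
  "contract_word w 0 \<xi> - const (\<xi> 1) * wprod w \<in> Sp (short (length w))"
proof (induction w)
  case Nil
  then show ?case by (simp add: Sp_J)
next
  case (Cons x w)
  let ?x = "\<lambda>i. component part i x"
  have "gen (?x 0 + ?x 1) \<approx> gen (?x 0) + gen (?x 1)"
    by (rule gen_add)
  then have "gen (?x 0) + gen (?x 1) - gen x \<in> J"
    using cong_sym by (simp add: component_sum cong_def)
  then have "const (\<xi> 1) * ((gen (?x 0) + gen (?x 1) - gen x) * wprod w) \<in>
      Sp (short (length (x # w)))"
    by (intro Sp_J J_mult_left J_mult_right)
  moreover have "gen y * (contract_word w 0 \<xi> - const (\<xi> 1) * wprod w) \<in>
      Sp (short (length (x # w)))" for y
    by (rule Sp_gen_mult[OF _ Cons.IH]) auto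
  moreover have "contract_word w l \<xi> \<in> Sp (short (length (x # w)))" for l \<xi>
    using contract_word_short[of w] by simp
  ultimately have
    "(\<Sum>i\<in>{0, 1}. contract_word w (0 + i) (\<lambda>t. \<xi> (gen (?x i) * t)) +
        gen (?x i) * (contract_word w 0 \<xi> - const (\<xi> 1) * wprod w)) +
      const (\<xi> 1) * ((gen (?x 0) + gen (?x 1) - gen x) * wprod w) \<in> Sp (short (length (x # w)))"
    by (intro Sp_sum Sp_add)
  also have "(\<Sum>i\<in>{0, 1}. contract_word w (0 + i) (\<lambda>t. \<xi> (gen (?x i) * t)) +
        gen (?x i) * (contract_word w 0 \<xi> - const (\<xi> 1) * wprod w)) +
      const (\<xi> 1) * ((gen (?x 0) + gen (?x 1) - gen x) * wprod w) =
      contract_word (x # w) 0 \<xi> - const (\<xi> 1) * wprod (x # w)"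
    by (simp add: wprod_Cons algebra_simps gen_const_left_commute)
  finally show ?case .
qed

lemma contract_augmentation:
  assumes "env_functional \<xi>" "\<xi> 1 = 0" "t \<in> Sp (short (Suc n))"
  shows "contract l \<xi> t \<in> Sp (short n)"
  by (rule Sp_linear[OF linear_contract subspace_Sp _ _ assms(3)])
    (auto intro: Sp_J contract_J assms(1)
      intro!: Sp_mono[OF _ contract_word_augmentation[where \<xi> = \<xi>, OF assms(2)]])

lemma contract_even:
  assumes "env_functional \<xi>" "t \<in> Sp (short (Suc n))"
  shows "contract 0 \<xi> t - const (\<xi> 1) * t \<in> Sp (short n)"
proof (rule Sp_linear[OF _ subspace_Sp _ _ assms(2)])
  show "F_linear (\<lambda>a t. const a * t) (\<lambda>t. contract 0 \<xi> t - const (\<xi> 1) * t)"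
    by unfold_locales
      (simp_all add: contract.add contract.scale algebra_simps flip: const_mult)
qed (auto intro: Sp_J contract_J assms(1) J_mult_left F.subspace_diff[OF subspace_J]
      intro!: Sp_mono[OF _ contract_word_even])

text \<open>Since \<open>V\<close> contains \<open>J\<close>, a linear functional that vanishes on
  \<open>V\<close> descends to \<open>U\<close>.\<close>

lemma functional_separating:
  assumes V: "F.subspace V" and J: "J \<subseteq> V" and v: "v \<notin> V"
  obtains \<xi> where "env_functional \<xi>" "\<And>t. t \<in> V \<Longrightarrow> \<xi> t = 0" "\<xi> v = 1"
proof -
  interpret C: vector_space "(*) :: complex \<Rightarrow> complex \<Rightarrow> complex"
    by unfold_locales (simp_all add: algebra_simps)
  interpret FC: vector_space_pair "\<lambda>a (t :: 'g free_alg). const a * t"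
      "(*) :: complex \<Rightarrow> complex \<Rightarrow> complex"
    by unfold_locales
  obtain B where B: "B \<subseteq> V" "F.independent B" "V \<subseteq> F.span B"
    using F.maximal_independent_subset[of V] by blast
  have "F.span B = V"
    using B F.span_minimal[OF B(1) V] by blast
  then have "F.independent (insert v B)"
    using F.independent_insertI[of v B] B v by simp
  then obtain \<xi> where \<xi>: "F_linear (*) \<xi>" "\<forall>x\<in>insert v B. \<xi> x = (if x = v then 1 else 0)"
    using FC.linear_independent_extend[of "insert v B" "\<lambda>x. if x = v then 1 else 0"] by blast
  interpret \<xi>: Vector_Spaces.linear "\<lambda>a t. const a * t" "(*)" \<xi> by fact
  have 0: "\<xi> t = 0" if "t \<in> V" for t
  proof -
    have "V \<subseteq> {t. \<xi> t = 0}"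
      unfolding \<open>F.span B = V\<close>[symmetric]
    proof (rule F.span_minimal)
      show "B \<subseteq> {t. \<xi> t = 0}" using \<xi>(2) B(1) v by auto
    qed (auto intro!: F.subspaceI simp: \<xi>.add \<xi>.scale \<xi>.zero)
    then show ?thesis using that by auto
  qed
  show thesis
    by (rule that[of \<xi>]) (use 0 J \<xi>(2) in \<open>auto simp: env_functional_def \<xi>.add \<xi>.scale\<close>)
qed

lemma lookup_const: "Poly_Mapping.lookup (const c) 0 = c"
  by (simp add: const_def)

text \<open>A dual basis functional that also kills 1, as shortening words by contraction requires.
  So the constants join the other basis letters in its kernel; \<open>gen b\<close> stays outside
  because the constant term separates constants from letters modulo \<open>J\<close>.\<close>

lemma coordinate_functional:
  assumes B: "finite B" and indep: "\<And>a. (\<Sum>b\<in>B. const (a b) * gen b) \<in> J \<Longrightarrow> \<forall>b\<in>B. a b = 0"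
    and b: "b \<in> B"
  obtains \<xi> where "env_functional \<xi>" "\<xi> 1 = 0" "\<And>b'. b' \<in> B \<Longrightarrow> \<xi> (gen b') = (if b' =
      b then 1 else 0)"
proof -
  let ?V = "{t. \<exists>c a. t \<approx> const c + (\<Sum>b'\<in>B - {b}. const (a b') * gen b')}"
  have "F.subspace ?V"
  proof (rule F.subspaceI)
    show "0 \<in> ?V"
      by (auto intro!: exI[of _ 0] exI[of _ "\<lambda>_. 0"])
  next
    fix s t assume "s \<in> ?V" "t \<in> ?V"
    then obtain c a d e where "s \<approx> const c + (\<Sum>b'\<in>B - {b}. const (a b') * gen b')"
      "t \<approx> const d + (\<Sum>b'\<in>B - {b}. const (e b') * gen b')" by blast
    from cong_add[OF this] have
      "s + t \<approx> const (c + d) + (\<Sum>b'\<in>B - {b}. const (a b' + e b') * gen b')"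
      by (simp add: const_add algebra_simps sum.distrib)
    then show "s + t \<in> ?V"
      by (intro CollectI exI[of _ "c + d"] exI[of _ "\<lambda>b'. a b' + e b'"])
  next
    fix k t assume "t \<in> ?V"
    then obtain c a where "t \<approx> const c + (\<Sum>b'\<in>B - {b}. const (a b') * gen b')" by blast
    from cong_mult[OF cong_refl[of "const k"] this] have
      "const k * t \<approx> const (k * c) + (\<Sum>b'\<in>B - {b}. const (k * a b') * gen b')"
      by (simp add: distrib_left sum_distrib_left flip: const_mult)
    then show "const k * t \<in> ?V"
      by (intro CollectI exI[of _ "k * c"] exI[of _ "\<lambda>b'. k * a b'"])
  qed
  moreover have "J \<subseteq> ?V"
    by (auto intro!: exI[of _ 0] exI[of _ "\<lambda>_. 0"] simp: cong_0_iff)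
  moreover have "gen b \<notin> ?V"
  proof
    assume "gen b \<in> ?V"
    then obtain c a where *: "gen b - (const c + (\<Sum>b'\<in>B - {b}. const (a b') * gen b')) \<in> J"
      unfolding cong_def by blast
    have "c = 0"
      using lookup_J[OF *]
      by (simp add: lookup_minus lookup_add lookup_gen lookup_sum lookup_const_mult lookup_const)
    \<comment> \<open>The coefficient -1 at \<open>b\<close> brings \<open>gen b\<close> to the
      other side, so that \<open>indep\<close> applies to a combination over all of
      \<open>B\<close>.\<close>
    have "(\<Sum>b'\<in>B. const ((a(b := - 1)) b') * gen b') =
        const (- 1) * gen b + (\<Sum>b'\<in>B - {b}. const (a b') * gen b')"
      using B b by (subst sum.remove[OF B b]) (auto intro!: sum.cong)
    also have "\<dots> = - (gen b - (const c + (\<Sum>b'\<in>B - {b}. const (a b') * gen b')))"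
      using \<open>c = 0\<close> by (simp add: const_uminus)
    finally have "(\<Sum>b'\<in>B. const ((a(b := - 1)) b') * gen b') \<in> J"
      using F.subspace_neg[OF subspace_J *] by simp
    from indep[OF this] b show False by auto
  qed
  ultimately obtain \<xi> where \<xi>: "env_functional \<xi>" "\<And>t. t \<in> ?V \<Longrightarrow> \<xi> t = 0" "\<xi> (gen b) = 1"
    by (rule functional_separating) blast
  have "1 \<in> ?V"
    by (auto intro!: exI[of _ 1] exI[of _ "\<lambda>_. 0"])
  moreover have "gen b' \<in> ?V" if "b' \<in> B" "b' \<noteq> b" for b'
  proof -
    have "(\<Sum>x\<in>B - {b}. const (if x = b' then 1 else 0) * gen x) = gen b'"
      using that B by (simp add: if_distrib[of const] if_distrib[of
          "\<lambda>u. u * _"] sum.delta cong: if_cong)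
    then show ?thesis
      by (auto intro!: exI[of _ 0] exI[of _ "\<lambda>x. if x = b' then 1 else 0"])
  qed
  ultimately show thesis
    using \<xi> by (intro that[of \<xi>]) auto
qed

end

section \<open>Symmetrization\<close>

text \<open>A function on words is read as the family of its homogeneous tensors, with coordinates in the
  basis \<open>Q\<close>; \<open>Phi Q n\<close> multiplies out the tensor of degree \<open>n\<close>.\<close>

primrec Phi :: "'g set \<Rightarrow> nat \<Rightarrow> ('g list \<Rightarrow> complex) \<Rightarrow> 'g free_alg" where
  "Phi Q 0 f = const (f [])"
| "Phi Q (Suc n) f = (\<Sum>b\<in>Q. gen b * Phi Q n (\<lambda>z. f (b # z)))"

lemma Phi_cong:
  "(\<And>z. set z \<subseteq> Q \<Longrightarrow> length z = n \<Longrightarrow> f z = g z) \<Longrightarrow> Phi Q n f = Phi Q n g"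
proof (induction n arbitrary: f g)
  case (Suc n)
  then have "Phi Q n (\<lambda>z. f (b # z)) = Phi Q n (\<lambda>z. g (b # z))" if "b \<in> Q" for b
    using that by (intro Suc.IH Suc.prems) auto
  then show ?case by simp
qed simp

lemma Phi_add: "Phi Q n (\<lambda>z. f z + g z) = Phi Q n f + Phi Q n g"
  by (induction n arbitrary: f g) (simp_all add: const_add distrib_left sum.distrib)

lemma Phi_scale: "Phi Q n (\<lambda>z. a * f z) = const a * Phi Q n f"
  by (induction n arbitrary: f) (simp_all add: const_mult const_left_commute sum_distrib_left)

lemma Phi_0 [simp]: "Phi Q n (\<lambda>z. 0) = 0"
  by (induction n) simp_all

lemma Phi_sum: "Phi Q n (\<lambda>z. \<Sum>i\<in>I. f i z) = (\<Sum>i\<in>I. Phi Q n (f i))"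
  by (induction I rule: infinite_finite_induct) (simp_all add: Phi_add)

lemma Phi_eq_0: "(\<And>z. set z \<subseteq> Q \<Longrightarrow> length z = n \<Longrightarrow> f z = 0) \<Longrightarrow> Phi Q n f = 0"
  using Phi_cong[of Q n f "\<lambda>z. 0"] by simp

lemma Phi_snoc: "Phi Q (Suc n) f = (\<Sum>b\<in>Q. Phi Q n (\<lambda>z. f (z @ [b])) * gen b)"
proof (induction n arbitrary: f)
  case 0
  then show ?case by (simp add: const_commute)
next
  case (Suc n)
  have "Phi Q (Suc (Suc n)) f = (\<Sum>b\<in>Q. gen b * (\<Sum>d\<in>Q. Phi Q n (\<lambda>z. f (b # z @ [d])) * gen d))"
    by (subst Phi.simps(2), subst Suc.IH) simp
  also have "\<dots> = (\<Sum>d\<in>Q. (\<Sum>b\<in>Q. gen b * Phi Q n (\<lambda>z. f (b # z @ [d]))) * gen d)"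
    unfolding sum_distrib_left sum_distrib_right mult.assoc by (rule sum.swap)
  finally show ?case by simp
qed

text \<open>A homogeneous basis of the image of the Lie superalgebra in \<open>U\<close>:
  independence and spanning are modulo \<open>J\<close>. \<open>Bk\<close> and \<open>Bp\<close>
  stand for k and p, and \<open>c a b d\<close> is the coefficient of \<open>d\<close> in the
  bracket of \<open>a\<close> and \<open>b\<close>; \<open>c_kk\<close> and \<open>c_kp\<close>
  express that k is a subalgebra and p a k-module. The sum in \<open>c_trace\<close> is minus the
  supertrace of ad \<open>a\<close> for even \<open>a\<close>, because \<open>c j a j\<close> has
  the acting letter on the right; for odd \<open>a\<close> its terms vanish by parity.\<close>

locale adapted_basis = lie_superalgebra scale part br
  for scale :: "complex \<Rightarrow> 'g::ab_group_add \<Rightarrow> 'g" and part :: "bit \<Rightarrow> 'g set" and br +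
  fixes Bk Bp :: "'g set" and par :: "'g \<Rightarrow> bit" and c :: "'g \<Rightarrow> 'g \<Rightarrow> 'g \<Rightarrow> complex"
  assumes finite_basis: "finite (Bk \<union> Bp)"
    and disjoint_basis: "Bk \<inter> Bp = {}"
    and par: "b \<in> Bk \<union> Bp \<Longrightarrow> b \<in> part (par b)"
    and independent_basis:
      "\<And>a. (\<Sum>b\<in>Bk \<union> Bp. const (a b) * gen b) \<in> J \<Longrightarrow> \<forall>b\<in>Bk \<union> Bp. a b = 0"
    and spanning_basis: "\<exists>a. gen x \<approx> (\<Sum>b\<in>Bk \<union> Bp. const (a b) * gen b)"
    and commutation: "a \<in> Bk \<union> Bp \<Longrightarrow> b \<in> Bk \<union> Bp \<Longrightarrow>
      gen a * gen b \<approx> const (koszul (par a) (par b)) * (gen b * gen a) +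
        (\<Sum>d\<in>Bk \<union> Bp. const (c a b d) * gen d)"
    and c_par: "a \<in> Bk \<union> Bp \<Longrightarrow> b \<in> Bk \<union> Bp \<Longrightarrow> d \<in> Bk \<union> Bp \<Longrightarrow> c a b d \<noteq> 0 \<Longrightarrow>
      par d = par a + par b"
    and c_kk: "a \<in> Bk \<Longrightarrow> b \<in> Bk \<Longrightarrow> d \<in> Bp \<Longrightarrow> c a b d = 0"
    and c_kp: "a \<in> Bk \<Longrightarrow> b \<in> Bp \<Longrightarrow> d \<in> Bk \<Longrightarrow> c a b d = 0"
    and c_trace: "a \<in> Bk \<Longrightarrow> (\<Sum>j\<in>Bk. koszul (par j) (par j) * c j a j) = 0"
begin

abbreviation B :: "'g set" where "B \<equiv> Bk \<union> Bp"

abbreviation kos :: "'g \<Rightarrow> 'g \<Rightarrow> complex" where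
  "kos a b \<equiv> koszul (par a) (par b)"

declare const_koszul [simp del]

lemma kos_square: "kos a b * kos b a = 1"
  using koszul_self_inverse[of "par a" "par b"] by (simp add: koszul_sym)

lemma Phi_in_Sp: "Phi Q n f \<in> Sp {z. set z \<subseteq> Q \<and> length z = n}"
proof (induction n arbitrary: f)
  case 0
  have "const (f []) * wprod [] \<in> Sp {z. set z \<subseteq> Q \<and> length z = 0}"
    by (intro Sp_scale Sp_word) auto
  then show ?case by simp
next
  case (Suc n)
  show ?case
    unfolding Phi.simps by (intro Sp_sum Sp_gen_mult[OF _ Suc]) auto
qed

lemma Phi_short: "Phi Q n f \<in> Sp (short (Suc n))"
  by (rule Sp_mono[OF _ Phi_in_Sp]) auto

subsection \<open>Functions on words that are supersymmetric in two groups of letters\<close>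

text \<open>Up to finite support, these are the elements of $S(Q_1) \otimes S(Q_2)$.\<close>

definition ord_sym :: "'g set \<Rightarrow> 'g set \<Rightarrow> ('g list \<Rightarrow> complex) \<Rightarrow> bool" where
  "ord_sym Q1 Q2 f \<longleftrightarrow> (\<forall>u a b z. set u \<subseteq> B \<longrightarrow> set z \<subseteq> B \<longrightarrow>
     (a \<in> Q1 \<and> b \<in> Q1 \<or> a \<in> Q2 \<and> b \<in> Q2 \<longrightarrow> f (u @ a # b # z) = kos a b * f (u @ b # a # z)) \<and>
     (a \<in> Q2 \<and> b \<in> Q1 \<longrightarrow> f (u @ a # b # z) = 0))"

lemma ord_symI:
  assumes "\<And>u a b z. set u \<subseteq> B \<Longrightarrow> set z \<subseteq> B \<Longrightarrow> a \<in> Q1 \<and> b \<in> Q1 \<or> a \<in> Q2 \<and> b \<in> Q2 \<Longrightarrow>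
      f (u @ a # b # z) = kos a b * f (u @ b # a # z)"
    and "\<And>u a b z. set u \<subseteq> B \<Longrightarrow> set z \<subseteq> B \<Longrightarrow> a \<in> Q2 \<Longrightarrow> b \<in> Q1 \<Longrightarrow> f (u @ a # b # z) = 0"
  shows "ord_sym Q1 Q2 f"
  using assms unfolding ord_sym_def by blast

lemma ord_sym_swap:
  "ord_sym Q1 Q2 f \<Longrightarrow> set u \<subseteq> B \<Longrightarrow> set z \<subseteq> B \<Longrightarrow> a \<in> Q1 \<and> b \<in> Q1 \<or> a \<in> Q2 \<and> b \<in> Q2 \<Longrightarrow>
    f (u @ a # b # z) = kos a b * f (u @ b # a # z)"
  unfolding ord_sym_def by blast

lemma ord_sym_zero:
  "ord_sym Q1 Q2 f \<Longrightarrow> set u \<subseteq> B \<Longrightarrow> set z \<subseteq> B \<Longrightarrow> a \<in> Q2 \<Longrightarrow> b \<in> Q1 \<Longrightarrow> f (u @ a # b # z) = 0"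
  unfolding ord_sym_def by blast

lemma ord_sym_swap0:
  "ord_sym Q1 Q2 f \<Longrightarrow> set z \<subseteq> B \<Longrightarrow> a \<in> Q1 \<and> b \<in> Q1 \<or> a \<in> Q2 \<and> b \<in> Q2 \<Longrightarrow>
    f (a # b # z) = kos a b * f (b # a # z)"
  using ord_sym_swap[of Q1 Q2 f "[]"] by simp

lemma ord_sym_zero0:
  "ord_sym Q1 Q2 f \<Longrightarrow> set z \<subseteq> B \<Longrightarrow> a \<in> Q2 \<Longrightarrow> b \<in> Q1 \<Longrightarrow> f (a # b # z) = 0"
  using ord_sym_zero[of Q1 Q2 f "[]"] by simp

lemma ord_sym_Cons:
  assumes "ord_sym Q1 Q2 f" "x \<in> B"
  shows "ord_sym Q1 Q2 (\<lambda>z. f (x # z))"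
proof (rule ord_symI)
  show "f (x # u @ a # b # z) = kos a b * f (x # u @ b # a # z)"
    if "set u \<subseteq> B" "set z \<subseteq> B" "a \<in> Q1 \<and> b \<in> Q1 \<or> a \<in> Q2 \<and> b \<in> Q2" for u a b z
    using ord_sym_swap[OF assms(1), of "x # u" z a b] that assms(2) by simp
  show "f (x # u @ a # b # z) = 0"
    if "set u \<subseteq> B" "set z \<subseteq> B" "a \<in> Q2" "b \<in> Q1" for u a b z
    using ord_sym_zero[OF assms(1), of "x # u" z a b] that assms(2) by simp
qed

lemma ord_sym_add: "ord_sym Q1 Q2 f \<Longrightarrow> ord_sym Q1 Q2 g \<Longrightarrow> ord_sym Q1 Q2 (\<lambda>z. f z + g z)"
proof (rule ord_symI, goal_cases)
  case (1 u a b z)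
  show ?case
    using ord_sym_swap[OF 1(1,3-5)] ord_sym_swap[OF 1(2,3-5)] by (simp add: distrib_left)
qed (simp add: ord_sym_zero)

lemma ord_sym_scale: "ord_sym Q1 Q2 f \<Longrightarrow> ord_sym Q1 Q2 (\<lambda>z. k * f z)"
proof (rule ord_symI, goal_cases)
  case (1 u a b z)
  show ?case
    using ord_sym_swap[OF 1] by simp
qed (simp add: ord_sym_zero)

lemma ord_sym_0: "ord_sym Q1 Q2 (\<lambda>z. 0)"
  by (rule ord_symI) simp_all

lemma ord_sym_sum: "(\<And>i. i \<in> I \<Longrightarrow> ord_sym Q1 Q2 (f i)) \<Longrightarrow> ord_sym Q1 Q2 (\<lambda>z. \<Sum>i\<in>I. f i z)"
  by (induction I rule: infinite_finite_induct) (simp_all add: ord_sym_0 ord_sym_add)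

text \<open>To verify \<^const>\<open>ord_sym\<close> for the result of an operator defined by recursion on words, it
  suffices to look at the first two letters.\<close>

lemma ord_sym_operatorI:
  assumes f: "ord_sym Q1 Q2 f"
    and swap: "\<And>f a b z. ord_sym Q1 Q2 f \<Longrightarrow> set z \<subseteq> B \<Longrightarrow> a \<in> Q1 \<and> b \<in> Q1 \<or> a \<in> Q2 \<and> b \<in> Q2 \<Longrightarrow>
      T f (a # b # z) = kos a b * T f (b # a # z)"
    and zero: "\<And>f a b z. ord_sym Q1 Q2 f \<Longrightarrow> set z \<subseteq> B \<Longrightarrow> a \<in> Q2 \<Longrightarrow> b \<in> Q1 \<Longrightarrow> T f (a # b # z) = 0"
    and rec: "\<And>f x z. T f (x # z) = k x * T (\<lambda>z. f (x # z)) z + h f x z"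
    and h: "\<And>f x. ord_sym Q1 Q2 f \<Longrightarrow> x \<in> B \<Longrightarrow> ord_sym Q1 Q2 (h f x)"
  shows "ord_sym Q1 Q2 (T f)"
proof (rule ord_symI)
  show "T f (u @ a # b # z) = kos a b * T f (u @ b # a # z)"
    if "set u \<subseteq> B" "set z \<subseteq> B" "a \<in> Q1 \<and> b \<in> Q1 \<or> a \<in> Q2 \<and> b \<in> Q2" for u a b z
    using that(1) f
  proof (induction u arbitrary: f)
    case (Cons x u)
    then show ?case
      using Cons.IH[OF _ ord_sym_Cons, of f x] ord_sym_swap[OF h, of f x u z a b] that(2,3)
      by (simp add: rec algebra_simps)
  qed (use swap that in auto)
  show "T f (u @ a # b # z) = 0"
    if "set u \<subseteq> B" "set z \<subseteq> B" "a \<in> Q2" "b \<in> Q1" for u a b z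
    using that(1) f
  proof (induction u arbitrary: f)
    case (Cons x u)
    then show ?case
      using Cons.IH[OF _ ord_sym_Cons, of f x] ord_sym_zero[OF h, of f x u z a b] that(2-)
      by (simp add: rec)
  qed (use zero that in auto)
qed

subsection \<open>Injectivity of symmetrization\<close>

text \<open>\<open>del b\<close> is what contraction with the functional dual to \<open>b\<close> becomes on coordinates, modulo lower
  degree.\<close>

primrec del :: "'g \<Rightarrow> ('g list \<Rightarrow> complex) \<Rightarrow> 'g list \<Rightarrow> complex" where
  "del b f [] = f [b]"
| "del b f (x # z) = kos x b * del b (\<lambda>z. f (x # z)) z + f (b # x # z)"

lemma del_scale:
  assumes "set z \<subseteq> B" "x \<in> B" "\<And>z. set z \<subseteq> B \<Longrightarrow> f z = k * g z"
  shows "del x f z = k * del x g z"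
  using assms(1,3)
proof (induction z arbitrary: f g)
  case (Cons y z)
  have "del x (\<lambda>z. f (y # z)) z = k * del x (\<lambda>z. g (y # z)) z"
    using Cons.prems by (intro Cons.IH) auto
  then show ?case using Cons.prems assms(2) by (simp add: algebra_simps)
qed (use assms(2) in auto)

lemma del_ord_sym:
  assumes f: "ord_sym Q1 Q2 f" and Q: "Q1 \<union> Q2 = B" "Q1 \<inter> Q2 = {}" and x: "x \<in> B"
  shows "ord_sym Q1 Q2 (del x f)"
proof (rule ord_sym_operatorI[OF f, where k = "\<lambda>y. kos y x" and h = "\<lambda>f y z. f (x # y # z)"])
  fix f :: "'g list \<Rightarrow> complex" and a b z
  assume f: "ord_sym Q1 Q2 f" and z: "set z \<subseteq> B" and ab: "a \<in> Q1 \<and> b \<in> Q1 \<or> a \<in> Q2 \<and> b \<in> Q2"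
  then have abB: "a \<in> B" "b \<in> B" using Q by auto
  have 1: "f (x # a # b # z) = kos a b * f (x # b # a # z)"
    using ord_sym_swap[OF f, of "[x]" z a b] z ab x by simp
  \<comment> \<open>These are the terms with \<open>x\<close> inserted between the two letters. If
    all three letters lie in one group, three transpositions reverse their order; otherwise both
    sides contain a letter of \<open>Q2\<close> directly before one of \<open>Q1\<close> and
    vanish.\<close>
  have 2: "kos a x * f (a # x # b # z) = kos a b * kos b x * f (b # x # a # z)"
  proof (cases "x \<in> Q1 \<longleftrightarrow> a \<in> Q1")
    case True
    then have c: "x \<in> Q1 \<and> a \<in> Q1 \<and> b \<in> Q1 \<or> x \<in> Q2 \<and> a \<in> Q2 \<and> b \<in> Q2"
      using ab x Q by blast
    have "f (a # x # b # z) = kos a x * (kos a b * (kos x b * f (b # x # a # z)))"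
      using c z abB ord_sym_swap0[OF f, of "b # z" a x] ord_sym_swap[OF f, of "[x]" z a b]
        ord_sym_swap0[OF f, of "a # z" x b] x by auto
    then show ?thesis by (simp add: koszul_sym)
  next
    case False
    then consider "x \<in> Q1" "a \<in> Q2" "b \<in> Q2" | "x \<in> Q2" "a \<in> Q1" "b \<in> Q1"
      using ab x Q by blast
    then show ?thesis
    proof cases
      case 1
      then show ?thesis
        using ord_sym_zero0[OF f, of "b # z" a x] ord_sym_zero0[OF f, of "a # z" b x] z abB by simp
    next
      case 2
      then show ?thesis
        using ord_sym_zero[OF f, of "[a]" z x b] ord_sym_zero[OF f, of "[b]" z x a] z abB by simp
    qed
  qed
  have "(\<lambda>z. f (a # b # z)) z = kos a b * f (b # a # z)" if "set z \<subseteq> B" for z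
    using ord_sym_swap0[OF f that ab] .
  then have "del x (\<lambda>z. f (a # b # z)) z = kos a b * del x (\<lambda>z. f (b # a # z)) z"
    using del_scale[OF z x] by simp
  then show "del x f (a # b # z) = kos a b * del x f (b # a # z)"
    using 1 2 kos_square[of a b] by (simp add: algebra_simps)
next
  fix f :: "'g list \<Rightarrow> complex" and a b z
  assume f: "ord_sym Q1 Q2 f" and z: "set z \<subseteq> B" and a: "a \<in> Q2" and b: "b \<in> Q1"
  then have abB: "a \<in> B" "b \<in> B" using Q by auto
  have "f (x # a # b # z) = 0"
    using ord_sym_zero[OF f, of "[x]" z a b] z a b x by simp
  moreover have "f (a # x # b # z) = 0"
    using ord_sym_zero0[OF f, of "b # z" a x] ord_sym_zero[OF f, of "[a]" z x b] z abB a b x Q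
    by auto
  moreover have "del x (\<lambda>z. f (a # b # z)) z = 0"
    using del_scale[OF z x, of "\<lambda>z. f (a # b # z)" 0 "\<lambda>z. 0"] ord_sym_zero0[OF f _ a b] by simp
  ultimately show "del x f (a # b # z) = 0" by simp
next
  show "ord_sym Q1 Q2 (\<lambda>z. f (x # y # z))" if "ord_sym Q1 Q2 f" "y \<in> B" for f y
    using ord_sym_Cons[OF ord_sym_Cons[OF that(1) x] that(2)] .
qed simp

text \<open>\<open>del b\<close> adds up the signed insertions of \<open>b\<close> at all positions.
  Past letters of \<open>Q1\<close>, supersymmetry carries \<open>b\<close> back to the front and
  the sign cancels; an insertion behind a letter of \<open>Q2\<close> contributes 0. The insertion
  at the front always counts, so the multiplicity is positive and hence invertible.\<close>

lemma del_first_group: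
  assumes "ord_sym Q1 Q2 f" "Q1 \<union> Q2 = B" "b \<in> Q1" "set z \<subseteq> B"
  shows "\<exists>m::nat. del b f z = (of_nat m + 1) * f (b # z)"
  using assms(1,4)
proof (induction z arbitrary: f)
  case Nil
  then show ?case by (intro exI[of _ 0]) simp
next
  case (Cons x z)
  then obtain m :: nat where m: "del b (\<lambda>z. f (x # z)) z = (of_nat m + 1) * f (x # b # z)"
    using ord_sym_Cons[of Q1 Q2 f x] by auto
  show ?case
  proof (cases "x \<in> Q1")
    case True
    then have "f (x # b # z) = kos x b * f (b # x # z)"
      using ord_sym_swap0[OF Cons.prems(1), of z x b] Cons.prems assms(3) by auto
    then show ?thesis
      by (intro exI[of _ "Suc m"]) (simp add: m algebra_simps)
  next
    case False
    then have "f (x # b # z) = 0"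
      using ord_sym_zero0[OF Cons.prems(1), of z x b] Cons.prems assms(2,3) by auto
    then show ?thesis
      by (intro exI[of _ 0]) (simp add: m)
  qed
qed

text \<open>For \<open>b\<close> in \<open>Q2\<close> all letters of \<open>z\<close> must come from
  \<open>Q2\<close> if the insertions are to be comparable; for the other words
  \<open>ord_sym_misordered\<close> gives the value 0 directly.\<close>

lemma del_second_group:
  assumes "ord_sym Q1 Q2 f" "Q1 \<union> Q2 = B" "b \<in> Q2" "set z \<subseteq> Q2"
  shows "\<exists>m::nat. del b f z = (of_nat m + 1) * f (b # z)"
  using assms(1,4)
proof (induction z arbitrary: f)
  case Nil
  then show ?case by (intro exI[of _ 0]) simp
next
  case (Cons x z)
  then have x: "x \<in> B" using assms(2) by auto
  obtain m :: nat where m: "del b (\<lambda>z. f (x # z)) z = (of_nat m + 1) * f (x # b # z)"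
    using Cons ord_sym_Cons[of Q1 Q2 f x] x by auto
  have "f (x # b # z) = kos x b * f (b # x # z)"
    using ord_sym_swap0[OF Cons.prems(1), of z x b] Cons.prems assms(2,3) by auto
  then show ?case
    by (intro exI[of _ "Suc m"]) (simp add: m algebra_simps)
qed

lemma ord_sym_misordered:
  assumes "ord_sym Q1 Q2 f" "Q1 \<union> Q2 = B" "b \<in> Q2" "set z \<subseteq> B" "\<not> set z \<subseteq> Q2"
  shows "f (b # z) = 0"
proof -
  obtain u x v where z: "z = u @ x # v" "set u \<subseteq> Q2" "x \<in> Q1"
    using assms(2,4,5) split_list_first_prop[of z "\<lambda>x. x \<notin> Q2"] by fastforce
  \<comment> \<open>\<open>y\<close> is the letter directly before the first letter of
    \<open>Q1\<close>; it is \<open>b\<close> itself when \<open>u\<close> is empty.\<close>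
  obtain u' y where y: "b # u = u' @ [y]"
    by (metis list.discI rev_exhaust)
  then have "set (u' @ [y]) \<subseteq> Q2"
    using z(2) assms(3) by (metis insert_subset list.simps(15))
  then have "f (u' @ y # x # v) = 0"
    using z assms(2,4) by (intro ord_sym_zero[OF assms(1)]) auto
  moreover have "b # z = u' @ y # x # v"
    using y z(1) by (metis append.assoc append_Cons append_Nil)
  ultimately show ?thesis by simp
qed

lemma del_eq_0:
  assumes "ord_sym Q1 Q2 f" "Q1 \<union> Q2 = B" "b \<in> B" "set z \<subseteq> B" "del b f z = 0"
  shows "f (b # z) = 0"
proof -
  have "f (b # z) = 0" if "\<exists>m::nat. del b f z = (of_nat m + 1) * f (b # z)"
  proof -
    from that obtain m :: nat where "(of_nat m + 1) * f (b # z) = 0" using assms(5) by auto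
    moreover have "of_nat m + 1 \<noteq> (0 :: complex)"
      by (metis of_nat_Suc of_nat_eq_0_iff add.commute nat.distinct(1))
    ultimately show ?thesis by simp
  qed
  then show ?thesis
    using del_first_group[OF assms(1,2) _ assms(4)] del_second_group[OF assms(1,2)]
      ord_sym_misordered[OF assms(1,2) _ assms(4)] assms(2,3) by blast
qed

text \<open>For \<open>x = b\<close>, absorbing the letter changes the parity to
  \<open>par b + par b = 0\<close>, where the leading term is unsigned and has the factor
  \<open>\<xi> (gen b) = 1\<close>. For \<open>x \<noteq> b\<close> the new functional vanishes at
  1, so the absorbed term falls to lower length.\<close>

lemma contract_gen_mult_basis:
  assumes \<xi>: "env_functional \<xi>" "\<And>b'. b' \<in> B \<Longrightarrow> \<xi> (gen b') = (if b' = b then 1 else 0)"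
    and b: "b \<in> B" and x: "x \<in> B" and t: "t \<in> Sp (short (Suc n))"
  shows "contract (par b) \<xi> (gen x * t) -
    ((if x = b then t else 0) + const (kos x b) * (gen x * contract (par b) \<xi> t)) \<in> Sp (short n)"
proof -
  let ?\<xi> = "\<lambda>t. \<xi> (gen x * t)"
  have \<xi>': "env_functional ?\<xi>" by (rule env_functional_mult[OF \<xi>(1)])
  have "contract (par b + par x) ?\<xi> t - (if x = b then t else 0) \<in> Sp (short n)"
  proof (cases "x = b")
    case True
    then show ?thesis
      using contract_even[OF \<xi>' t] \<xi>(2)[OF b] by simp
  next
    case False
    then show ?thesis
      using contract_augmentation[OF \<xi>' _ t, of "par b + par x"] \<xi>(2)[OF x] by simp
  qed
  moreover have "contract (par b) \<xi> (gen x * t) - (contract (par b + par x) ?\<xi> t +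
      const (kos x b) * (gen x * contract (par b) \<xi> t)) \<in> Sp (short n)"
    using contract_gen_mult_part[OF \<xi>(1) par[OF x], of "par b" t] unfolding cong_def by (rule Sp_J)
  ultimately have "(contract (par b + par x) ?\<xi> t - (if x = b then t else 0)) +
     (contract (par b) \<xi> (gen x * t) - (contract (par b + par x) ?\<xi> t +
      const (kos x b) * (gen x * contract (par b) \<xi> t))) \<in> Sp (short n)"
    by (rule Sp_add)
  then show ?thesis by (simp add: algebra_simps)
qed

lemma contract_Phi:
  assumes \<xi>: "env_functional \<xi>" "\<xi> 1 = 0" "\<And>b'. b' \<in> B \<Longrightarrow> \<xi> (gen b') = (if b' = b then 1 else 0)"
    and b: "b \<in> B"
  shows "contract (par b) \<xi> (Phi B (Suc n) f) - Phi B n (del b f) \<in> Sp (short n)"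
proof (induction n arbitrary: f)
  case 0
  have "contract l \<xi> (const a) = 0" for l a
    using contract.scale[of l \<xi> a 1] contract_wprod[of l \<xi> "[]"] \<xi>(2) by simp
  then have *: "contract (par b) \<xi> (gen x * const (f [x])) - (if x =
      b then const (f [x]) else 0) \<in> Sp (short 0)"
    if "x \<in> B" for x
    using contract_gen_mult_basis[OF \<xi>(1,3) b that, of "const (f [x])" 0]
      Phi_short[of B 0 "\<lambda>_. f [x]"] by simp
  have "(\<Sum>x\<in>B. contract (par b) \<xi> (gen x * const (f [x])) - (if x =
      b then const (f [x]) else 0)) \<in> Sp (short 0)"
    by (rule Sp_sum) (rule *)
  then show ?case
    using finite_basis b by (simp add: contract.sum sum_subtractf)
next
  case (Suc n)
  let ?d = "\<lambda>x. \<lambda>z. f (x # z)"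
  have *: "contract (par b) \<xi> (gen x * Phi B (Suc n) (?d x)) - ((if x =
      b then Phi B (Suc n) (?d x) else 0) +
      const (kos x b) * (gen x * Phi B n (del b (?d x)))) \<in> Sp (short (Suc n))"
    if "x \<in> B" for x
  proof -
    have "gen x * (contract (par b) \<xi> (Phi B (Suc n) (?d x)) - Phi B n (del b (?d x))) \<in>
        Sp (short (Suc n))"
      by (rule Sp_gen_mult[OF _ Suc.IH]) auto
    from Sp_add[OF contract_gen_mult_basis[OF \<xi>(1,3) b that Phi_short[of B "Suc n"
        "?d x"]] Sp_scale[OF this, of "kos x b"]]
    show ?thesis by (simp add: algebra_simps del: Phi.simps(2))
  qed
  have "(\<Sum>x\<in>B. contract (par b) \<xi> (gen x * Phi B (Suc n) (?d x)) - ((if x =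
      b then Phi B (Suc n) (?d x) else 0) +
      const (kos x b) * (gen x * Phi B n (del b (?d x))))) \<in> Sp (short (Suc n))"
    by (rule Sp_sum) (rule *)
  moreover have "(\<Sum>x\<in>B. contract (par b) \<xi> (gen x * Phi B (Suc n) (?d x)) - ((if x =
      b then Phi B (Suc n) (?d x) else 0) +
      const (kos x b) * (gen x * Phi B n (del b (?d x))))) =
     contract (par b) \<xi> (Phi B (Suc (Suc n)) f) - Phi B (Suc n) (del b f)"
  proof -
    have "Phi B (Suc n) (del b f) = (\<Sum>x\<in>B. gen x * Phi B n (\<lambda>z. f (b # x # z))) +
        (\<Sum>x\<in>B. const (kos x b) * (gen x * Phi B n (del b (?d x))))"
      by (simp add: Phi_add Phi_scale gen_const_left_commute distrib_left sum.distrib)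
    also have "(\<Sum>x\<in>B. gen x * Phi B n (\<lambda>z. f (b # x # z))) = (\<Sum>x\<in>B. if x =
        b then Phi B (Suc n) (?d x) else 0)"
      using finite_basis b by simp
    finally show ?thesis
      by (simp only: Phi.simps(2)[of B "Suc n"] contract.sum sum_subtractf sum.distrib)
  qed
  ultimately show ?case by metis
qed

text \<open>Contraction with the coordinate functional of \<open>b\<close> turns the hypothesis into
  the one for \<open>del b f\<close> in one degree less, and \<open>del_eq_0\<close> recovers
  \<open>f\<close> on words that begin with \<open>b\<close>. In degree 0 the claim is that
  \<open>J\<close> contains no nonzero constant.\<close>

lemma Phi_top_injective:
  assumes Q: "Q1 \<union> Q2 = B" "Q1 \<inter> Q2 = {}"
    and "ord_sym Q1 Q2 f" "Phi B n f \<in> Sp (short n)" "set z \<subseteq> B" "length z = n"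
  shows "f z = 0"
  using assms(3-)
proof (induction n arbitrary: f z)
  case 0
  have "Sp {} \<subseteq> J"
    using Sp_induct[OF _ subspace_J] by blast
  then show ?case using 0 const_in_J_iff by auto
next
  case (Suc n)
  have "del b f z = 0" if b: "b \<in> B" and z: "set z \<subseteq> B" "length z = n" for b z
  proof (rule Suc.IH[OF del_ord_sym[OF Suc.prems(1) Q b] _ z])
    obtain \<xi> where \<xi>: "env_functional \<xi>" "\<xi> 1 = 0"
      "\<And>b'. b' \<in> B \<Longrightarrow> \<xi> (gen b') = (if b' = b then 1 else 0)"
      using coordinate_functional[OF finite_basis independent_basis b] by blast
    have "contract (par b) \<xi> (Phi B (Suc n) f) \<in> Sp (short n)"
      by (rule contract_augmentation[OF \<xi>(1,2) Suc.prems(2)])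
    from Sp_diff[OF this contract_Phi[OF \<xi> b, of n f]]
    show "Phi B n (del b f) \<in> Sp (short n)" by (simp del: Phi.simps(2))
  qed
  then show ?case
    using Suc.prems del_eq_0[OF Suc.prems(1) Q(1)] by (cases z) auto
qed

lemma Phi_injective:
  assumes Q: "Q1 \<union> Q2 = B" "Q1 \<inter> Q2 = {}" and f: "ord_sym Q1 Q2 f"
    and J: "(\<Sum>n<N. Phi B n f) \<in> J" and z: "set z \<subseteq> B" "length z < N"
  shows "f z = 0"
  using J z
proof (induction N arbitrary: z)
  case (Suc N)
  have "(\<Sum>n<N. Phi B n f) \<in> Sp (short N)"
    by (rule Sp_sum) (auto intro!: Sp_mono[OF _ Phi_short])
  then have "Phi B N f \<in> Sp (short N)"
    using Sp_diff[OF Sp_J[OF Suc.prems(1)]] by fastforce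
  then have top: "f z = 0" if "set z \<subseteq> B" "length z = N" for z
    using Phi_top_injective[OF Q f] that by blast
  then have "(\<Sum>n<N. Phi B n f) \<in> J"
    using Suc.prems(1) Phi_eq_0[of B N f] by simp
  then show ?case
    using Suc top less_Suc_eq by metis
qed simp

end

context adapted_basis
begin


subsection \<open>The adjoint action on symmetrized elements\<close>

text \<open>The supercommutator with the letter \<open>x\<close>; writing its sign through
  \<open>eps\<close> admits arbitrary \<open>t\<close>.\<close>

definition ad :: "'g \<Rightarrow> 'g free_alg \<Rightarrow> 'g free_alg" where
  "ad x t = gen x * t - eps (par x) t * gen x"

lemma ad_sum: "ad x (sum f I) = (\<Sum>i\<in>I. ad x (f i))"
  by (simp add: ad_def eps_sum sum_distrib_left sum_distrib_right sum_subtractf)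

lemma ad_cong: "s \<approx> t \<Longrightarrow> ad x s \<approx> ad x t"
  unfolding ad_def by (intro cong_diff cong_mult eps_cong) auto

lemma ad_const: "ad x (const a) = 0"
  by (simp add: ad_def const_commute)

lemma ad_gen_mult:
  assumes "x \<in> B" "b \<in> B"
  shows "ad x (gen b * t) \<approx>
    (\<Sum>d\<in>B. const (c x b d) * gen d) * t + const (kos x b) * (gen b * ad x t)"
proof -
  have "ad x (gen b * t) = gen x * gen b * t - eps (par x) (gen b) * eps (par x) t * gen x"
    by (simp add: ad_def eps_mult mult.assoc)
  also have "\<dots> \<approx> (const (kos x b) * (gen b * gen x) + (\<Sum>d\<in>B. const (c x b d) * gen d)) * t -
      (const (kos x b) * gen b) * eps (par x) t * gen x"
    by (intro cong_diff cong_mult commutation assms eps_gen par) auto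
  also have "\<dots> = (\<Sum>d\<in>B. const (c x b d) * gen d) * t + const (kos x b) * (gen b * ad x t)"
    by (simp add: ad_def algebra_simps)
  finally show ?thesis .
qed

text \<open>The derivation action on the tensor algebra, transposed to coordinates: one letter of
  the word is replaced at a time, and since \<open>c x a b\<close> is the coefficient of the new
  letter \<open>b\<close>, the sum runs over the old letter \<open>a\<close>.\<close>

primrec act :: "'g \<Rightarrow> ('g list \<Rightarrow> complex) \<Rightarrow> 'g list \<Rightarrow> complex" where
  "act x f [] = 0"
| "act x f (b # z) = kos x b * act x (\<lambda>z. f (b # z)) z + (\<Sum>a\<in>B. c x a b * f (a # z))"

lemma ad_Phi:
  assumes x: "x \<in> B"
  shows "ad x (Phi B n f) \<approx> Phi B n (act x f)"
proof (induction n arbitrary: f)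
  case 0
  then show ?case by (simp add: ad_const)
next
  case (Suc n)
  let ?d = "\<lambda>b z. f (b # z)"
  have "ad x (Phi B (Suc n) f) = (\<Sum>b\<in>B. ad x (gen b * Phi B n (?d b)))"
    by (simp add: ad_sum)
  also have "\<dots> \<approx> (\<Sum>b\<in>B. (\<Sum>d\<in>B. const (c x b d) * gen d) * Phi B n (?d b) +
      const (kos x b) * (gen b * Phi B n (act x (?d b))))"
    by (intro cong_sum cong_trans[OF ad_gen_mult[OF x]] cong_add cong_mult Suc.IH) auto
  also have "\<dots> = (\<Sum>b\<in>B. \<Sum>d\<in>B. const (c x b d) * (gen d * Phi B n (?d b))) +
      (\<Sum>b\<in>B. gen b * Phi B n (\<lambda>z. kos x b * act x (?d b) z))"
    by (simp add: sum.distrib sum_distrib_right mult.assoc Phi_scale gen_const_left_commute)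
  also have "(\<Sum>b\<in>B. \<Sum>d\<in>B. const (c x b d) * (gen d * Phi B n (?d b))) =
      (\<Sum>d\<in>B. gen d * Phi B n (\<lambda>z. \<Sum>b\<in>B. c x b d * f (b # z)))"
    by (subst sum.swap) (simp add: Phi_sum Phi_scale sum_distrib_left gen_const_left_commute)
  also have "\<dots> + (\<Sum>b\<in>B. gen b * Phi B n (\<lambda>z. kos x b * act x (?d b) z)) = Phi B (Suc n) (act x f)"
    by (simp add: Phi_add sum.distrib distrib_left)
  finally show ?case .
qed

lemma c_zero:
  assumes "x \<in> Bk" "a \<in> B" "b \<in> B" "a \<in> Bk \<longleftrightarrow> b \<notin> Bk"
  shows "c x a b = 0"
  using assms c_kk[of x a b] c_kp[of x a b] disjoint_basis by blast

lemma act_scale: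
  assumes "set z \<subseteq> B" "\<And>z. set z \<subseteq> B \<Longrightarrow> f z = k * g z"
  shows "act x f z = k * act x g z"
  using assms
proof (induction z arbitrary: f g)
  case (Cons y z)
  have "act x (\<lambda>z. f (y # z)) z = k * act x (\<lambda>z. g (y # z)) z"
    using Cons.prems by (intro Cons.IH) auto
  moreover have "(\<Sum>a\<in>B. c x a y * f (a # z)) = k * (\<Sum>a\<in>B. c x a y * g (a # z))"
    unfolding sum_distrib_left using Cons.prems by (intro sum.cong) auto
  ultimately show ?case by (simp add: distrib_left)
qed auto

text \<open>\<open>c_kk\<close> and \<open>c_kp\<close> keep a replaced letter in its group, so
  misordered words still receive 0. The Koszul signs match because replacement shifts the parity of
  the letter by that of \<open>x\<close>.\<close>

lemma act_ord_sym:
  assumes f: "ord_sym Q1 Q2 f" and x: "x \<in> Bk" and Q: "(Q1, Q2) \<in> {(Bk, Bp), (Bp, Bk)}"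
  shows "ord_sym Q1 Q2 (act x f)"
proof (rule ord_sym_operatorI[OF f, where k = "\<lambda>y. kos x y" and
      h = "\<lambda>f y z. \<Sum>a\<in>B. c x a y * f (a # z)"])
  have QB: "Q1 \<union> Q2 = B" "Q1 \<inter> Q2 = {}" using Q disjoint_basis by auto
  have same: "a \<in> Q1 \<longleftrightarrow> b \<in> Q1" if "c x a b \<noteq> 0" "a \<in> B" "b \<in> B" for a b
    using that c_zero[OF x, of a b] Q disjoint_basis by auto
  fix f :: "'g list \<Rightarrow> complex" and a b z
  assume f: "ord_sym Q1 Q2 f" and z: "set z \<subseteq> B"
  {
    assume ab: "a \<in> Q1 \<and> b \<in> Q1 \<or> a \<in> Q2 \<and> b \<in> Q2"
    then have abB: "a \<in> B" "b \<in> B" using QB by auto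
    have 1: "c x a' a * f (a' # b # z) = kos a b * (kos x b * (c x a' a * f (b # a' # z)))"
      if "a' \<in> B" "a \<in> B" "b \<in> B" "a \<in> Q1 \<and> b \<in> Q1 \<or> a \<in> Q2 \<and> b \<in> Q2" for a a' b
    proof (cases "c x a' a = 0")
      case False
      then have "a' \<in> Q1 \<and> b \<in> Q1 \<or> a' \<in> Q2 \<and> b \<in> Q2"
        using same[of a' a] that QB by blast
      then have "f (a' # b # z) = kos a' b * f (b # a' # z)"
        using ord_sym_swap0[OF f z] by blast
      moreover have "kos a b * kos x b = kos a' b"
        using c_par[of x a' a] x that False by (simp add: koszul_add_left)
      ultimately show ?thesis by (metis mult.assoc mult.left_commute)
    qed simp
    have "act x (\<lambda>z. f (a # b # z)) z = kos a b * act x (\<lambda>z. f (b # a # z)) z"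
      by (rule act_scale[OF z ord_sym_swap0[OF f _ ab]])
    moreover have "(\<Sum>a'\<in>B. c x a' a * f (a' # b # z)) =
        kos a b * (kos x b * (\<Sum>a'\<in>B. c x a' a * f (b # a' # z)))"
      unfolding sum_distrib_left by (intro sum.cong refl 1 abB ab)
    moreover have "kos a b * (\<Sum>a'\<in>B. c x a' b * f (a' # a # z)) =
        kos x a * (\<Sum>a'\<in>B. c x a' b * f (a # a' # z))"
    proof -
      have "(\<Sum>a'\<in>B. c x a' b * f (a' # a # z)) =
          kos b a * (kos x a * (\<Sum>a'\<in>B. c x a' b * f (a # a' # z)))"
        unfolding sum_distrib_left using ab by (intro sum.cong refl 1 abB) auto
      then show ?thesis
        using kos_square[of a b] by (simp add: mult.assoc[symmetric])
    qed
    ultimately show "act x f (a # b # z) = kos a b * act x f (b # a # z)"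
      by (simp add: algebra_simps)
  next
    assume a: "a \<in> Q2" and b: "b \<in> Q1"
    then have abB: "a \<in> B" "b \<in> B" using QB by auto
    have "act x (\<lambda>z. f (a # b # z)) z = 0"
      using act_scale[OF z, of "\<lambda>z. f (a # b # z)" 0 "\<lambda>z. 0"] ord_sym_zero0[OF f _ a b] by simp
    moreover have "(\<Sum>a'\<in>B. c x a' a * f (a' # b # z)) = 0"
      using same[of _ a] ord_sym_zero0[OF f z, of _ b] a b abB QB
      by (intro sum.neutral ballI) (metis IntI UnE empty_iff mult_eq_0_iff)
    moreover have "(\<Sum>a'\<in>B. c x a' b * f (a # a' # z)) = 0"
      using same[of _ b] ord_sym_zero0[OF f z, of a] a b abB QB
      by (intro sum.neutral ballI) (metis mult_eq_0_iff)
    ultimately show "act x f (a # b # z) = 0"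
      by simp
  }
next
  show "ord_sym Q1 Q2 (\<lambda>z. \<Sum>a\<in>B. c x a y * f (a # z))" if "ord_sym Q1 Q2 f" for f y
    using that by (intro ord_sym_sum ord_sym_scale ord_sym_Cons)
qed simp

text \<open>Here injectivity of symmetrization pays off: invariance holds only modulo
  \<open>J\<close>, but \<open>act x f\<close> is again supersymmetric, so its coordinates vanish
  one by one.\<close>

lemma invariant_act_eq_0:
  assumes f: "ord_sym Q1 Q2 f" and Q: "(Q1, Q2) \<in> {(Bk, Bp), (Bp, Bk)}" and x: "x \<in> Bk"
    and inv: "ad x (\<Sum>n<N. Phi B n f) \<in> J" and z: "set z \<subseteq> B" "length z < N"
  shows "act x f z = 0"
proof (rule Phi_injective[OF _ _ act_ord_sym[OF f x Q] _ z])
  have "ad x (\<Sum>n<N. Phi B n f) \<approx> (\<Sum>n<N. Phi B n (act x f))"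
    unfolding ad_sum using x by (intro cong_sum ad_Phi) auto
  then show "(\<Sum>n<N. Phi B n (act x f)) \<in> J"
    using inv by (metis cong_0_iff cong_sym cong_trans)
qed (use Q disjoint_basis in auto)

subsection \<open>Exchanging left and right multiples of \<open>\<kk>\<close>\<close>

text \<open>The trace condition enters through the contraction of \<^const>\<open>act\<close> over a basis of \<open>\<kk>\<close>.\<close>

lemma right_multiple_of_left_multiple:
  assumes act: "\<And>x z. x \<in> Bk \<Longrightarrow> set z \<subseteq> B \<Longrightarrow> length z < N \<Longrightarrow> act x f z = 0"
    and Nil: "f [] = 0" and hd: "\<And>b z. b \<in> Bp \<Longrightarrow> f (b # z) = 0"
  shows "\<exists>T. (\<Sum>n<N. Phi B n f) \<approx> (\<Sum>j\<in>Bk. T j * gen j)"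
proof (cases N)
  case (Suc N')
  define T where "T j = (\<Sum>n<N'. Phi B n (\<lambda>z. f (j # z)))" for j
  have fin: "finite Bk" "finite Bp" using finite_basis by auto
  have "(\<Sum>n<N. Phi B n f) = (\<Sum>n<N'. Phi B (Suc n) f)"
    unfolding Suc sum.lessThan_Suc_shift using Nil by simp
  also have "\<dots> = (\<Sum>j\<in>B. gen j * T j)"
    unfolding T_def sum_distrib_left by (subst sum.swap) simp
  also have "\<dots> = (\<Sum>j\<in>Bk. gen j * T j)"
    using finite_basis hd by (intro sum.mono_neutral_right) (auto simp: T_def)
  \<comment> \<open>Each letter of k moves to the right past its coefficient. \<open>eps\<close>
    absorbs the sign into the new coefficient, so what has to vanish is the sum of the
    supercommutators.\<close>
  also have "\<dots> = (\<Sum>j\<in>Bk. ad j (T j)) + (\<Sum>j\<in>Bk. eps (par j) (T j) * gen j)"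
    by (simp add: ad_def sum_subtractf)
  also have "\<dots> \<approx> (\<Sum>j\<in>Bk. \<Sum>n<N'. Phi B n (act j (\<lambda>z. f (j # z)))) +
      (\<Sum>j\<in>Bk. eps (par j) (T j) * gen j)"
    unfolding T_def ad_sum by (intro cong_add cong_sum ad_Phi) auto
  also have "(\<Sum>j\<in>Bk. \<Sum>n<N'. Phi B n (act j (\<lambda>z. f (j # z)))) = 0"
  proof -
    have "(\<Sum>j\<in>Bk. act j (\<lambda>z. f (j # z)) z) = 0" if z: "set z \<subseteq> B" "length z < N'" for z
    proof -
      have "act j (\<lambda>z. f (j # z)) z = - (\<Sum>a\<in>B. kos j j * c j a j * f (a # z))" if j: "j \<in> Bk" for j
      proof -
        \<comment> \<open>Invariance under \<open>j\<close> is read off at a word that starts with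
          the same letter \<open>j\<close>. The summand for the first letter then contains the
          constants \<open>c j a j\<close>, and summing over \<open>j\<close> produces the
          trace.\<close>
        have "kos j j * act j (\<lambda>z. f (j # z)) z + (\<Sum>a\<in>B. c j a j * f (a # z)) = 0"
          using act[OF j, of "j # z"] z j Suc by simp
        then have "kos j j * (kos j j * act j (\<lambda>z. f (j # z)) z + (\<Sum>a\<in>B. c j a j * f (a # z))) = 0"
          by simp
        then show ?thesis
          unfolding distrib_left koszul_self_inverse_left
          by (simp add: sum_distrib_left mult.assoc eq_neg_iff_add_eq_0)
      qed
      then have "(\<Sum>j\<in>Bk. act j (\<lambda>z. f (j # z)) z) =
          - (\<Sum>a\<in>B. (\<Sum>j\<in>Bk. kos j j * c j a j) * f (a # z))"
        unfolding sum_distrib_right by (subst sum.swap) (simp add: sum_negf)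
      moreover have "(\<Sum>j\<in>Bk. kos j j * c j a j) * f (a # z) = 0" if "a \<in> B" for a
        using that c_trace[of a] hd[of a] by auto
      ultimately show ?thesis by simp
    qed
    then have "Phi B n (\<lambda>z. \<Sum>j\<in>Bk. act j (\<lambda>z. f (j # z)) z) = 0" if "n < N'" for n
      using that by (intro Phi_eq_0) auto
    then show ?thesis
      unfolding Phi_sum by (subst sum.swap) simp
  qed
  finally show ?thesis by auto
qed (auto intro!: exI[of _ "\<lambda>_. 0"])

primrec word_par :: "'g list \<Rightarrow> bit" where
  "word_par [] = 0"
| "word_par (b # z) = par b + word_par z"

lemma eps_Phi: "eps i (Phi B n f) \<approx> Phi B n (\<lambda>z. koszul i (word_par z) * f z)"
proof (induction n arbitrary: f)
  case (Suc n)
  have "eps i (Phi B (Suc n) f) = (\<Sum>b\<in>B. eps i (gen b) * eps i (Phi B n (\<lambda>z. f (b # z))))"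
    by (simp add: eps_sum eps_mult)
  also have "\<dots> \<approx> (\<Sum>b\<in>B. const (koszul i (par b)) * gen b *
      Phi B n (\<lambda>z. koszul i (word_par z) * f (b # z)))"
    by (intro cong_sum cong_mult eps_gen par Suc.IH)
  also have "\<dots> = Phi B (Suc n) (\<lambda>z. koszul i (word_par z) * f z)"
    by (simp add: koszul_add_right mult.assoc Phi_scale gen_const_left_commute)
  finally show ?case .
qed simp

text \<open>\<open>act x\<close> shifts parity by \<open>par x\<close>, so it commutes with the sign
  operator up to the Koszul sign of \<open>i\<close> and \<open>par x\<close>.\<close>

lemma act_signed:
  assumes "x \<in> B" "set z \<subseteq> B"
  shows "act x (\<lambda>z. koszul i (word_par z) * f z) z = koszul i (word_par z + par x) * act x f z"
  using assms(2)
proof (induction z arbitrary: f)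
  case (Cons b z)
  have "act x (\<lambda>z. koszul i (word_par (b # z)) * f (b # z)) z =
      koszul i (par b) * act x (\<lambda>z. koszul i (word_par z) * f (b # z)) z"
    using Cons.prems by (intro act_scale) (auto simp: koszul_add_right)
  also have "\<dots> = koszul i (word_par (b # z) + par x) * act x (\<lambda>z. f (b # z)) z"
    using Cons by (simp add: koszul_add_right)
  finally have 1: "act x (\<lambda>z. koszul i (word_par (b # z)) * f (b # z)) z =
      koszul i (word_par (b # z) + par x) * act x (\<lambda>z. f (b # z)) z" .
  have "c x a b * (koszul i (word_par (a # z)) * f (a # z)) =
      koszul i (word_par (b # z) + par x) * (c x a b * f (a # z))" if "a \<in> B" for a
  proof (cases "c x a b = 0")
    case False
    then have "par b = par x + par a"
      using c_par[OF assms(1) that, of b] Cons.prems by simp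
    then have "word_par (b # z) + par x = word_par (a # z)"
      by (cases "par x"; cases "par a"; cases "word_par z") simp_all
    then show ?thesis by (metis mult.left_commute)
  qed simp
  then have "(\<Sum>a\<in>B. c x a b * (koszul i (word_par (a # z)) * f (a # z))) =
      koszul i (word_par (b # z) + par x) * (\<Sum>a\<in>B. c x a b * f (a # z))"
    unfolding sum_distrib_left by (intro sum.cong refl)
  with 1 show ?case
    unfolding act.simps by (simp add: algebra_simps)
qed simp

lemma act_snoc:
  "act x f (z @ [j]) = act x (\<lambda>z. f (z @ [j])) z +
     koszul (par x) (word_par z) * (\<Sum>a\<in>B. c x a j * f (z @ [a]))"
  by (induction z arbitrary: f) (simp_all add: koszul_add_right algebra_simps)

text \<open>The mirror image of the preceding exchange, with the letter of k peeled off at the end.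
  The acting letter now crosses the whole word before it reaches the last one, which brings in
  \<open>word_par\<close>.\<close>

lemma left_multiple_of_right_multiple:
  assumes act: "\<And>x z. x \<in> Bk \<Longrightarrow> set z \<subseteq> B \<Longrightarrow> length z < N \<Longrightarrow> act x f z = 0"
    and Nil: "f [] = 0" and last: "\<And>b z. b \<in> Bp \<Longrightarrow> f (z @ [b]) = 0"
  shows "\<exists>T. (\<Sum>n<N. Phi B n f) \<approx> (\<Sum>j\<in>Bk. gen j * T j)"
proof (cases N)
  case (Suc N')
  \<comment> \<open>\<open>ad j\<close> attaches the sign to the coefficient standing left of
    \<open>j\<close>. So the new coefficient \<open>T j\<close> is the sign-twisted
    \<open>S j\<close>, whose coordinates are \<open>g j\<close>.\<close>
  define g where "g j z = koszul (par j) (word_par z) * f (z @ [j])" for j z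
  define S where "S j = (\<Sum>n<N'. Phi B n (\<lambda>z. f (z @ [j])))" for j
  define T where "T j = (\<Sum>n<N'. Phi B n (g j))" for j
  have T: "eps (par j) (T j) \<approx> S j" for j
  proof -
    have "eps (par j) (S j) \<approx> T j"
      unfolding S_def T_def g_def eps_sum by (intro cong_sum eps_Phi)
    then show ?thesis
      by (meson cong_sym cong_trans eps_cong eps_eps)
  qed
  have "(\<Sum>n<N. Phi B n f) = (\<Sum>n<N'. Phi B (Suc n) f)"
    unfolding Suc sum.lessThan_Suc_shift using Nil by simp
  also have "\<dots> = (\<Sum>j\<in>B. S j * gen j)"
    unfolding S_def sum_distrib_right Phi_snoc by (rule sum.swap)
  also have "\<dots> = (\<Sum>j\<in>Bk. S j * gen j)"
    using finite_basis last by (intro sum.mono_neutral_right) (auto simp: S_def)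
  also have "\<dots> \<approx> (\<Sum>j\<in>Bk. eps (par j) (T j) * gen j)"
    by (intro cong_sum cong_mult cong_sym[OF T]) auto
  also have "\<dots> = (\<Sum>j\<in>Bk. gen j * T j) - (\<Sum>j\<in>Bk. ad j (T j))"
    by (simp add: ad_def sum_subtractf)
  also have "\<dots> \<approx> (\<Sum>j\<in>Bk. gen j * T j) - (\<Sum>j\<in>Bk. \<Sum>n<N'. Phi B n (act j (g j)))"
    unfolding T_def ad_sum by (intro cong_diff cong_sum ad_Phi) auto
  also have "(\<Sum>j\<in>Bk. \<Sum>n<N'. Phi B n (act j (g j))) = 0"
  proof -
    have "(\<Sum>j\<in>Bk. act j (g j) z) = 0" if z: "set z \<subseteq> B" "length z < N'" for z
    proof -
      have "act j (g j) z = - (\<Sum>a\<in>B. kos j j * c j a j * f (z @ [a]))" if j: "j \<in> Bk" for j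
      proof -
        have "act j (\<lambda>z. f (z @ [j])) z = - koszul (par j) (word_par z) *
            (\<Sum>a\<in>B. c j a j * f (z @ [a]))"
          using act[OF j, of "z @ [j]"] z j Suc act_snoc[of j f z j]
          by (simp add: eq_neg_iff_add_eq_0)
        moreover have "act j (g j) z = kos j j * (koszul (par j) (word_par z) * act j (\<lambda>z. f (z @
            [j])) z)"
          unfolding g_def using act_signed[of j z "par j" "\<lambda>z. f (z @ [j])"] j z
          by (simp add: koszul_add_right mult_ac)
        ultimately show ?thesis
          by (simp add: sum_distrib_left mult.assoc sum_negf)
      qed
      then have "(\<Sum>j\<in>Bk. act j (g j) z) =
          - (\<Sum>a\<in>B. (\<Sum>j\<in>Bk. kos j j * c j a j) * f (z @ [a]))"
        unfolding sum_distrib_right by (subst sum.swap) (simp add: sum_negf)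
      moreover have "(\<Sum>j\<in>Bk. kos j j * c j a j) * f (z @ [a]) = 0" if "a \<in> B" for a
        using that c_trace[of a] last[of a] by auto
      ultimately show ?thesis by simp
    qed
    then have "Phi B n (\<lambda>z. \<Sum>j\<in>Bk. act j (g j) z) = 0" if "n < N'" for n
      using that by (intro Phi_eq_0) auto
    then show ?thesis
      unfolding Phi_sum by (subst sum.swap) simp
  qed
  finally show ?thesis by auto
qed (auto intro!: exI[of _ "\<lambda>_. 0"])

end

context adapted_basis
begin

subsection \<open>Surjectivity of symmetrization\<close>

text \<open>The empty word is excluded: brackets of letters produce letters and never constants. For
  words in k this keeps all corrections inside the augmentation ideal, as
  \<open>k_words_span\<close> requires.\<close>

abbreviation lower :: "'g set \<Rightarrow> nat \<Rightarrow> 'g list set" where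
  "lower L n \<equiv> {w. set w \<subseteq> L \<and> 1 \<le> length w \<and> length w \<le> n}"

text \<open>The two instances are \<open>B\<close> and \<open>Bk\<close>. In the second, reordering
  a word of k-letters creates only k-letters.\<close>

definition bracket_closed :: "'g set \<Rightarrow> bool" where
  "bracket_closed L \<longleftrightarrow> L \<subseteq> B \<and> (\<forall>a\<in>L. \<forall>b\<in>L. \<forall>d\<in>B - L. c a b d = 0)"

lemma bracket_closed_B: "bracket_closed B"
  and bracket_closed_Bk: "bracket_closed Bk"
  using c_kk by (auto simp: bracket_closed_def)

text \<open>The supersymmetric tensors of degree \<open>n\<close> over the span of \<open>Q\<close>,
  extended by zero to all words.\<close>

definition sym_on :: "'g set \<Rightarrow> nat \<Rightarrow> ('g list \<Rightarrow> complex) \<Rightarrow> bool" where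
  "sym_on Q n g \<longleftrightarrow> (\<forall>z. g z \<noteq> 0 \<longrightarrow> set z \<subseteq> Q \<and> length z = n) \<and>
     (\<forall>u a b z. a \<in> Q \<longrightarrow> b \<in> Q \<longrightarrow> g (u @ a # b # z) = kos a b * g (u @ b # a # z))"

lemma sym_on_support: "sym_on Q n g \<Longrightarrow> g z \<noteq> 0 \<Longrightarrow> set z \<subseteq> Q \<and> length z = n"
  and sym_on_swap: "sym_on Q n g \<Longrightarrow> a \<in> Q \<Longrightarrow> b \<in> Q \<Longrightarrow>
    g (u @ a # b # z) = kos a b * g (u @ b # a # z)"
  unfolding sym_on_def by blast+

lemma sym_on_scale: "sym_on Q n g \<Longrightarrow> sym_on Q n (\<lambda>z. k * g z)"
  unfolding sym_on_def by (metis mult.left_commute mult_zero_right)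

text \<open>\<open>ins q g\<close> is the sum, over all positions, of the insertions of \<open>q\<close> into the tensor \<open>g\<close>.\<close>

primrec ins :: "'g \<Rightarrow> ('g list \<Rightarrow> complex) \<Rightarrow> 'g list \<Rightarrow> complex" where
  "ins q g [] = 0"
| "ins q g (x # z) = kos x q * ins q (\<lambda>z. g (x # z)) z + (if x = q then g z else 0)"

lemma ins_scale: "ins q (\<lambda>z. k * g z) z = k * ins q g z"
  by (induction z arbitrary: g) (simp_all add: algebra_simps)

lemma ins_support:
  "ins q g z \<noteq> 0 \<Longrightarrow> \<exists>z'. g z' \<noteq> 0 \<and> set z \<subseteq> insert q (set z') \<and> length z = Suc (length z')"
proof (induction z arbitrary: g)
  case (Cons x z)
  then consider "x = q" "g z \<noteq> 0" | "ins q (\<lambda>z. g (x # z)) z \<noteq> 0"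
    by (cases "x = q \<and> g z \<noteq> 0") (auto split: if_splits)
  then show ?case
  proof cases
    case 1
    then show ?thesis by (intro exI[of _ z]) auto
  next
    case 2
    then obtain z' where "g (x # z') \<noteq> 0" "set z \<subseteq> insert q (set z')" "length z = Suc (length z')"
      using Cons.IH by blast
    then show ?thesis by (intro exI[of _ "x # z'"]) auto
  qed
qed simp

lemma sym_on_ins:
  assumes g: "sym_on Q n g" and q: "q \<in> Q"
  shows "sym_on Q (Suc n) (ins q g)"
proof -
  have "ins q g (u @ a # b # z) = kos a b * ins q g (u @ b # a # z)" if ab: "a \<in> Q" "b \<in> Q"
      for u a b z
  proof -
    have swap: "\<forall>u z. g (u @ a # b # z) = kos a b * g (u @ b # a # z)"
      using sym_on_swap[OF g ab] by blast
    show ?thesis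
      using swap
    proof (induction u arbitrary: g)
      case Nil
      have "(\<lambda>z. g (a # b # z)) = (\<lambda>z. kos a b * g (b # a # z))"
        using Nil[rule_format, of "[]"] by simp
      then have "ins q (\<lambda>z. g (a # b # z)) z = kos a b * ins q (\<lambda>z. g (b # a # z)) z"
        by (simp add: ins_scale)
      then show ?case
        using kos_square[of a b] by (simp add: algebra_simps koszul_sym)
    next
      case (Cons x u)
      have "ins q (\<lambda>z. g (x # z)) (u @ a # b # z) = kos a b * ins q (\<lambda>z. g (x # z)) (u @ b # a # z)"
        using Cons.prems[rule_format, of "x # _"] by (intro Cons.IH) simp
      then show ?case
        using Cons.prems by (simp add: algebra_simps)
    qed
  qed
  moreover have "set z \<subseteq> Q \<and> length z = Suc n" if "ins q g z \<noteq> 0" for z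
    using ins_support[OF that] sym_on_support[OF g] q by force
  ultimately show ?thesis unfolding sym_on_def by blast
qed

text \<open>Each of the n + 1 insertions of \<open>q\<close> differs from \<open>q\<close> placed in
  front, up to the sign built into \<open>ins\<close>, only by brackets, which have one letter fewer
  and stay in the alphabet \<open>L\<close>.\<close>

lemma Phi_ins:
  assumes L: "bracket_closed L" "Q \<subseteq> L" and q: "q \<in> Q"
  shows "const (of_nat (Suc n)) * (gen q * Phi Q n g) - Phi Q (Suc n) (ins q g) \<in> Sp (lower L n)"
proof (induction n arbitrary: g)
  case 0
  have "finite Q" using L finite_basis unfolding bracket_closed_def by (meson finite_subset)
  then have "(\<Sum>x\<in>Q. gen x * const (if x = q then g [] else 0)) = gen q * const (g [])"
    using q by (simp add: if_distrib[of const] if_distrib[of "\<lambda>u. _ * u"] sum.delta cong: if_cong)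
  then show ?case by (simp add: Sp_J)
next
  case (Suc n)
  have fin: "finite Q" and QB: "Q \<subseteq> B"
    using L finite_basis unfolding bracket_closed_def by (auto intro: finite_subset)
  let ?d = "\<lambda>x z. g (x # z)"
  let ?m = "of_nat (Suc n) :: complex"
  have 1: "const ?m * (gen q * (gen x * Phi Q n (?d x))) -
      const (kos x q) * (gen x * Phi Q (Suc n) (ins q (?d x))) \<in> Sp (lower L (Suc n))"
    if x: "x \<in> Q" for x
  proof -
    have "gen q * gen x \<approx> const (kos x q) * (gen x * gen q) + (\<Sum>d\<in>B. const (c q x d) * gen d)"
      using commutation[of q x] x q QB by (auto simp: koszul_sym)
    then have "gen q * gen x * Phi Q n (?d x) \<approx>
        (const (kos x q) * (gen x * gen q) + (\<Sum>d\<in>B. const (c q x d) * gen d)) * Phi Q n (?d x)"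
      by (intro cong_mult) auto
    then have "gen q * gen x * Phi Q n (?d x) -
        (const (kos x q) * (gen x * gen q) + (\<Sum>d\<in>B. const (c q x d) * gen d)) * Phi Q n (?d x)
        \<in> Sp (lower L (Suc n))" (is "?r \<in> _")
      unfolding cong_def by (rule Sp_J)
    moreover have "(\<Sum>d\<in>B. const (c q x d) * (gen d * Phi Q n (?d x))) \<in> Sp (lower L (Suc n))" (is
        "?s \<in> _")
    proof (rule Sp_sum)
      fix d assume d: "d \<in> B"
      show "const (c q x d) * (gen d * Phi Q n (?d x)) \<in> Sp (lower L (Suc n))"
      proof (cases "d \<in> L")
        case True
        then show ?thesis
          using L by (intro Sp_scale Sp_gen_mult[OF _ Phi_in_Sp]) auto
      next
        case False
        then have "c q x d = 0"
          using L q x d unfolding bracket_closed_def by blast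
        then show ?thesis by (simp add: Sp_J)
      qed
    qed
    moreover have "gen x * (const ?m * (gen q * Phi Q n (?d x)) - Phi Q (Suc n) (ins q (?d x)))
        \<in> Sp (lower L (Suc n))" (is "?t \<in> _")
      using x L by (intro Sp_gen_mult[OF _ Suc.IH]) auto
    ultimately have "const ?m * (?r + ?s) + const (kos x q) * ?t \<in> Sp (lower L (Suc n))"
      by (intro Sp_add Sp_scale)
    moreover have "const ?m * (?r + ?s) + const (kos x q) * ?t =
        const ?m * (gen q * (gen x * Phi Q n (?d x))) -
        const (kos x q) * (gen x * Phi Q (Suc n) (ins q (?d x)))"
    proof -
      have "?r + ?s = gen q * (gen x * Phi Q n (?d x)) -
          const (kos x q) * (gen x * (gen q * Phi Q n (?d x)))"
        by (simp add: distrib_right sum_distrib_right mult.assoc)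
      moreover have "?t = const ?m * (gen x * (gen q * Phi Q n (?d x))) -
          gen x * Phi Q (Suc n) (ins q (?d x))"
        by (simp only: right_diff_distrib gen_const_left_commute)
      ultimately show ?thesis
        by (simp only: right_diff_distrib F.scale_scale mult.commute[of ?m]) simp
    qed
    ultimately show ?thesis by metis
  qed
  have "const (of_nat (Suc (Suc n))) * (gen q * Phi Q (Suc n) g) - Phi Q (Suc (Suc n)) (ins q g) =
      (\<Sum>x\<in>Q. const ?m * (gen q * (gen x * Phi Q n (?d x))) -
      const (kos x q) * (gen x * Phi Q (Suc n) (ins q (?d x))))"
  proof -
    have "(\<Sum>x\<in>Q. gen x * Phi Q (Suc n) (\<lambda>z. if x = q then g z else 0)) = gen q * Phi Q (Suc n) g"
    proof -
      have "gen x * Phi Q (Suc n) (\<lambda>z. if x = q then g z else 0) =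
          (if x = q then gen q * Phi Q (Suc n) g else 0)" for x
        by (cases "x = q") (simp_all only: if_True if_False Phi_0 mult_zero_right refl)
      then show ?thesis using fin q by (simp only: sum.delta if_True)
    qed
    moreover have "Phi Q (Suc (Suc n)) (ins q g) =
        (\<Sum>x\<in>Q. const (kos x q) * (gen x * Phi Q (Suc n) (ins q (?d x)))) +
        (\<Sum>x\<in>Q. gen x * Phi Q (Suc n) (\<lambda>z. if x = q then g z else 0))"
      by (simp only: Phi.simps(2)[of Q "Suc n"] ins.simps Phi_add Phi_scale distrib_left sum.distrib
          gen_const_left_commute)
    moreover have "const ?m * (gen q * Phi Q (Suc n) g) =
        (\<Sum>x\<in>Q. const ?m * (gen q * (gen x * Phi Q n (?d x))))"
      by (simp add: sum_distrib_left)
    moreover have "const (of_nat (Suc (Suc n))) * (gen q * Phi Q (Suc n) g) =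
        const ?m * (gen q * Phi Q (Suc n) g) + gen q * Phi Q (Suc n) g"
    proof -
      have "of_nat (Suc (Suc n)) = ?m + 1" by simp
      then show ?thesis by (metis const_add const_1 distrib_right mult_1_left)
    qed
    ultimately show ?thesis by (simp only: sum_subtractf) (simp only: algebra_simps)
  qed
  also have "\<dots> \<in> Sp (lower L (Suc n))"
    by (rule Sp_sum) (rule 1)
  finally show ?case .
qed

lemma word_symmetrization:
  assumes L: "bracket_closed L" "Q \<subseteq> L" and v: "set v \<subseteq> Q"
  shows "\<exists>g. sym_on Q (length v) g \<and> wprod v - Phi Q (length v) g \<in> Sp (lower L (length v - 1))"
  using v
proof (induction v)
  case Nil
  have "sym_on Q 0 (\<lambda>z. if z = [] then 1 else 0)"
    by (auto simp: sym_on_def)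
  then show ?case
    by (intro exI[of _ "\<lambda>z. if z = [] then 1 else 0"]) (simp add: Sp_J)
next
  case (Cons x v)
  then obtain g where g: "sym_on Q (length v) g"
    "wprod v - Phi Q (length v) g \<in> Sp (lower L (length v - 1))" by auto
  let ?m = "of_nat (Suc (length v)) :: complex"
  \<comment> \<open>Dividing by n + 1 averages the insertions, which keeps the coefficient of the
    word equal to 1.\<close>
  let ?g = "\<lambda>z. inverse ?m * ins x g z"
  have x: "x \<in> Q" using Cons.prems by simp
  have "sym_on Q (Suc (length v)) ?g"
    by (rule sym_on_scale[OF sym_on_ins[OF g(1) x]])
  moreover have "wprod (x # v) - Phi Q (Suc (length v)) ?g \<in> Sp (lower L (length v))"
  proof -
    have "gen x * (wprod v - Phi Q (length v) g) \<in> Sp (lower L (length v))"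
      using x L by (intro Sp_gen_mult[OF _ g(2)]) auto
    from Sp_add[OF this Sp_scale[OF Phi_ins[OF L x, of "length v" g], of "inverse ?m"]]
    have "gen x * (wprod v - Phi Q (length v) g) +
        const (inverse ?m) * (const ?m * (gen x * Phi Q (length v) g) -
            Phi Q (Suc (length v)) (ins x g))
        \<in> Sp (lower L (length v))" .
    moreover have "const (inverse ?m) * (const ?m * (gen x * Phi Q (length v) g) -
        Phi Q (Suc (length v)) (ins x g)) =
        gen x * Phi Q (length v) g - Phi Q (Suc (length v)) ?g"
    proof -
      have "inverse ?m * ?m = 1" by (intro left_inverse) (metis of_nat_eq_0_iff nat.distinct(1))
      then show ?thesis
        by (simp only: Phi_scale right_diff_distrib F.scale_scale const_1 mult_1_left)
    qed
    ultimately show ?thesis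
      by (simp only: wprod_Cons right_diff_distrib) simp
  qed
  ultimately show ?case by auto
qed

lemma move_letter:
  assumes x: "x \<in> B" and u: "set u \<subseteq> B"
  shows "\<exists>k. gen x * wprod u - const k * (wprod u * gen x) \<in> Sp (lower B (length u))"
  using u
proof (induction u)
  case Nil
  then show ?case by (intro exI[of _ 1]) (simp add: Sp_J)
next
  case (Cons y u)
  then obtain k where k: "gen x * wprod u - const k * (wprod u * gen x) \<in> Sp (lower B (length u))"
    by auto
  have y: "y \<in> B" using Cons.prems by auto
  have "gen x * gen y * wprod u \<approx>
      (const (kos x y) * (gen y * gen x) + (\<Sum>d\<in>B. const (c x y d) * gen d)) * wprod u"
    by (intro cong_mult commutation x y) auto
  then have "gen x * gen y * wprod u -
      (const (kos x y) * (gen y * gen x) + (\<Sum>d\<in>B. const (c x y d) * gen d)) * wprod u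
      \<in> Sp (lower B (length (y # u)))" (is "?r \<in> _")
    unfolding cong_def by (rule Sp_J)
  moreover have "(\<Sum>d\<in>B. const (c x y d) * wprod (d # u)) \<in> Sp (lower B (length (y # u)))" (is
      "?s \<in> _")
    using Cons.prems by (intro Sp_sum Sp_scale Sp_word) auto
  moreover have "gen y * (gen x * wprod u - const k * (wprod u * gen x)) \<in>
      Sp (lower B (length (y # u)))" (is "?t \<in> _")
    using y by (intro Sp_gen_mult[OF _ k]) auto
  ultimately have "?r + ?s + const (kos x y) * ?t \<in> Sp (lower B (length (y # u)))"
    by (intro Sp_add Sp_scale)
  moreover have "?r + ?s + const (kos x y) * ?t =
      gen x * wprod (y # u) - const (kos x y * k) * (wprod (y # u) * gen x)"
  proof -
    have "?r + ?s = gen x * (gen y * wprod u) - const (kos x y) * (gen y * (gen x * wprod u))"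
      by (simp add: distrib_right sum_distrib_right mult.assoc wprod_Cons)
    moreover have "?t = gen y * (gen x * wprod u) - const k * (gen y * (wprod u * gen x))"
      by (simp only: right_diff_distrib gen_const_left_commute)
    ultimately show ?thesis
      by (simp only: right_diff_distrib F.scale_scale wprod_Cons mult.assoc) simp
  qed
  ultimately show ?case by metis
qed

text \<open>Insertion sort on words: passing one letter over another costs a sign, collected in
  \<open>k\<close>, and a bracket, which makes the word shorter.\<close>

lemma sort_word:
  assumes Q: "Q1 \<union> Q2 = B" and w: "set w \<subseteq> B"
  shows "\<exists>k u v. set u \<subseteq> Q1 \<and> set v \<subseteq> Q2 \<and> length u + length v = length w \<and>
    wprod w - const k * (wprod u * wprod v) \<in> Sp (lower B (length w - 1))"
  using w
proof (induction w)
  case Nil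
  then show ?case by (intro exI[of _ 1] exI[of _ "[]"]) (simp add: Sp_J)
next
  case (Cons x w)
  then obtain k u v where *: "set u \<subseteq> Q1" "set v \<subseteq> Q2" "length u + length v = length w"
    "wprod w - const k * (wprod u * wprod v) \<in> Sp (lower B (length w - 1))" by auto
  have x: "x \<in> B" using Cons.prems by simp
  have 1: "gen x * (wprod w - const k * (wprod u * wprod v)) \<in> Sp (lower B (length w))"
    using x by (intro Sp_gen_mult[OF _ *(4)]) auto
  show ?case
  proof (cases "x \<in> Q1")
    case True
    have "wprod (x # w) - const k * (wprod (x # u) * wprod v) \<in> Sp (lower B (length w))"
      using 1 by (simp add: wprod_Cons right_diff_distrib mult.assoc gen_const_left_commute)
    then show ?thesis
      using * True by (intro exI[of _ k] exI[of _ "x # u"] exI[of _ v]) auto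
  next
    case False
    then have x2: "x \<in> Q2" using x Q by auto
    obtain k' where k': "gen x * wprod u - const k' * (wprod u * gen x) \<in> Sp (lower B (length u))"
      using move_letter[OF x, of u] * Q by auto
    have "(gen x * wprod u - const k' * (wprod u * gen x)) * wprod v \<in> Sp (lower B (length w))"
      using * Q by (intro Sp_mult_right[OF _ k']) auto
    from Sp_add[OF 1 Sp_scale[OF this, of k]]
    have "gen x * (wprod w - const k * (wprod u * wprod v)) +
        const k * ((gen x * wprod u - const k' * (wprod u * gen x)) * wprod v) \<in>
            Sp (lower B (length w))" .
    moreover have "gen x * (wprod w - const k * (wprod u * wprod v)) +
        const k * ((gen x * wprod u - const k' * (wprod u * gen x)) * wprod v) =
        wprod (x # w) - const (k * k') * (wprod u * wprod (x # v))"
      by (simp only: right_diff_distrib left_diff_distrib F.scale_scale wprod_Cons mult.assoc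
          gen_const_left_commute) simp
    ultimately have "wprod (x # w) - const (k * k') * (wprod u * wprod (x # v)) \<in>
        Sp (lower B (length w))"
      by metis
    then show ?thesis
      using * x2 by (intro exI[of _ "k * k'"] exI[of _ u] exI[of _ "x # v"]) auto
  qed
qed

lemma all_in_Sp_B: "t \<in> Sp {w. set w \<subseteq> B}"
proof (induction t rule: F_induct)
  case (word w)
  show ?case
  proof (induction w)
    case Nil
    then show ?case using Sp_word[of "[]" "{w. set w \<subseteq> B}"] by simp
  next
    case (Cons x w)
    obtain a where "gen x \<approx> (\<Sum>b\<in>B. const (a b) * gen b)"
      using spanning_basis by blast
    then have "wprod (x # w) \<approx> (\<Sum>b\<in>B. const (a b) * gen b) * wprod w"
      unfolding wprod_Cons by (intro cong_mult) auto
    moreover have "(\<Sum>b\<in>B. const (a b) * gen b) * wprod w \<in> Sp {w. set w \<subseteq> B}"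
      unfolding sum_distrib_right mult.assoc by (intro Sp_sum Sp_scale Sp_gen_mult[OF _ Cons]) auto
    ultimately show ?case by (rule Sp_cong)
  qed
qed (auto intro: Sp_add Sp_scale Sp_J)

text \<open>Surjectivity of symmetrization, phrased as an induction principle. A word is sorted into
  a \<open>Q1\<close>-word followed by a \<open>Q2\<close>-word and each part is symmetrized; the
  corrections are shorter words, covered by induction on the length.\<close>

lemma symmetrized_products_span:
  assumes Q: "Q1 \<union> Q2 = B" and V: "F.subspace V" "J \<subseteq> V"
    and prod: "\<And>i l g h. sym_on Q1 i g \<Longrightarrow> sym_on Q2 l h \<Longrightarrow> Phi Q1 i g * Phi Q2 l h \<in> V"
  shows "t \<in> V"
proof -
  have lower_V: "s \<in> V" if "s \<in> Sp (lower B n)" "\<And>w. length w \<le> n \<Longrightarrow> set w \<subseteq> B \<Longrightarrow> wprod w \<in> V" for s n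
    by (rule Sp_induct[OF that(1) V]) (use that(2) in auto)
  have QB: "Q1 \<subseteq> B" "Q2 \<subseteq> B" using Q by auto
  have word: "wprod w \<in> V" if "set w \<subseteq> B" for w
    using that
  proof (induction "length w" arbitrary: w rule: less_induct)
    case less
    obtain k u v where *: "set u \<subseteq> Q1" "set v \<subseteq> Q2" "length u + length v = length w"
      "wprod w - const k * (wprod u * wprod v) \<in> Sp (lower B (length w - 1))"
      using sort_word[OF Q less.prems] by blast
    show ?case
    proof (cases "w = []")
      case True
      have "sym_on Q 0 (\<lambda>z. if z = [] then 1 else 0)" for Q
        by (auto simp: sym_on_def)
      from prod[OF this this] show ?thesis using True by simp
    next
      case False
      have IH: "s \<in> V" if s: "s \<in> Sp (lower B (length w - 1))" for s
      proof (rule lower_V[OF s])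
        fix v assume v: "length v \<le> length w - 1" "set v \<subseteq> B"
        have "length v < length w" using v(1) False by (cases w) auto
        then show "wprod v \<in> V" using less.hyps v(2) by blast
      qed
      obtain g where g: "sym_on Q1 (length u) g" "wprod u - Phi Q1 (length u) g \<in>
          Sp (lower B (length u - 1))"
        using word_symmetrization[OF bracket_closed_B QB(1) *(1)] by blast
      obtain h where h: "sym_on Q2 (length v) h" "wprod v - Phi Q2 (length v) h \<in>
          Sp (lower B (length v - 1))"
        using word_symmetrization[OF bracket_closed_B QB(2) *(2)] by blast
      have "(wprod u - Phi Q1 (length u) g) * wprod v \<in> Sp (lower B (length w - 1))"
        using * QB by (intro Sp_mult_right[OF _ g(2)]) auto
      moreover have "Phi Q1 (length u) g * (wprod v - Phi Q2 (length v) h) \<in>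
          Sp (lower B (length w - 1))"
      proof (rule Sp_linear[OF F_linear_intros(2) subspace_Sp _ _ Phi_in_Sp])
        show "t * (wprod v - Phi Q2 (length v) h) \<in> Sp (lower B (length w - 1))" if "t \<in> J" for t
          using that by (intro Sp_J J_mult_right)
        show "wprod z * (wprod v - Phi Q2 (length v) h) \<in> Sp (lower B (length w - 1))"
          if "z \<in> {z. set z \<subseteq> Q1 \<and> length z = length u}" for z
          using that * QB by (intro Sp_mult[OF _ h(2)]) auto
      qed
      ultimately have "(wprod u - Phi Q1 (length u) g) * wprod v +
          Phi Q1 (length u) g * (wprod v - Phi Q2 (length v) h) \<in> V"
        by (intro IH Sp_add)
      from F.subspace_add[OF V(1) this prod[OF g(1) h(1)]]
      have "wprod u * wprod v \<in> V"
        by (simp add: algebra_simps)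
      from F.subspace_add[OF V(1) IH[OF *(4)] F.subspace_scale[OF V(1) this, of k]]
      show ?thesis by simp
    qed
  qed
  show ?thesis
    by (rule Sp_induct[OF all_in_Sp_B V]) (use word in auto)
qed

text \<open>The counterpart for the augmentation ideal of the subalgebra generated by k: tensors of
  positive degree suffice, because every correction is a shorter nonempty word in k.\<close>

lemma k_words_span:
  assumes V: "F.subspace V" "J \<subseteq> V"
    and sym: "\<And>n g. 1 \<le> n \<Longrightarrow> sym_on Bk n g \<Longrightarrow> Phi Bk n g \<in> V"
    and w: "set w \<subseteq> Bk" "w \<noteq> []"
  shows "wprod w \<in> V"
  using w
proof (induction "length w" arbitrary: w rule: less_induct)
  case less
  obtain g where g: "sym_on Bk (length w) g" "wprod w - Phi Bk (length w) g \<in>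
      Sp (lower Bk (length w - 1))"
    using word_symmetrization[OF bracket_closed_Bk _ less.prems(1)] by blast
  have "wprod w - Phi Bk (length w) g \<in> V"
  proof (rule Sp_induct[OF g(2) V])
    fix v assume "v \<in> lower Bk (length w - 1)"
    then show "wprod v \<in> V"
      using less.prems by (intro less.hyps) (auto simp: Suc_le_eq dest: order_le_less_trans)
  qed
  moreover have "Phi Bk (length w) g \<in> V"
    using less.prems by (intro sym g) (simp add: Suc_le_eq)
  ultimately show ?case using F.subspace_add[OF V(1)] by fastforce
qed

end

section \<open>Products of symmetrized tensors, written in coordinates\<close>

context adapted_basis
begin

text \<open>The external product of two tensors, with the word cut where its initial segment in
  \<open>Q\<close> ends. If \<open>h\<close> is supported on words without letters of
  \<open>Q\<close>, misordered words automatically receive 0.\<close>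

definition tens :: "'g set \<Rightarrow> ('g list \<Rightarrow> complex) \<Rightarrow> ('g list \<Rightarrow> complex) \<Rightarrow> 'g list \<Rightarrow> complex" where
  "tens Q g h z = g (takeWhile (\<lambda>x. x \<in> Q) z) * h (dropWhile (\<lambda>x. x \<in> Q) z)"

lemma tens_Nil: "tens Q g h [] = g [] * h []"
  and tens_Cons: "tens Q g h (x # z) =
    (if x \<in> Q then tens Q (\<lambda>z. g (x # z)) h z else g [] * h (x # z))"
  by (simp_all add: tens_def)

lemma tens_ord_sym:
  assumes g: "sym_on Q1 i g" and h: "sym_on Q2 l h" and Q: "Q1 \<inter> Q2 = {}"
  shows "ord_sym Q1 Q2 (tens Q1 g h)"
proof -
  have h0: "h z = 0" if "\<not> set z \<subseteq> Q2" for z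
    using sym_on_support[OF h] that by blast
  have "(a \<in> Q1 \<and> b \<in> Q1 \<or> a \<in> Q2 \<and> b \<in> Q2 \<longrightarrow>
      tens Q1 g h (u @ a # b # z) = kos a b * tens Q1 g h (u @ b # a # z)) \<and>
     (a \<in> Q2 \<and> b \<in> Q1 \<longrightarrow> tens Q1 g h (u @ a # b # z) = 0)" for u a b z
  proof -
    have "\<forall>u z. a \<in> Q1 \<longrightarrow> b \<in> Q1 \<longrightarrow> g (u @ a # b # z) = kos a b * g (u @ b # a # z)"
      using sym_on_swap[OF g] by blast
    then show ?thesis
    proof (induction u arbitrary: g)
      case Nil
      have "g (a # b # v) = kos a b * g (b # a # v)" if "a \<in> Q1" "b \<in> Q1" for v
        using Nil[rule_format, OF that, of "[]"] by simp
      then show ?case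
        using Q sym_on_swap[OF h, of a b "[]" z] h0[of "a # b # z"]
        by (auto simp: tens_Cons tens_def)
    next
      case (Cons x u)
      have "(a \<in> Q1 \<and> b \<in> Q1 \<or> a \<in> Q2 \<and> b \<in> Q2 \<longrightarrow>
          tens Q1 (\<lambda>z. g (x # z)) h (u @ a # b # z) =
              kos a b * tens Q1 (\<lambda>z. g (x # z)) h (u @ b # a # z)) \<and>
         (a \<in> Q2 \<and> b \<in> Q1 \<longrightarrow> tens Q1 (\<lambda>z. g (x # z)) h (u @ a # b # z) = 0)"
        using Cons.prems by (intro Cons.IH) (metis append_Cons)
      moreover have "h (x # u @ a # b # z) = kos a b * h (x # u @ b # a # z)"
        if "a \<in> Q1 \<and> b \<in> Q1 \<or> a \<in> Q2 \<and> b \<in> Q2"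
      proof (cases "a \<in> Q2")
        case True
        then show ?thesis using sym_on_swap[OF h, of a b "x # u" z] that Q by auto
      next
        case False
        then show ?thesis using h0 by simp
      qed
      moreover have "h (x # u @ a # b # z) = 0" if "b \<in> Q1"
        using that Q by (intro h0) auto
      ultimately show ?case by (auto simp: tens_Cons)
    qed
  qed
  then show ?thesis by (intro ord_symI) blast+
qed

lemma Phi_subset:
  assumes "Q \<subseteq> B" "\<And>z. f z \<noteq> 0 \<Longrightarrow> set z \<subseteq> Q"
  shows "Phi B n f = Phi Q n f"
  using assms(2)
proof (induction n arbitrary: f)
  case (Suc n)
  have "Phi B (Suc n) f = (\<Sum>b\<in>Q. gen b * Phi B n (\<lambda>z. f (b # z)))"
    unfolding Phi.simps
  proof (rule sum.mono_neutral_right[OF finite_basis assms(1)], intro ballI)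
    fix b assume "b \<in> B - Q"
    then have "(\<lambda>z. f (b # z)) = (\<lambda>z. 0)" using Suc.prems[of "b # _"] by fastforce
    then show "gen b * Phi B n (\<lambda>z. f (b # z)) = 0" by simp
  qed
  also have "\<dots> = Phi Q (Suc n) f"
    using Suc.prems[of "_ # _"] by (simp add: Suc.IH)
  finally show ?case .
qed simp

lemma Phi_tens:
  assumes Q: "Q1 \<union> Q2 = B" "Q1 \<inter> Q2 = {}"
    and g: "\<And>z. g z \<noteq> 0 \<Longrightarrow> set z \<subseteq> Q1 \<and> length z = i" and h: "\<And>z. h z \<noteq> 0 \<Longrightarrow> set z \<subseteq> Q2"
  shows "Phi B (i + l) (tens Q1 g h) = Phi Q1 i g * Phi Q2 l h"
  using g
proof (induction i arbitrary: g)
  case 0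
  have "tens Q1 g h z = g [] * h z" for z
  proof (cases z)
    case (Cons x z')
    have "g (x # v) = 0" for v using 0[of "x # v"] by auto
    moreover have "h (x # z') = 0" if "x \<in> Q1" using h[of "x # z'"] that Q by auto
    ultimately show ?thesis using Cons by (simp add: tens_def)
  qed (simp add: tens_Nil)
  then have "Phi B l (tens Q1 g h) = const (g []) * Phi B l h"
    using Phi_scale[of B l "g []" h] Phi_cong[of B l "tens Q1 g h" "\<lambda>z. g [] * h z"] by simp
  then show ?case
    using Phi_subset[of Q2 h l] Q h by auto
next
  case (Suc i)
  have 0: "g [] = 0" using Suc.prems[of "[]"] by auto
  have "Phi B (Suc i + l) (tens Q1 g h) = (\<Sum>b\<in>B. gen b * Phi B (i + l) (\<lambda>z. tens Q1 g h (b # z)))"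
    by simp
  also have "\<dots> = (\<Sum>b\<in>Q1. gen b * Phi B (i + l) (\<lambda>z. tens Q1 g h (b # z)))"
    using Q(1) finite_basis by (intro sum.mono_neutral_right) (auto simp: tens_Cons 0)
  also have "\<dots> = (\<Sum>b\<in>Q1. gen b * (Phi Q1 i (\<lambda>z. g (b # z)) * Phi Q2 l h))"
  proof (rule sum.cong[OF refl])
    fix b assume "b \<in> Q1"
    then have "(\<lambda>z. tens Q1 g h (b # z)) = tens Q1 (\<lambda>z. g (b # z)) h"
      by (simp add: tens_Cons fun_eq_iff)
    moreover have "Phi B (i + l) (tens Q1 (\<lambda>z. g (b # z)) h) =
        Phi Q1 i (\<lambda>z. g (b # z)) * Phi Q2 l h"
      using Suc.prems[of "b # _"] by (intro Suc.IH) auto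
    ultimately show "gen b * Phi B (i + l) (\<lambda>z. tens Q1 g h (b # z)) =
        gen b * (Phi Q1 i (\<lambda>z. g (b # z)) * Phi Q2 l h)" by simp
  qed
  finally show ?case by (simp add: sum_distrib_right mult.assoc)
qed

text \<open>The elements represented in \<open>U\<close> by a tensor of bounded degree in S(Q1)
  \<otimes> S(Q2) whose support satisfies \<open>P\<close>. Below, \<open>P\<close> says that the
  first or the last letter belongs to k.\<close>

definition symmetrized :: "'g set \<Rightarrow> 'g set \<Rightarrow> ('g list \<Rightarrow> bool) \<Rightarrow> 'g free_alg set" where
  "symmetrized Q1 Q2 P = {t. \<exists>N f. ord_sym Q1 Q2 f \<and> (\<forall>z. f z \<noteq> 0 \<longrightarrow> length z < N \<and> P z) \<and>
     t \<approx> (\<Sum>n<N. Phi B n f)}"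

lemma sum_Phi_extend:
  assumes "\<And>z. f z \<noteq> 0 \<Longrightarrow> length z < N" "N \<le> M"
  shows "(\<Sum>n<N. Phi B n f) = (\<Sum>n<M. Phi B n f)"
proof (rule sum.mono_neutral_left, goal_cases)
  case 3
  have "Phi B n f = 0" if "N \<le> n" for n
    using assms(1) that by (intro Phi_eq_0) (metis leD)
  then show ?case by simp
qed (use assms in auto)

lemma subspace_symmetrized: "F.subspace (symmetrized Q1 Q2 P)"
proof (rule F.subspaceI)
  show "0 \<in> symmetrized Q1 Q2 P"
    unfolding symmetrized_def by (auto intro!: exI[of _ "\<lambda>_. 0"] exI[of _ 0] ord_sym_0)
next
  fix s t assume "s \<in> symmetrized Q1 Q2 P" "t \<in> symmetrized Q1 Q2 P"
  then obtain N M f g where f: "ord_sym Q1 Q2 f" "\<forall>z. f z \<noteq> 0 \<longrightarrow> length z < N \<and> P z"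
      "s \<approx> (\<Sum>n<N. Phi B n f)"
    and g: "ord_sym Q1 Q2 g" "\<forall>z. g z \<noteq> 0 \<longrightarrow> length z < M \<and> P z" "t \<approx> (\<Sum>n<M. Phi B n g)"
    unfolding symmetrized_def by auto
  have "s + t \<approx> (\<Sum>n<max N M. Phi B n f) + (\<Sum>n<max N M. Phi B n g)"
    using cong_add[OF f(3) g(3)] sum_Phi_extend[of f N "max N M"] sum_Phi_extend[of g M "max N M"]
      f(2) g(2) by simp
  then have "s + t \<approx> (\<Sum>n<max N M. Phi B n (\<lambda>z. f z + g z))"
    by (simp add: Phi_add sum.distrib)
  moreover have "length z < max N M \<and> P z" if "f z + g z \<noteq> 0" for z
    using that f(2) g(2) by (cases "f z = 0") (auto simp: less_max_iff_disj)
  ultimately show "s + t \<in> symmetrized Q1 Q2 P"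
    unfolding symmetrized_def using ord_sym_add[OF f(1) g(1)] by blast
next
  fix k s assume "s \<in> symmetrized Q1 Q2 P"
  then obtain N f where f: "ord_sym Q1 Q2 f" "\<forall>z. f z \<noteq> 0 \<longrightarrow> length z < N \<and> P z"
      "s \<approx> (\<Sum>n<N. Phi B n f)"
    unfolding symmetrized_def by auto
  have "const k * s \<approx> (\<Sum>n<N. Phi B n (\<lambda>z. k * f z))"
    using cong_mult[OF cong_refl[of "const k"] f(3)] by (simp add: Phi_scale sum_distrib_left)
  then show "const k * s \<in> symmetrized Q1 Q2 P"
    unfolding symmetrized_def using f(2)
    by (intro CollectI exI[of _ N] exI[of _ "\<lambda>z. k * f z"] conjI ord_sym_scale[OF f(1)]) auto
qed

lemma J_symmetrized: "J \<subseteq> symmetrized Q1 Q2 P"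
  unfolding symmetrized_def
  by (auto intro!: exI[of _ "\<lambda>_. 0"] exI[of _ 0] ord_sym_0 simp: cong_0_iff)

lemma product_symmetrized:
  assumes Q: "Q1 \<union> Q2 = B" "Q1 \<inter> Q2 = {}" and g: "sym_on Q1 i g" and h: "sym_on Q2 l h"
    and P: "\<And>u v. set u \<subseteq> Q1 \<Longrightarrow> set v \<subseteq> Q2 \<Longrightarrow> length u = i \<Longrightarrow> length v = l \<Longrightarrow> P (u @ v)"
  shows "Phi Q1 i g * Phi Q2 l h \<in> symmetrized Q1 Q2 P"
proof -
  have supp: "length z = i + l \<and> P z" if "tens Q1 g h z \<noteq> 0" for z
  proof -
    let ?u = "takeWhile (\<lambda>x. x \<in> Q1) z" and ?v = "dropWhile (\<lambda>x. x \<in> Q1) z"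
    have "g ?u \<noteq> 0" "h ?v \<noteq> 0" using that by (auto simp: tens_def)
    then have uv: "set ?u \<subseteq> Q1" "length ?u = i" "set ?v \<subseteq> Q2" "length ?v = l"
      using sym_on_support g h by blast+
    then show ?thesis
      using P[OF uv(1,3,2,4)] by (metis length_append takeWhile_dropWhile_id)
  qed
  \<comment> \<open>The product tensor lives in the single degree \<open>i + l\<close>, so summing
    over all lower degrees as well changes nothing.\<close>
  have "Phi B n (tens Q1 g h) = 0" if "n < i + l" for n
    using supp that by (intro Phi_eq_0) (metis less_irrefl)
  then have "(\<Sum>n<Suc (i + l). Phi B n (tens Q1 g h)) = Phi Q1 i g * Phi Q2 l h"
    using Phi_tens[OF Q, of g i h l] sym_on_support[OF g] sym_on_support[OF h] by simp
  then have "Phi Q1 i g * Phi Q2 l h \<approx> (\<Sum>n<Suc (i + l). Phi B n (tens Q1 g h))"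
    by (metis cong_refl)
  moreover have "\<forall>z. tens Q1 g h z \<noteq> 0 \<longrightarrow> length z < Suc (i + l) \<and> P z"
    using supp by (metis lessI)
  ultimately show ?thesis
    unfolding symmetrized_def mem_Collect_eq using tens_ord_sym[OF g h Q(2)] by blast
qed

section \<open>The two inclusions, in the free algebra modulo \<open>J\<close>\<close>

lemma subspace_mult_vimage:
  assumes "F.subspace V"
  shows "F.subspace {s. r * s \<in> V}" "F.subspace {s. s * r \<in> V}"
  by (rule F.subspaceI; simp add: distrib_left distrib_right const_left_commute mult.assoc
      F.subspace_0[OF assms] F.subspace_add[OF assms] F.subspace_scale[OF assms])+

text \<open>With k-letters written first, left multiples of k lie in the symmetrization of tensors
  supported on words that begin in k. So the coordinates of \<open>t\<close> vanish on the empty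
  word and on words beginning in p, which is the form required by
  \<open>right_multiple_of_left_multiple\<close>.\<close>

theorem invariant_left_to_right:
  assumes t: "t \<approx> (\<Sum>j\<in>Bk. gen j * T j)" and inv: "\<And>x. x \<in> Bk \<Longrightarrow> ad x t \<in> J"
  shows "\<exists>T. t \<approx> (\<Sum>j\<in>Bk. T j * gen j)"
proof -
  define V where "V = symmetrized Bk Bp (\<lambda>z. z \<noteq> [] \<and> hd z \<in> Bk)"
  have V: "F.subspace V" "J \<subseteq> V"
    unfolding V_def by (rule subspace_symmetrized J_symmetrized)+
  have prod: "Phi Bk n g * Phi Bp l h \<in> V" if "1 \<le> n" "sym_on Bk n g" "sym_on Bp l h" for n l g h
    unfolding V_def using that(1) disjoint_basis
    by (intro product_symmetrized that) (auto simp: Suc_le_length_iff)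
  have "gen j * s \<in> V" if j: "j \<in> Bk" for j s
  proof -
    have "gen j * (Phi Bk i g * Phi Bp l h) \<in> V" if g: "sym_on Bk i g" and h: "sym_on Bp l h"
        for i g l h
    proof -
      \<comment> \<open>With the p-factor fixed, \<open>gen j\<close> times the k-factor is a
        combination of nonempty k-words. These are symmetrized again inside k in positive degree, so
        a leading k-letter survives.\<close>
      let ?W = "{s. s * Phi Bp l h \<in> V}"
      have W: "F.subspace ?W" "J \<subseteq> ?W"
        using V J_mult_right subspace_mult_vimage[OF V(1)] by auto
      have "gen j * Phi Bk i g \<in> Sp {w. set w \<subseteq> Bk \<and> w \<noteq> []}"
        using j by (intro Sp_gen_mult[OF _ Phi_in_Sp]) auto
      then have "gen j * Phi Bk i g \<in> ?W"
      proof (rule Sp_induct[OF _ W])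
        fix w assume "w \<in> {w. set w \<subseteq> Bk \<and> w \<noteq> []}"
        then show "wprod w \<in> ?W"
          using k_words_span[OF W] prod h by blast
      qed
      then show ?thesis by (simp add: mult.assoc)
    qed
    then have "s \<in> {s. gen j * s \<in> V}"
      using V(2) J_mult_left
      by - (rule symmetrized_products_span[OF refl subspace_mult_vimage(1)[OF V(1)]], blast+)
    then show ?thesis by simp
  qed
  then have "(\<Sum>j\<in>Bk. gen j * T j) \<in> V"
    by (intro F.subspace_sum[OF V(1)]) auto
  then have "t \<in> V"
    using t F.subspace_add[OF V(1), of "t - (\<Sum>j\<in>Bk. gen j * T j)" "\<Sum>j\<in>Bk. gen j * T j"] V(2)
    by (simp add: cong_def subset_iff)
  then obtain N f where f: "ord_sym Bk Bp f" "\<forall>z. f z \<noteq> 0 \<longrightarrow> length z < N \<and> z \<noteq> [] \<and> hd z \<in> Bk"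
    "t \<approx> (\<Sum>n<N. Phi B n f)"
    unfolding V_def symmetrized_def by auto
  have "act x f z = 0" if "x \<in> Bk" "set z \<subseteq> B" "length z < N" for x z
  proof (rule invariant_act_eq_0[OF f(1) _ that(1) _ that(2,3)])
    show "ad x (\<Sum>n<N. Phi B n f) \<in> J"
      using inv[OF that(1)] ad_cong[OF f(3), of x] by (metis cong_0_iff cong_sym cong_trans)
  qed simp
  moreover have "f (b # z) = 0" if "b \<in> Bp" for b z
    using f(2)[rule_format, of "b # z"] that disjoint_basis by auto
  ultimately obtain T where "(\<Sum>n<N. Phi B n f) \<approx> (\<Sum>j\<in>Bk. T j * gen j)"
    using right_multiple_of_left_multiple[of N f] f(2) by blast
  then show ?thesis using cong_trans[OF f(3)] by blast
qed

text \<open>Here p-letters are written first, so that right multiples of k have coordinates on words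
  that end in k.\<close>

theorem invariant_right_to_left:
  assumes t: "t \<approx> (\<Sum>j\<in>Bk. T j * gen j)" and inv: "\<And>x. x \<in> Bk \<Longrightarrow> ad x t \<in> J"
  shows "\<exists>T. t \<approx> (\<Sum>j\<in>Bk. gen j * T j)"
proof -
  define V where "V = symmetrized Bp Bk (\<lambda>z. z \<noteq> [] \<and> last z \<in> Bk)"
  have V: "F.subspace V" "J \<subseteq> V"
    unfolding V_def by (rule subspace_symmetrized J_symmetrized)+
  have prod: "Phi Bp l h * Phi Bk n g \<in> V" if "1 \<le> n" "sym_on Bk n g" "sym_on Bp l h" for n l g h
  proof -
    have "u @ v \<noteq> [] \<and> last (u @ v) \<in> Bk" if "set v \<subseteq> Bk" "length v = n" for u v
      using that \<open>1 \<le> n\<close> last_in_set[of v] by (cases "v = []") auto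
    then show ?thesis
      unfolding V_def using disjoint_basis
      by (intro product_symmetrized[OF Un_commute _ that(3,2)]) blast+
  qed
  have "s * gen j \<in> V" if j: "j \<in> Bk" for j s
  proof -
    have "Phi Bp l h * Phi Bk i g * gen j \<in> V" if g: "sym_on Bk i g" and h: "sym_on Bp l h"
        for i g l h
    proof -
      let ?W = "{s. Phi Bp l h * s \<in> V}"
      have W: "F.subspace ?W" "J \<subseteq> ?W"
        using V J_mult_left subspace_mult_vimage[OF V(1)] by auto
      have "Phi Bk i g * wprod [j] \<in> Sp {w. set w \<subseteq> Bk \<and> w \<noteq> []}"
        using j by (intro Sp_mult_right[OF _ Phi_in_Sp]) auto
      then have "Phi Bk i g * wprod [j] \<in> ?W"
      proof (rule Sp_induct[OF _ W])
        fix w assume "w \<in> {w. set w \<subseteq> Bk \<and> w \<noteq> []}"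
        then show "wprod w \<in> ?W"
          using k_words_span[OF W] prod h by blast
      qed
      then show ?thesis by (simp add: mult.assoc wprod_single)
    qed
    then have "s \<in> {s. s * gen j \<in> V}"
      using V(2) J_mult_right
      by - (rule symmetrized_products_span[OF Un_commute subspace_mult_vimage(2)[OF V(1)]], blast+)
    then show ?thesis by simp
  qed
  then have "(\<Sum>j\<in>Bk. T j * gen j) \<in> V"
    by (intro F.subspace_sum[OF V(1)]) auto
  then have "t \<in> V"
    using t F.subspace_add[OF V(1), of "t - (\<Sum>j\<in>Bk. T j * gen j)" "\<Sum>j\<in>Bk. T j * gen j"] V(2)
    by (simp add: cong_def subset_iff)
  then obtain N f where f: "ord_sym Bp Bk f" "\<forall>z. f z \<noteq> 0 \<longrightarrow> length z < N \<and> z \<noteq> [] \<and> last z \<in> Bk"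
    "t \<approx> (\<Sum>n<N. Phi B n f)"
    unfolding V_def symmetrized_def by auto
  have "act x f z = 0" if "x \<in> Bk" "set z \<subseteq> B" "length z < N" for x z
  proof (rule invariant_act_eq_0[OF f(1) _ that(1) _ that(2,3)])
    show "ad x (\<Sum>n<N. Phi B n f) \<in> J"
      using inv[OF that(1)] ad_cong[OF f(3), of x] by (metis cong_0_iff cong_sym cong_trans)
  qed simp
  moreover have "f (z @ [b]) = 0" if "b \<in> Bp" for b z
    using f(2)[rule_format, of "z @ [b]"] that disjoint_basis by auto
  ultimately obtain T where "(\<Sum>n<N. Phi B n f) \<approx> (\<Sum>j\<in>Bk. gen j * T j)"
    using left_multiple_of_right_multiple[of N f] f(2) by blast
  then show ?thesis using cong_trans[OF f(3)] by blast
qed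

end

section \<open>A basis adapted to the involution\<close>

context vector_space
begin

lemma independent_Un:
  assumes "finite A" "finite B" "independent A" "independent B" "span A \<inter> span B \<subseteq> {0}"
  shows "independent (A \<union> B)"
proof (rule independent_if_scalars_zero)
  have "0 \<notin> A" using assms(3) dependent_zero by blast
  then have disj: "A \<inter> B = {}" using assms(5) span_superset[of A] span_superset[of B] by blast
  fix f x assume sum: "(\<Sum>x\<in>A \<union> B. f x *s x) = 0" and x: "x \<in> A \<union> B"
  let ?a = "\<Sum>x\<in>A. f x *s x" and ?b = "\<Sum>x\<in>B. f x *s x"
  have ab: "?a + ?b = 0" using sum assms(1,2) disj by (simp add: sum.union_disjoint)
  have "?a \<in> span A" "?b \<in> span B" by (auto intro: span_sum span_scale span_base)
  moreover have "?a = - ?b" using ab by (simp add: eq_neg_iff_add_eq_0)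
  ultimately have "?a \<in> span A \<inter> span B" using span_neg by auto
  then have "?a = 0" "?b = 0" using assms(5) ab by auto
  then show "f x = 0"
    using x independentD[OF assms(3,1) subset_refl] independentD[OF assms(4,2) subset_refl] by blast
qed (use assms in auto)

text \<open>Needed because \<open>supertrace_on\<close> uses an unspecified basis. Expanding
  \<open>a\<close> in \<open>B\<close> and \<open>T b\<close> in \<open>A\<close> turns both traces
  into the same double sum, as in tr(PQ) = tr(QP).\<close>

lemma trace_basis_independent:
  assumes A: "finite A" "independent A" and B: "finite B" "independent B" and span: "span A =
      span B"
    and T: "Vector_Spaces.linear scale scale T" "\<And>x. x \<in> span A \<Longrightarrow> T x \<in> span A"
  shows "(\<Sum>a\<in>A. representation A (T a) a) = (\<Sum>b\<in>B. representation B (T b) b)"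
proof -
  interpret T: Vector_Spaces.linear scale scale T by fact
  let ?P = "representation B"
  have TB: "T b \<in> span A" if "b \<in> B" for b
    using T(2) span_base[OF that] span by auto
  have "representation A (T a) a = (\<Sum>b\<in>B. ?P a b * representation A (T b) a)" if "a \<in> A" for a
  proof -
    have "(\<Sum>b\<in>B. ?P a b *s b) = a"
      using span_base[OF that] span B by (intro sum_representation_eq) auto
    then have "representation A (T a) = representation A (\<Sum>b\<in>B. ?P a b *s T b)"
      by (metis (no_types, lifting) T.scale T.sum sum.cong)
    also have "\<dots> = (\<lambda>x. \<Sum>b\<in>B. ?P a b * representation A (T b) x)"
      using TB by (simp add: representation_sum[OF A(2)] representation_scale[OF A(2)] span_scale)
    finally show ?thesis by simp
  qed
  then have "(\<Sum>a\<in>A. representation A (T a) a) = (\<Sum>a\<in>A. \<Sum>b\<in>B. ?P a b * representation A (T b) a)"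
    by simp
  also have "\<dots> = (\<Sum>b\<in>B. \<Sum>a\<in>A. representation A (T b) a * ?P a b)"
    by (subst sum.swap) (simp add: mult.commute)
  also have "\<dots> = (\<Sum>b\<in>B. ?P (T b) b)"
  proof (rule sum.cong[OF refl])
    fix b assume b: "b \<in> B"
    have "?P (T b) = ?P (\<Sum>a\<in>A. representation A (T b) a *s a)"
      using sum_representation_eq[OF A(2) TB[OF b] A(1) subset_refl] by simp
    also have "\<dots> = (\<lambda>x. \<Sum>a\<in>A. representation A (T b) a * ?P a x)"
      using span_base[of _ A] span
      by (simp add: representation_sum[OF B(2)] representation_scale[OF B(2)] span_scale)
    finally show "(\<Sum>a\<in>A. representation A (T b) a * ?P a b) = ?P (T b) b" by simp
  qed
  finally show ?thesis .
qed

end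

context supersymmetric_pair
begin


section \<open>Eigenspaces of the involution, their homogeneous sectors and the kernel of the map to
  \<open>U\<close>\<close>

lemma theta_linear: "Vector_Spaces.linear scale scale \<theta>"
  and theta_part: "x \<in> part i \<Longrightarrow> \<theta> x \<in> part i"
  and theta_br: "\<theta> (br x y) = br (\<theta> x) (\<theta> y)"
  and theta_theta [simp]: "\<theta> (\<theta> x) = x"
  using involution unfolding superalgebra_involution_def by auto

sublocale theta: Vector_Spaces.linear scale scale \<theta>
  by (rule theta_linear)

definition eig :: "bool \<Rightarrow> 'g set" where
  "eig s = {x. \<theta> x = (if s then x else - x)}"

definition sector :: "bool \<Rightarrow> bit \<Rightarrow> 'g set" where
  "sector s i = eig s \<inter> part i"

lemma eig_True: "eig True = fixed_subalgebra \<theta>"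
  by (simp add: eig_def fixed_subalgebra_def)

lemma subspace_eig: "subspace (eig s)"
  unfolding eig_def by (rule subspaceI) (auto simp: theta.zero theta.add theta.scale)

lemma subspace_sector: "subspace (sector s i)"
  unfolding sector_def by (intro subspace_inter subspace_eig subspace_part)

lemma eig_inter: "eig True \<inter> eig False = {0}"
proof -
  have "x = 0" if "x = - x" for x :: 'g
  proof -
    have "scale 2 x = x + x" using scale_left_distrib[of 1 1 x] by simp
    also have "\<dots> = 0" using that by (metis add.right_inverse)
    finally show ?thesis by simp
  qed
  then show ?thesis by (auto simp: eig_def theta.zero)
qed

text \<open>Booleans encode the eigenvalues 1 and -1, so \<open>s = t\<close> is the product of two
  signs.\<close>

lemma br_eig: "x \<in> eig s \<Longrightarrow> y \<in> eig t \<Longrightarrow> br x y \<in> eig (s = t)"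
  using br_scale_left[of "- 1"] br_scale_right[of _ "- 1"] by (auto simp: eig_def theta_br)

lemma component_theta: "component part i (\<theta> x) = \<theta> (component part i x)"
  by (rule component_eqI[of _ _ "\<theta> (component part (i + 1) x)"])
    (use component_decomp[of i x] in \<open>auto intro: theta_part simp flip: theta.add\<close>)

lemma component_eig: "x \<in> eig s \<Longrightarrow> component part i x \<in> eig s"
  using component_theta[of i x] component_scale[of i "- 1" x] by (auto simp: eig_def)

definition kernel :: "'g set" where
  "kernel = {x. gen x \<in> J}"

lemma subspace_kernel: "subspace kernel"
  unfolding kernel_def
proof (rule subspaceI)
  show "0 \<in> {x. gen x \<in> J}" using gen_0 by (simp add: cong_0_iff)
  show "x + y \<in> {x. gen x \<in> J}" if "x \<in> {x. gen x \<in> J}" "y \<in> {x. gen x \<in> J}" for x y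
    using that J_add cong_J_iff[OF gen_add] by simp
  show "scale a x \<in> {x. gen x \<in> J}" if "x \<in> {x. gen x \<in> J}" for a x
    using that J_mult_left cong_J_iff[OF gen_scale] by simp
qed

text \<open>\<theta> induces an endomorphism of \<open>U\<close>, as does the parity automorphism,
  so \<open>kernel\<close> is stable under both. It is therefore the sum of its intersections with
  the four sectors.\<close>

lemma kernel_theta: "x \<in> kernel \<Longrightarrow> \<theta> x \<in> kernel"
  unfolding kernel_def
  using env_hom_J[of \<theta> "gen x"] by (simp add: theta.add theta.scale theta_part theta_br)

lemma kernel_signed: "x \<in> kernel \<Longrightarrow> signed x \<in> kernel"
  unfolding kernel_def using eps_J[of "gen x" 1] by (simp add: eps_def)

lemma kernel_component: "x \<in> kernel \<Longrightarrow> component part i x \<in> kernel"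
proof -
  assume x: "x \<in> kernel"
  have "scale (1/2) (x + scale (koszul 1 i) (signed x)) \<in> kernel"
    by (intro subspace_scale subspace_add subspace_kernel x kernel_signed)
  moreover have "component part 0 x + component part 1 x + scale (koszul 1 i) (signed x) =
      scale 2 (component part i x)"
    using scale_left_distrib[of 1 1] by (cases i) (simp_all add: signed_def)
  ultimately show ?thesis by (simp add: component_sum)
qed

definition proj :: "bool \<Rightarrow> bit \<Rightarrow> 'g \<Rightarrow> 'g" where
  "proj s i x = scale (1/2) (component part i x + scale (if s then 1 else -
      1) (\<theta> (component part i x)))"

lemma proj_sector: "proj s i x \<in> sector s i"
  unfolding sector_def eig_def proj_def
  by (auto simp: theta.scale theta.add add.commute intro!: part_scale part_add part_diff theta_part)
    (simp flip: scale_minus_right)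

lemma proj_kernel: "x \<in> kernel \<Longrightarrow> proj s i x \<in> kernel"
  unfolding proj_def
  by (intro subspace_scale subspace_add subspace_kernel kernel_component kernel_theta)

lemma proj_sum: "proj True i x + proj False i x = component part i x"
  using scale_left_distrib[of "1/2" "1/2" "component part i x"]
  by (simp add: proj_def scale_right_distrib scale_right_diff_distrib)

text \<open>The basis of the sector contains a basis of the part of the sector inside
  \<open>kernel\<close>; its remaining vectors then give a basis of the image of the sector in
  \<open>U\<close>.\<close>

definition sector_basis :: "bool \<Rightarrow> bit \<Rightarrow> 'g set" where
  "sector_basis s i = (SOME E. E \<subseteq> sector s i \<and> independent E \<and> sector s i \<subseteq> span E \<and>
     sector s i \<inter> kernel \<subseteq> span (E \<inter> kernel))"

lemma sector_basis:
  "sector_basis s i \<subseteq> sector s i" "independent (sector_basis s i)"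
  "span (sector_basis s i) = sector s i"
  "sector s i \<inter> kernel \<subseteq> span (sector_basis s i \<inter> kernel)"
proof -
  obtain N where N: "N \<subseteq> sector s i \<inter> kernel" "independent N" "sector s i \<inter> kernel \<subseteq> span N"
    using maximal_independent_subset by metis
  obtain E where E: "N \<subseteq> E" "E \<subseteq> sector s i" "independent E" "sector s i \<subseteq> span E"
    using maximal_independent_subset_extend[of N "sector s i"] N by blast
  have "sector s i \<inter> kernel \<subseteq> span (E \<inter> kernel)"
    using N E span_mono[of N "E \<inter> kernel"] by blast
  then have "\<exists>E. E \<subseteq> sector s i \<and> independent E \<and> sector s i \<subseteq> span E \<and>
     sector s i \<inter> kernel \<subseteq> span (E \<inter> kernel)"
    using E by blast
  from someI_ex[OF this] have *: "sector_basis s i \<subseteq> sector s i" "independent (sector_basis s i)"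
    "sector s i \<subseteq> span (sector_basis s i)"
    "sector s i \<inter> kernel \<subseteq> span (sector_basis s i \<inter> kernel)"
    unfolding sector_basis_def by auto
  then show "sector_basis s i \<subseteq> sector s i" "independent (sector_basis s i)"
    "span (sector_basis s i) = sector s i"
    "sector s i \<inter> kernel \<subseteq> span (sector_basis s i \<inter> kernel)"
    using span_minimal[OF *(1) subspace_sector] by auto
qed

lemma finite_independent: "independent A \<Longrightarrow> finite A"
  using finite_dim independent_span_bound unfolding finite_dim_def by blast

definition eig_basis :: "bool \<Rightarrow> 'g set" where
  "eig_basis s = sector_basis s 0 \<union> sector_basis s 1"

lemma eig_basis: "independent (eig_basis s)" "eig_basis s \<subseteq> eig s" "span (eig_basis s) = eig s"
proof -
  show "independent (eig_basis s)"
    unfolding eig_basis_def using part_disjoint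
    by (intro independent_Un finite_independent sector_basis) (auto simp: sector_basis sector_def)
  show sub: "eig_basis s \<subseteq> eig s"
    using sector_basis(1) by (auto simp: eig_basis_def sector_def)
  have "x \<in> span (eig_basis s)" if "x \<in> eig s" for x
  proof -
    have "component part i x \<in> span (sector_basis s i)" for i
      using component_eig[OF that] by (simp add: sector_basis sector_def)
    then have "component part i x \<in> span (eig_basis s)" for i
      using span_mono[of "sector_basis s i" "eig_basis s"] by (cases i) (auto simp: eig_basis_def)
    then show ?thesis using span_add component_sum by metis
  qed
  then show "span (eig_basis s) = eig s"
    using span_minimal[OF sub subspace_eig] by blast
qed

definition full_basis :: "'g set" where
  "full_basis = eig_basis True \<union> eig_basis False"

lemma independent_full_basis: "independent full_basis"
  unfolding full_basis_def
  by (intro independent_Un finite_independent eig_basis) (simp add: eig_basis eig_inter)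

lemma proj_decomp: "x = proj True 0 x + proj False 0 x + (proj True 1 x + proj False 1 x)"
  by (simp add: proj_sum component_sum)

lemma span_full_basis: "span full_basis = UNIV"
proof -
  have "proj s i x \<in> span full_basis" for s i x
  proof -
    have "proj s i x \<in> span (sector_basis s i)" using proj_sector sector_basis(3) by simp
    moreover have "sector_basis s i \<subseteq> full_basis"
      by (cases s; cases i) (auto simp: full_basis_def eig_basis_def)
    ultimately show ?thesis using span_mono by blast
  qed
  then have "x \<in> span full_basis" for x
    by (subst proj_decomp) (intro span_add)
  then show ?thesis by auto
qed

lemma kernel_span: "kernel \<subseteq> span (full_basis \<inter> kernel)"
proof
  fix x assume x: "x \<in> kernel"
  have "proj s i x \<in> span (full_basis \<inter> kernel)" for s i
  proof -
    have "proj s i x \<in> span (sector_basis s i \<inter> kernel)"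
      using proj_sector proj_kernel[OF x] sector_basis(4) by blast
    moreover have "sector_basis s i \<subseteq> full_basis"
      by (cases s; cases i) (auto simp: full_basis_def eig_basis_def)
    ultimately show ?thesis using span_mono[of "sector_basis s i \<inter> kernel" "full_basis \<inter> kernel"]
      by blast
  qed
  then show "x \<in> span (full_basis \<inter> kernel)"
    by (subst proj_decomp) (intro span_add)
qed

definition Bk :: "'g set" where "Bk = eig_basis True - kernel"

definition Bp :: "'g set" where "Bp = eig_basis False - kernel"

definition par :: "'g \<Rightarrow> bit" where
  "par x = (if x \<in> part 0 then 0 else 1)"

definition coeff :: "'g \<Rightarrow> 'g \<Rightarrow> 'g \<Rightarrow> complex" where
  "coeff a b d = representation full_basis (br a b) d"

lemma basis_diff_kernel: "Bk \<union> Bp = full_basis - kernel"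
  by (auto simp: Bk_def Bp_def full_basis_def)

lemma full_basis_part: "b \<in> full_basis \<Longrightarrow> b \<in> part (par b)"
  using sector_basis(1) by (fastforce simp: full_basis_def eig_basis_def sector_def par_def)

lemma full_basis_par: "b \<in> full_basis \<Longrightarrow> b \<in> part i \<Longrightarrow> par b = i"
proof -
  assume b: "b \<in> full_basis" "b \<in> part i"
  have "b \<noteq> 0" using b(1) independent_full_basis dependent_zero by blast
  then show ?thesis
    using b(2) part_inter[of b 0] by (cases i) (auto simp: par_def)
qed

lemma representation_full_basis:
  assumes "A \<subseteq> full_basis" "x \<in> span A"
  shows "representation full_basis x = representation A x"
  using representation_extend[OF independent_full_basis assms(2,1)] .

lemma gen_expansion:
  "gen x \<approx> (\<Sum>d\<in>Bk \<union> Bp. const (representation full_basis x d) * gen d)"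
proof -
  let ?r = "representation full_basis x"
  have fin: "finite full_basis" using finite_independent[OF independent_full_basis] .
  have "(\<Sum>d\<in>full_basis. scale (?r d) d) = x"
    by (rule sum_representation_eq) (use independent_full_basis span_full_basis fin in auto)
  then have "gen x = gen (\<Sum>d\<in>full_basis. scale (?r d) d)" by simp
  also have "\<dots> \<approx> (\<Sum>d\<in>full_basis. const (?r d) * gen d)"
    by (intro cong_trans[OF gen_sum] cong_sum gen_scale)
  also have "\<dots> = (\<Sum>d\<in>Bk \<union> Bp. const (?r d) * gen d) +
      (\<Sum>d\<in>full_basis \<inter> kernel. const (?r d) * gen d)"
    unfolding basis_diff_kernel using fin sum.Int_Diff[of full_basis _ kernel]
    by (simp add: add.commute)
  also have "\<dots> \<approx> (\<Sum>d\<in>Bk \<union> Bp. const (?r d) * gen d) + 0"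
    by (intro cong_add cong_refl)
      (auto simp: cong_0_iff kernel_def intro!: F.subspace_sum[OF subspace_J] J_mult_left)
  finally show ?thesis by simp
qed

text \<open>The combination of basis vectors lies in \<open>kernel\<close>, so its coordinates are
  supported on basis vectors in \<open>kernel\<close> by \<open>kernel_span\<close>. By construction
  they are supported off \<open>kernel\<close>, hence they vanish.\<close>

lemma independent_mod_J:
  assumes "(\<Sum>b\<in>Bk \<union> Bp. const (a b) * gen b) \<in> J"
  shows "\<forall>b\<in>Bk \<union> Bp. a b = 0"
proof
  fix b assume b: "b \<in> Bk \<union> Bp"
  let ?B = "full_basis - kernel"
  let ?y = "\<Sum>b\<in>?B. scale (a b) b"
  have "gen ?y \<approx> (\<Sum>b\<in>?B. const (a b) * gen b)"
    by (intro cong_trans[OF gen_sum] cong_sum gen_scale)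
  then have "?y \<in> kernel"
    using assms cong_J_iff by (simp add: basis_diff_kernel kernel_def)
  then have "representation full_basis ?y = representation (full_basis \<inter> kernel) ?y"
    using kernel_span by (intro representation_full_basis) auto
  then have "representation full_basis ?y b = 0"
    using b representation_ne_zero[of "full_basis \<inter> kernel" ?y b]
    unfolding basis_diff_kernel by auto
  moreover have "representation full_basis ?y b = a b"
  proof -
    have "representation full_basis ?y = (\<lambda>x. \<Sum>b\<in>?B. a b * representation full_basis b x)"
      using span_full_basis
      by (simp add: representation_sum[OF independent_full_basis] representation_scale[OF
          independent_full_basis])
    then have "representation full_basis ?y b = (\<Sum>b'\<in>?B. a b' * representation full_basis b' b)"
      by simp
    also have "\<dots> = (\<Sum>b'\<in>?B. if b = b' then a b' else 0)"
      by (intro sum.cong refl) (simp add: representation_basis[OF independent_full_basis])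
    also have "\<dots> = a b"
      using b finite_independent[OF independent_full_basis] by (simp add: basis_diff_kernel)
    finally show ?thesis .
  qed
  ultimately show "a b = 0" by simp
qed

lemma coeff_eig:
  assumes "a \<in> eig s" "b \<in> eig t" "d \<in> full_basis" "d \<in> eig (s \<noteq> t)"
  shows "coeff a b d = 0"
proof (rule ccontr)
  assume "coeff a b d \<noteq> 0"
  moreover have "representation full_basis (br a b) = representation (eig_basis (s = t)) (br a b)"
    using br_eig[OF assms(1,2)] eig_basis(3)
    by (intro representation_full_basis) (cases "s = t"; auto simp: full_basis_def)+
  ultimately have "d \<in> eig_basis (s = t)"
    unfolding coeff_def using representation_ne_zero by metis
  then have "d \<in> eig (s = t) \<inter> eig (s \<noteq> t)" using eig_basis(2) assms(4) by blast
  then have "d = 0" using eig_inter by (cases "s = t") auto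
  then show False using assms(3) independent_full_basis dependent_zero by blast
qed

lemma coeff_par:
  assumes "a \<in> part i" "b \<in> part j" "coeff a b d \<noteq> 0"
  shows "d \<in> part (i + j)"
proof -
  let ?E = "sector_basis True (i + j) \<union> sector_basis False (i + j)"
  have E: "?E \<subseteq> full_basis" by (cases "i + j") (auto simp: full_basis_def eig_basis_def)
  have br: "br a b \<in> part (i + j)" using br_part assms by blast
  then have "proj True (i + j) (br a b) + proj False (i + j) (br a b) = br a b"
    by (simp only: proj_sum component_of_part[OF br]) simp
  moreover have "proj s (i + j) (br a b) \<in> span ?E" for s
    using proj_sector[of s "i + j" "br a b"] sector_basis(3)[of s "i + j"]
      span_mono[of "sector_basis s (i + j)" ?E] by (cases s) auto
  ultimately have "br a b \<in> span ?E" using span_add by metis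
  then have "d \<in> ?E"
    using assms(3) representation_full_basis[OF E] representation_ne_zero unfolding coeff_def
    by metis
  then show ?thesis using sector_basis(1) by (auto simp: sector_def)
qed

text \<open>For even \<open>a\<close> the map \<open>br a\<close> preserves both homogeneous parts
  of k, so each diagonal block has a trace of its own that may be computed in any basis.\<close>

lemma supertrace_fixed:
  assumes a: "a \<in> fixed_subalgebra \<theta>" "a \<in> part 0"
  shows "supertrace_on (fixed_subalgebra \<theta>) (br a) =
    (\<Sum>b\<in>sector_basis True 0. coeff a b b) - (\<Sum>b\<in>sector_basis True 1. coeff a b b)"
proof -
  let ?K = "fixed_subalgebra \<theta>"
  define P where "P i = part_basis ?K i" for i
  have P: "independent (P i)" "span (P i) = sector True i" for i
  proof -
    have "\<exists>B. independent B \<and> span B = ?K \<inter> part i"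
      using sector_basis(2,3)[of True i] by (auto simp: sector_def eig_True)
    from someI_ex[OF this] show "independent (P i)" "span (P i) = sector True i"
      unfolding P_def part_basis_def by (auto simp: sector_def eig_True)
  qed
  have T: "br a x \<in> sector True i" if "x \<in> sector True i" for x i
    using that br_eig[of a True x True] br_part[OF a(2), of x i] a(1)
    by (simp add: sector_def eig_True)
  have ind: "independent (P 0 \<union> P 1)"
    using part_disjoint by (intro independent_Un finite_independent P) (auto simp: P sector_def)
  have 1: "representation (P 0 \<union> P 1) (br a b) b = representation (P i) (br a b) b"
    if "b \<in> P i" for b i
  proof -
    have "br a b \<in> span (P i)" using T[of b i] span_base[OF that] P by simp
    moreover have "P i \<subseteq> P 0 \<union> P 1" by (cases i) auto
    ultimately show ?thesis using representation_extend[OF ind] by metis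
  qed
  have 2: "(\<Sum>b\<in>P i. representation (P i) (br a b) b) = (\<Sum>b\<in>sector_basis True i. coeff a b b)" for i
  proof -
    have "(\<Sum>b\<in>P i. representation (P i) (br a b) b) =
        (\<Sum>b\<in>sector_basis True i. representation (sector_basis True i) (br a b) b)"
      by (rule trace_basis_independent)
        (use P sector_basis finite_independent br_linear_right T in auto)
    also have "\<dots> = (\<Sum>b\<in>sector_basis True i. coeff a b b)"
    proof (rule sum.cong[OF refl])
      fix b assume "b \<in> sector_basis True i"
      then have "br a b \<in> span (sector_basis True i)"
        using T[of b i] sector_basis(1,3) by auto
      moreover have "sector_basis True i \<subseteq> full_basis"
        by (cases i) (auto simp: full_basis_def eig_basis_def)
      ultimately show "representation (sector_basis True i) (br a b) b = coeff a b b"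
        unfolding coeff_def using representation_full_basis by metis
    qed
    finally show ?thesis .
  qed
  show ?thesis
    unfolding supertrace_on_def Let_def P_def[symmetric] 2[symmetric] by (simp add: 1)
qed

text \<open>For odd \<open>a\<close> the bracket with \<open>j\<close> has the parity opposite to
  \<open>j\<close>, so every diagonal coefficient is 0. For even \<open>a\<close> the sum is minus
  the supertrace: the basis vectors in \<open>kernel\<close>, which \<open>Bk\<close> leaves out,
  are central and contribute nothing to it.\<close>

lemma coeff_trace:
  assumes str: "\<And>x. x \<in> fixed_subalgebra \<theta> \<Longrightarrow> supertrace_on (fixed_subalgebra \<theta>) (br x) = 0"
    and a: "a \<in> Bk"
  shows "(\<Sum>j\<in>Bk. koszul (par j) (par j) * coeff j a j) = 0"
proof (cases "par a = 1")
  case True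
  have "coeff j a j = 0" if "j \<in> Bk" for j
  proof (rule ccontr)
    assume "coeff j a j \<noteq> 0"
    then have "j \<in> part (par j + par a)"
      using that a coeff_par[OF full_basis_part full_basis_part, of j a j]
      by (simp add: Bk_def full_basis_def)
    then have "par j = par j + par a"
      using that by (intro full_basis_par) (auto simp: Bk_def full_basis_def)
    then show False using True by (cases "par j") auto
  qed
  then show ?thesis by simp
next
  case False
  then have par_a: "par a = 0" by simp
  have a_full: "a \<in> full_basis" and aK: "a \<in> fixed_subalgebra \<theta>"
    using a eig_basis(2)[of True] by (auto simp: Bk_def full_basis_def eig_True)
  have a0: "a \<in> part 0" using full_basis_part[OF a_full] par_a by simp
  have skew: "coeff j a j = - coeff a j j" for j
  proof -
    have *: "br (component part i j) a = - br a (component part i j)" for i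
      using br_skew[OF component_in a0, of i j] by simp
    have "br (component part 0 j + component part 1 j) a = - br a (component part 0 j +
        component part 1 j)"
      unfolding br_add_left br_add_right * by simp
    then have "br j a = - br a j" by (simp add: component_sum)
    then show ?thesis
      using representation_neg[OF independent_full_basis, of "br a j"] span_full_basis
      by (simp add: coeff_def)
  qed
  have kernel: "coeff a j j = 0" if "j \<in> kernel" for j
    using skew[of j] gen_J_central[of j a] that representation_zero
    by (simp add: kernel_def coeff_def)
  have fin: "finite (sector_basis True i)" for i
    using finite_independent sector_basis(2) by blast
  have par: "par j = i" if "j \<in> sector_basis True i" for j i
    using that sector_basis(1) by (cases i)
      (auto intro!: full_basis_par simp: full_basis_def eig_basis_def sector_def subset_iff)
  have "(\<Sum>j\<in>Bk. koszul (par j) (par j) * coeff j a j) = -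
      (\<Sum>j\<in>Bk. koszul (par j) (par j) * coeff a j j)"
    by (simp add: skew sum_negf)
  also have "(\<Sum>j\<in>Bk. koszul (par j) (par j) * coeff a j j) =
      (\<Sum>j\<in>eig_basis True. koszul (par j) (par j) * coeff a j j)"
    using kernel finite_independent[OF eig_basis(1)]
    by (intro sum.mono_neutral_left) (auto simp: Bk_def)
  also have "\<dots> = (\<Sum>j\<in>sector_basis True 0. koszul (par j) (par j) * coeff a j j) +
      (\<Sum>j\<in>sector_basis True 1. koszul (par j) (par j) * coeff a j j)"
    unfolding eig_basis_def using par by (intro sum.union_disjoint fin) (metis disjoint_iff
        zero_neq_one)
  also have "\<dots> = supertrace_on (fixed_subalgebra \<theta>) (br a)"
    unfolding supertrace_fixed[OF aK a0] by (simp add: par sum_negf)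
  finally show ?thesis using str[OF aK] by simp
qed

lemma adapted_basis:
  assumes "\<And>x. x \<in> fixed_subalgebra \<theta> \<Longrightarrow> supertrace_on (fixed_subalgebra \<theta>) (br x) = 0"
  shows "adapted_basis scale part br Bk Bp par coeff"
proof
  have full: "b \<in> full_basis" if "b \<in> Bk \<union> Bp" for b
    using that by (simp add: basis_diff_kernel)
  note part = full_basis_part[OF full]
  have K: "b \<in> eig True" if "b \<in> Bk" for b using that eig_basis(2) by (auto simp: Bk_def)
  have P: "b \<in> eig False" if "b \<in> Bp" for b using that eig_basis(2) by (auto simp: Bp_def)
  show "finite (Bk \<union> Bp)"
    using finite_independent[OF independent_full_basis] by (simp add: basis_diff_kernel)
  show "Bk \<inter> Bp = {}"
  proof -
    have "b = 0" if "b \<in> Bk" "b \<in> Bp" for b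
      using K P that eig_inter by blast
    then show ?thesis using full independent_full_basis dependent_zero by blast
  qed
  show "b \<in> part (par b)" if "b \<in> Bk \<union> Bp" for b
    using part that .
  show "\<forall>b\<in>Bk \<union> Bp. a b = 0" if "(\<Sum>b\<in>Bk \<union> Bp. const (a b) * gen b) \<in> J" for a
    using independent_mod_J[OF that] .
  show "\<exists>a. gen x \<approx> (\<Sum>b\<in>Bk \<union> Bp. const (a b) * gen b)" for x
    using gen_expansion by blast
  show "gen a * gen b \<approx> const (koszul (par a) (par b)) * (gen b * gen a) +
      (\<Sum>d\<in>Bk \<union> Bp. const (coeff a b d) * gen d)"
    if "a \<in> Bk \<union> Bp" "b \<in> Bk \<union> Bp" for a b
    using cong_trans[OF gen_br[OF part[OF that(1)] part[OF that(2)]]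
        cong_add[OF cong_refl gen_expansion]] by (simp add: mult.assoc coeff_def)
  show "par d = par a + par b"
    if "a \<in> Bk \<union> Bp" "b \<in> Bk \<union> Bp" "d \<in> Bk \<union> Bp" "coeff a b d \<noteq> 0" for a b d
    using full_basis_par[OF full[OF that(3)] coeff_par[OF part[OF that(1)] part[OF that(2)]
        that(4)]] .
  show "coeff a b d = 0" if "a \<in> Bk" "b \<in> Bk" "d \<in> Bp" for a b d
    using that by (intro coeff_eig[of a True b True] K full) (auto intro: P)
  show "coeff a b d = 0" if "a \<in> Bk" "b \<in> Bp" "d \<in> Bk" for a b d
    using that by (intro coeff_eig[of a True b False] K P full) (auto intro: K)
  show "(\<Sum>j\<in>Bk. koszul (par j) (par j) * coeff j a j) = 0" if "a \<in> Bk" for a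
    using coeff_trace[OF assms that] .
qed

end

section \<open>The enveloping algebra as a quotient\<close>

context lie_superalgebra
begin


abbreviation U :: "'g free_alg set ring" where
  "U \<equiv> envelope scale part br"

abbreviation cls :: "'g free_alg \<Rightarrow> 'g free_alg set" where
  "cls \<equiv> env_class scale part br"

lemma cls_ring_hom: "ring_hom_ring free_ring U cls"
  using ideal.rcos_ring_hom_ring[OF ideal_J]
  unfolding envelope_def env_class_def[abs_def] .

lemma ring_U: "ring U"
  using cls_ring_hom unfolding ring_hom_ring_def by blast

lemma cls_closed [simp]: "cls t \<in> carrier U"
  using ring_hom_ring.homh[OF cls_ring_hom] ring_hom_closed[of cls free_ring U t] by simp

lemma cls_add: "cls s \<oplus>\<^bsub>U\<^esub> cls t = cls (s + t)"
  and cls_mult: "cls s \<otimes>\<^bsub>U\<^esub> cls t = cls (s * t)"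
  using ring_hom_ring.homh[OF cls_ring_hom] ring_hom_add[of cls free_ring U s t]
    ring_hom_mult[of cls free_ring U s t] by simp_all

lemma cls_zero: "\<zero>\<^bsub>U\<^esub> = cls 0"
  using ring_hom_zero[OF ring_hom_ring.homh[OF cls_ring_hom] ring_free_ring ring_U] by simp

lemma cls_minus: "cls s \<ominus>\<^bsub>U\<^esub> cls t = cls (s - t)"
proof -
  interpret U: ring U by (rule ring_U)
  have "cls (s - t) \<oplus>\<^bsub>U\<^esub> cls t = cls s" by (simp add: cls_add)
  then show ?thesis
    by (metis U.add.inv_solve_right a_minus_def cls_closed)
qed

lemma cls_eq_iff: "cls s = cls t \<longleftrightarrow> s \<approx> t"
  using ring.quotient_eq_iff_same_a_r_cos[OF ring_free_ring ideal_J, of s t]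
  by (simp add: cong_def env_class_def)

lemma carrier_U: "carrier U = range cls"
  unfolding envelope_def FactRing_def A_RCOSETS_def' env_class_def[abs_def] by auto

section \<open>The parity decomposition of the enveloping algebra and the adjoint action in terms of
  representatives\<close>

definition pure :: "bit \<Rightarrow> 'g free_alg \<Rightarrow> bool" where
  "pure i t \<longleftrightarrow> (\<forall>w\<in>Poly_Mapping.keys t. word_parity part i (letter_list w))"

lemma env_part_eq: "env_part scale part br i = cls ` {t. pure i t}"
  by (simp add: env_part_def pure_def)

lemma eps_word: "word_parity part i w \<Longrightarrow> eps l (wprod w) \<approx> const (koszul l i) * wprod w"
proof (induction w arbitrary: i)
  case (Cons x w)
  then obtain j where j: "x \<in> part j" "word_parity part (i - j) w" by auto
  have "eps l (wprod (x # w)) = eps l (gen x) * eps l (wprod w)"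
    by (simp add: wprod_Cons eps_mult)
  also have "\<dots> \<approx> (const (koszul l j) * gen x) * (const (koszul l (i - j)) * wprod w)"
    by (intro cong_mult eps_gen Cons.IH j)
  also have "\<dots> = const (koszul l (j + (i - j))) * wprod (x # w)"
    by (simp only: koszul_add_right const_mult wprod_Cons mult.assoc const_left_commute[of "gen x"])
  finally show ?case by (cases i; cases j) simp_all
qed simp

lemma eps_scale: "eps l (const a * t) = const a * eps l t"
  by (simp add: eps_mult)

lemma eps_pure:
  assumes "pure i t"
  shows "eps l t \<approx> const (koszul l i) * t"
proof -
  let ?e = "\<lambda>w. const (Poly_Mapping.lookup t w) * wprod (letter_list w)"
  have "eps l (\<Sum>w\<in>Poly_Mapping.keys t. ?e w) \<approx> (\<Sum>w\<in>Poly_Mapping.keys t. const (koszul l i) * ?e w)"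
    unfolding eps_sum
  proof (rule cong_sum)
    fix w assume "w \<in> Poly_Mapping.keys t"
    then have "eps l (wprod (letter_list w)) \<approx> const (koszul l i) * wprod (letter_list w)"
      using assms by (intro eps_word) (auto simp: pure_def)
    from cong_mult[OF cong_refl this]
    show "eps l (?e w) \<approx> const (koszul l i) * ?e w"
      by (metis eps_scale const_left_commute)
  qed
  then show ?thesis
    by (simp only: sum_distrib_left[symmetric] wprod_expansion[of t, symmetric])
qed

lemma pure_0: "pure i 0"
  and pure_1: "pure 0 1"
  by (simp_all add: pure_def zero_letters_def)

lemma pure_add: "pure i s \<Longrightarrow> pure i t \<Longrightarrow> pure i (s + t)"
  using Poly_Mapping.keys_add[of s t] by (auto simp: pure_def)

lemma pure_scale: "pure i t \<Longrightarrow> pure i (const a * t)"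
  by (auto simp: pure_def in_keys_iff lookup_const_mult)

lemma pure_gen_mult: "x \<in> part j \<Longrightarrow> pure i t \<Longrightarrow> pure (j + i) (gen x * t)"
  unfolding pure_def
proof
  fix w assume x: "x \<in> part j" and t: "\<forall>w\<in>Poly_Mapping.keys t. word_parity part i (letter_list w)"
    and "w \<in> Poly_Mapping.keys (gen x * t)"
  then obtain v where v: "v \<in> Poly_Mapping.keys t" "w = Letters [x] + v"
    using keys_mult[of "gen x" t] by (auto simp: gen_def)
  have "j + i - j = i" by (cases i; cases j) simp_all
  then show "word_parity part (j + i) (letter_list w)"
    using v t x by (auto simp: plus_letters_def)
qed

lemma pure_decomposition: "\<exists>s t'. pure 0 s \<and> pure 1 t' \<and> t \<approx> s + t'"
proof (induction t rule: F_induct)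
  case zero
  show ?case using pure_0 by (intro exI[of _ 0]) simp
next
  case (add s t)
  then obtain s0 s1 t0 t1 where *: "pure 0 s0" "pure 1 s1" "s \<approx> s0 + s1" "pure 0 t0" "pure 1 t1"
      "t \<approx> t0 + t1"
    by blast
  then have "s + t \<approx> (s0 + t0) + (s1 + t1)"
    using cong_add[OF *(3,6)] by (simp add: algebra_simps)
  then show ?case using * pure_add by blast
next
  case (scale a t)
  then obtain t0 t1 where *: "pure 0 t0" "pure 1 t1" "t \<approx> t0 + t1" by blast
  then have "const a * t \<approx> const a * t0 + const a * t1"
    using cong_mult[OF cong_refl *(3), of "const a"] by (simp add: distrib_left)
  then show ?case using * pure_scale by blast
next
  case (word w)
  show ?case
  proof (induction w)
    case Nil
    show ?case using pure_0 pure_1 by (intro exI[of _ 1] exI[of _ 0]) simp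
  next
    case (Cons x w)
    then obtain t0 t1 where *: "pure 0 t0" "pure 1 t1" "wprod w \<approx> t0 + t1" by blast
    let ?x = "\<lambda>i. gen (component part i x)"
    have "gen x \<approx> ?x 0 + ?x 1"
      using gen_add[of "component part 0 x" "component part 1 x"] by (simp add: component_sum)
    from cong_mult[OF this *(3)]
    have "wprod (x # w) \<approx> (?x 0 * t0 + ?x 1 * t1) + (?x 0 * t1 + ?x 1 * t0)"
      by (simp add: wprod_Cons algebra_simps)
    moreover have "pure 0 (?x 0 * t0 + ?x 1 * t1)"
      using pure_gen_mult[of _ 0 0 t0] pure_gen_mult[of _ 1 1 t1] * by (intro pure_add) auto
    moreover have "pure 1 (?x 0 * t1 + ?x 1 * t0)"
      using pure_gen_mult[of _ 0 1 t1] pure_gen_mult[of _ 1 0 t0] * by (intro pure_add) auto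
    ultimately show ?case by blast
  qed
qed

text \<open>Half the sum of the identity and the signed parity automorphism is the projection to the
  part of parity \<open>i\<close>; this supplies a formula for \<open>env_component\<close>, which
  is a definite description.\<close>

definition parity_part :: "bit \<Rightarrow> 'g free_alg \<Rightarrow> 'g free_alg" where
  "parity_part i t = const (1/2) * (t + const (koszul 1 i) * eps 1 t)"

lemma const_half: "const (1/2) * t + const (1/2) * t = t"
  using F.scale_left_distrib[of "1/2" "1/2" t] by simp

lemma parity_part_pure:
  assumes "pure i s" "pure (i + 1) t" "r \<approx> s + t"
  shows "parity_part i r \<approx> s"
proof -
  have "eps 1 r \<approx> const (koszul 1 i) * s + const (koszul 1 (i + 1)) * t"
    using cong_trans[OF eps_cong[OF assms(3)], of 1] cong_add[OF eps_pure[OF assms(1), of 1]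
        eps_pure[OF assms(2), of 1]]
    by (simp add: eps_add)
  then have "parity_part i r \<approx> const (1/2) * ((s + t) + const (koszul 1 i) *
      (const (koszul 1 i) * s + const (koszul 1 (i + 1)) * t))"
    unfolding parity_part_def by (intro cong_mult cong_add assms) auto
  also have "\<dots> = s"
    using const_half[of s] by (cases i) (simp_all add: algebra_simps const_uminus)
  finally show ?thesis .
qed

text \<open>By \<open>parity_part_pure\<close> the summand of parity \<open>i\<close> is recovered
  from any homogeneous decomposition, which gives uniqueness; existence is
  \<open>pure_decomposition\<close>.\<close>

lemma env_component_cls: "env_component scale part br i (cls r) = cls (parity_part i r)"
  unfolding env_component_def
proof (rule the_equality)
  obtain s t where st: "pure i s" "pure (i + 1) t" "r \<approx> s + t"
  proof (cases i)
    case zero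
    then show ?thesis using pure_decomposition[of r] that by auto
  next
    case one
    then show ?thesis using pure_decomposition[of r] that by (metis add.commute bit_add_self)
  qed
  have "cls (parity_part i r) = cls s"
    using parity_part_pure[OF st] by (simp add: cls_eq_iff)
  moreover have "cls r = cls s \<oplus>\<^bsub>U\<^esub> cls t"
    using st(3) by (simp add: cls_add cls_eq_iff)
  ultimately show "cls (parity_part i r) \<in> env_part scale part br i \<and>
      (\<exists>w\<in>env_part scale part br (i + 1). cls r = cls (parity_part i r) \<oplus>\<^bsub>U\<^esub> w)"
    using st(1,2) by (auto simp: env_part_eq)
next
  fix v assume "v \<in> env_part scale part br i \<and>
      (\<exists>w\<in>env_part scale part br (i + 1). cls r = v \<oplus>\<^bsub>U\<^esub> w)"
  then obtain s t where st: "pure i s" "pure (i + 1) t" "v = cls s" "cls r = cls s \<oplus>\<^bsub>U\<^esub> cls t"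
    by (auto simp: env_part_eq)
  then show "v = cls (parity_part i r)"
    using cong_sym[OF parity_part_pure[OF st(1,2)]] by (simp add: cls_add cls_eq_iff)
qed

lemma parity_part_sum: "parity_part 0 t + parity_part 1 t = t"
  and parity_part_diff: "parity_part 0 t - parity_part 1 t = eps 1 t"
  using const_half[of t] const_half[of "eps 1 t"]
  by (simp_all add: parity_part_def algebra_simps const_uminus)

text \<open>Summation over the parities of the second argument turns the Koszul signs into
  \<open>eps\<close>: the sum of the two parity parts is \<open>t\<close>, their difference is
  \<open>eps 1 t\<close>.\<close>

lemma env_ad_cls:
  "env_ad scale part br x (cls t) =
     cls (\<Sum>i\<in>{0, 1}. gen (component part i x) * t - eps i t * gen (component part i x))"
proof -
  interpret U: ring U by (rule ring_U)
  let ?x = "\<lambda>i. gen (component part i x)"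
  have inner: "(\<Oplus>\<^bsub>U\<^esub>j\<in>{0, 1}. (cls (?x i) \<otimes>\<^bsub>U\<^esub> cls (parity_part j t)) \<ominus>\<^bsub>U\<^esub>
        (cls (koszul i j) \<otimes>\<^bsub>U\<^esub> (cls (parity_part j t) \<otimes>\<^bsub>U\<^esub> cls (?x i)))) =
      cls (?x i * t - eps i t * ?x i)" (is "?L = _") for i
  proof -
    have "?L = cls (?x i * parity_part 0 t - koszul i 0 * (parity_part 0 t * ?x i) +
        (?x i * parity_part 1 t - koszul i 1 * (parity_part 1 t * ?x i)))"
      by (simp add: cls_mult cls_minus cls_add U.finsum_insert)
    also have "?x i * parity_part 0 t - koszul i 0 * (parity_part 0 t * ?x i) +
        (?x i * parity_part 1 t - koszul i 1 * (parity_part 1 t * ?x i)) =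
        ?x i * (parity_part 0 t + parity_part 1 t) -
          (parity_part 0 t + koszul i 1 * parity_part 1 t) * ?x i"
      by (simp add: algebra_simps)
    also have "parity_part 0 t + koszul i 1 * parity_part 1 t = eps i t"
      by (cases i) (simp_all add: parity_part_sum parity_part_diff)
    finally show ?thesis by (simp add: parity_part_sum)
  qed
  show ?thesis
    unfolding env_ad_def Let_def env_map_def env_component_cls inner
    by (simp add: cls_add U.finsum_insert)
qed

end

context supersymmetric_pair
begin

section \<open>The sets kU and Uk in terms of the basis letters, and the conclusion\<close>

lemma gen_fixed_expansion:
  assumes "x \<in> fixed_subalgebra \<theta>"
  shows "\<exists>a. gen x \<approx> (\<Sum>j\<in>Bk. const (a j) * gen j)"
proof -
  let ?r = "representation full_basis x"
  have "x \<in> span (eig_basis True)" using assms eig_basis(3) eig_True by simp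
  then have "?r = representation (eig_basis True) x"
    by (intro representation_full_basis) (auto simp: full_basis_def)
  then have "?r d = 0" if "d \<in> Bp - Bk" for d
    using that representation_ne_zero[of "eig_basis True" x d] by (auto simp: Bk_def Bp_def)
  moreover have "finite (Bk \<union> Bp)"
    using finite_independent[OF independent_full_basis] by (simp add: basis_diff_kernel)
  ultimately have "(\<Sum>d\<in>Bk \<union> Bp. const (?r d) * gen d) = (\<Sum>d\<in>Bk. const (?r d) * gen d)"
    by (intro sum.mono_neutral_right) auto
  then show ?thesis using gen_expansion[of x] by auto
qed

lemma right_ideal_cls:
  assumes "u \<in> env_right_ideal scale part br (fixed_subalgebra \<theta>)"
  shows "\<exists>t T. u = cls t \<and> t \<approx> (\<Sum>j\<in>Bk. gen j * T j)"
  using assms unfolding env_right_ideal_def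
proof (induction rule: ideal_prod.induct)
  case (prod v w)
  then obtain x s where x: "x \<in> fixed_subalgebra \<theta>" "v = cls (gen x)" and s: "w = cls s"
    by (auto simp: env_map_def carrier_U)
  obtain a where "gen x \<approx> (\<Sum>j\<in>Bk. const (a j) * gen j)"
    using gen_fixed_expansion[OF x(1)] by blast
  from cong_mult[OF this cong_refl[of s]]
  have "gen x * s \<approx> (\<Sum>j\<in>Bk. gen j * (const (a j) * s))"
    by (simp add: sum_distrib_right mult.assoc const_left_commute)
  then show ?case
    using x s
    by (intro exI[of _ "gen x * s"] exI[of _ "\<lambda>j. const (a j) * s"]) (simp add: cls_mult)
next
  case (sum u v)
  then obtain s t S T where "u = cls s" "v = cls t" "s \<approx> (\<Sum>j\<in>Bk. gen j * S j)" "t \<approx>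
      (\<Sum>j\<in>Bk. gen j * T j)"
    by blast
  moreover from this have "s + t \<approx> (\<Sum>j\<in>Bk. gen j * (S j + T j))"
    using cong_add by (fastforce simp: distrib_left sum.distrib)
  ultimately show ?case by (metis cls_add)
qed

lemma left_ideal_cls:
  assumes "u \<in> env_left_ideal scale part br (fixed_subalgebra \<theta>)"
  shows "\<exists>t T. u = cls t \<and> t \<approx> (\<Sum>j\<in>Bk. T j * gen j)"
  using assms unfolding env_left_ideal_def
proof (induction rule: ideal_prod.induct)
  case (prod w v)
  then obtain x s where x: "x \<in> fixed_subalgebra \<theta>" "v = cls (gen x)" and s: "w = cls s"
    by (auto simp: env_map_def carrier_U)
  obtain a where "gen x \<approx> (\<Sum>j\<in>Bk. const (a j) * gen j)"
    using gen_fixed_expansion[OF x(1)] by blast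
  from cong_mult[OF cong_refl[of s] this]
  have "s * gen x \<approx> (\<Sum>j\<in>Bk. (s * const (a j)) * gen j)"
    by (simp add: sum_distrib_left mult.assoc)
  then show ?case
    using x s
    by (intro exI[of _ "s * gen x"] exI[of _ "\<lambda>j. s * const (a j)"]) (simp add: cls_mult)
next
  case (sum u v)
  then obtain s t S T where "u = cls s" "v = cls t" "s \<approx> (\<Sum>j\<in>Bk. S j * gen j)" "t \<approx>
      (\<Sum>j\<in>Bk. T j * gen j)"
    by blast
  moreover from this have "s + t \<approx> (\<Sum>j\<in>Bk. (S j + T j) * gen j)"
    using cong_add by (fastforce simp: distrib_right sum.distrib)
  ultimately show ?case by (metis cls_add)
qed

lemma Bk_fixed: "b \<in> Bk \<Longrightarrow> b \<in> fixed_subalgebra \<theta>"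
  using eig_basis(2)[of True] by (auto simp: Bk_def eig_True)

lemma zero_fixed: "0 \<in> fixed_subalgebra \<theta>"
  by (simp add: fixed_subalgebra_def theta.zero)

lemma cls_in_right_ideal: "cls (\<Sum>j\<in>Bk. gen j * T j) \<in>
    env_right_ideal scale part br (fixed_subalgebra \<theta>)"
proof -
  have "cls (\<Sum>j\<in>A. gen j * T j) \<in> env_right_ideal scale part br (fixed_subalgebra \<theta>)" if "A \<subseteq> Bk"
      for A
    using that
  proof (induction A rule: infinite_finite_induct)
    case (insert j A)
    have "cls (gen j) \<otimes>\<^bsub>U\<^esub> cls (T j) \<in> env_right_ideal scale part br (fixed_subalgebra \<theta>)"
      unfolding env_right_ideal_def
      using insert.prems Bk_fixed by (intro ideal_prod.prod) (auto simp: env_map_def)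
    then show ?case
      using insert ideal_prod.sum unfolding env_right_ideal_def
      by (fastforce simp: cls_mult simp flip: cls_add)
  next
    \<comment> \<open>\<open>ideal_prod\<close> is generated by products and sums alone, so the zero
      class, the value of an empty sum, has to be exhibited as a product.\<close>
    have "cls (gen 0) \<otimes>\<^bsub>U\<^esub> cls 0 \<in> env_right_ideal scale part br (fixed_subalgebra \<theta>)"
      unfolding env_right_ideal_def using zero_fixed by (intro ideal_prod.prod) (auto simp:
          env_map_def)
    then have *: "cls 0 \<in> env_right_ideal scale part br (fixed_subalgebra \<theta>)"
      by (simp add: cls_mult)
    {
      case empty
      then show ?case using * by simp
    next
      case (infinite A)
      then show ?case using * by simp
    }
  qed
  then show ?thesis by blast
qed

lemma cls_in_left_ideal: "cls (\<Sum>j\<in>Bk. T j * gen j) \<in>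
    env_left_ideal scale part br (fixed_subalgebra \<theta>)"
proof -
  have "cls (\<Sum>j\<in>A. T j * gen j) \<in> env_left_ideal scale part br (fixed_subalgebra \<theta>)" if "A \<subseteq> Bk"
      for A
    using that
  proof (induction A rule: infinite_finite_induct)
    case (insert j A)
    have "cls (T j) \<otimes>\<^bsub>U\<^esub> cls (gen j) \<in> env_left_ideal scale part br (fixed_subalgebra \<theta>)"
      unfolding env_left_ideal_def
      using insert.prems Bk_fixed by (intro ideal_prod.prod) (auto simp: env_map_def)
    then show ?case
      using insert ideal_prod.sum unfolding env_left_ideal_def
      by (fastforce simp: cls_mult simp flip: cls_add)
  next
    have "cls 0 \<otimes>\<^bsub>U\<^esub> cls (gen 0) \<in> env_left_ideal scale part br (fixed_subalgebra \<theta>)"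
      unfolding env_left_ideal_def using zero_fixed by (intro ideal_prod.prod) (auto simp:
          env_map_def)
    then have *: "cls 0 \<in> env_left_ideal scale part br (fixed_subalgebra \<theta>)"
      by (simp add: cls_mult)
    {
      case empty
      then show ?case using * by simp
    next
      case (infinite A)
      then show ?case using * by simp
    }
  qed
  then show ?thesis by blast
qed

theorem invariants_right_ideal_eq_left_ideal:
  assumes "\<And>x. x \<in> fixed_subalgebra \<theta> \<Longrightarrow> supertrace_on (fixed_subalgebra \<theta>) (br x) = 0"
  shows "env_invariants scale part br (fixed_subalgebra \<theta>) \<inter> env_right_ideal scale part br
      (fixed_subalgebra \<theta>) =
    env_invariants scale part br (fixed_subalgebra \<theta>) \<inter> env_left_ideal scale part br
        (fixed_subalgebra \<theta>)"
proof -
  interpret AB: adapted_basis scale part br Bk Bp par coeff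
    by (rule adapted_basis[OF assms])
  have inv: "AB.ad b t \<in> J" if t: "cls t \<in>
      env_invariants scale part br (fixed_subalgebra \<theta>)" and b: "b \<in> Bk" for t b
  proof -
    have bp: "b \<in> part (par b)" using AB.par b by blast
    have "cls (\<Sum>i\<in>{0, 1}. gen (component part i b) * t - eps i t * gen (component part i b)) =
        cls 0"
      using t Bk_fixed[OF b] by (simp add: env_invariants_def env_ad_cls cls_zero)
    then have "(\<Sum>i\<in>{0, 1}. gen (component part i b) * t - eps i t * gen (component part i b)) \<in> J"
      by (simp add: cls_eq_iff cong_0_iff)
    \<comment> \<open>A basis letter is homogeneous; the summand of the other parity involves
      \<open>gen 0\<close>, which is zero only modulo \<open>J\<close>.\<close>
    moreover have "AB.ad b t \<approx>
        (\<Sum>i\<in>{0, 1}. gen (component part i b) * t - eps i t * gen (component part i b))"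
    proof -
      have 0: "gen 0 * t - eps i t * gen 0 \<approx> 0" for i
        using cong_diff[OF cong_mult[OF gen_0 cong_refl[of t]] cong_mult[OF cong_refl[of
            "eps i t"] gen_0]] by simp
      show ?thesis
        using cong_add[OF cong_refl[of "AB.ad b t"] cong_sym[OF 0, of 0]]
          cong_add[OF cong_refl[of "AB.ad b t"] cong_sym[OF 0, of 1]]
        by (cases "par b") (simp_all add: component_of_part[OF bp] AB.ad_def add.commute)
    qed
    ultimately show ?thesis using cong_J_iff by blast
  qed
  show ?thesis
  proof (intro equalityI subsetI IntI; elim IntE)
    fix u assume u: "u \<in> env_invariants scale part br (fixed_subalgebra \<theta>)"
      "u \<in> env_right_ideal scale part br (fixed_subalgebra \<theta>)"
    then obtain t T where t: "u = cls t" "t \<approx> (\<Sum>j\<in>Bk. gen j * T j)"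
      using right_ideal_cls by blast
    then obtain T' where "t \<approx> (\<Sum>j\<in>Bk. T' j * gen j)"
      using AB.invariant_left_to_right[OF t(2)] inv u(1) by blast
    then show "u \<in> env_left_ideal scale part br (fixed_subalgebra \<theta>)"
      using t(1) cls_in_left_ideal by (metis cls_eq_iff)
  next
    fix u assume u: "u \<in> env_invariants scale part br (fixed_subalgebra \<theta>)"
      "u \<in> env_left_ideal scale part br (fixed_subalgebra \<theta>)"
    then obtain t T where t: "u = cls t" "t \<approx> (\<Sum>j\<in>Bk. T j * gen j)"
      using left_ideal_cls by blast
    then obtain T' where "t \<approx> (\<Sum>j\<in>Bk. gen j * T' j)"
      using AB.invariant_right_to_left[OF t(2)] inv u(1) by blast
    then show "u \<in> env_right_ideal scale part br (fixed_subalgebra \<theta>)"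
      using t(1) cls_in_right_ideal by (metis cls_eq_iff)
  qed
qed

end

theorem proposition7p1:
  fixes scale :: "complex \<Rightarrow> 'g::ab_group_add \<Rightarrow> 'g"
    and part :: "bit \<Rightarrow> 'g set"
    and br :: "'g \<Rightarrow> 'g \<Rightarrow> 'g"
    and \<beta> :: "'g \<Rightarrow> 'g \<Rightarrow> complex"
    and \<theta> :: "'g \<Rightarrow> 'g"
  assumes "supersymmetric_pair scale part br \<beta> \<theta>"
    and "\<And>x. x \<in> fixed_subalgebra \<theta> \<Longrightarrow>
           super_vector_space.supertrace_on scale part (fixed_subalgebra \<theta>) (br x) = 0"
  shows "env_invariants scale part br (fixed_subalgebra \<theta>)
           \<inter> env_right_ideal scale part br (fixed_subalgebra \<theta>) =
         env_invariants scale part br (fixed_subalgebra \<theta>)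
           \<inter> env_left_ideal scale part br (fixed_subalgebra \<theta>)"
  using supersymmetric_pair.invariants_right_ideal_eq_left_ideal[OF assms] .

end
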